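(* Let $d\ge2$ and $m=\lfloor d/2\rfloor$. Then $\{\gamma_2,\dots,\gamma_{m+1}\}$ is a minimal set of generators of $\mathcal{A}(d)$ as a $\mathbb{Q}$-algebra, and $\{\delta_1,\dots,\delta_m\}$ is also a minimal set of generators of $\mathcal{A}(d)$ as a $\mathbb{Q}$-algebra.
   Context: For $\sigma$ in the symmetric group $\mathfrak{S}_d$ let $N(\sigma)$ (the norm) be the minimal number of transpositions whose product is $\sigma$ (equivalently, $d$ minus the number of cycles of $\sigma$, fixed points included). Let $\mathrm{grad}^N\mathbb{Q}[\mathfrak{S}_d]$ be the $\mathbb{Q}$-vector space with basis $\{[\sigma]:\sigma\in\mathfrak{S}_d\}$, with $[\sigma]$ of norm $N(\sigma)$, and with multiplication $[\sigma]\cdot[\tau]=[\sigma\tau]$ if $N(\sigma\tau)=N(\sigma)+N(\tau)$, and $[\sigma]\cdot[\tau]=0$ otherwise. $\mathcal{A}(d)$ is the (commutative) subalgebra of invariants under the conjugation action of $\mathfrak{S}_d$; by Lehn and Sorger it is isomorphic to $H^*(\mathrm{Hilb}^d(\mathbb{C}^2);\mathbb{Q})$, with elements of norm $j$ in cohomological degree $2j$. For $2\le i\le d$, $\gamma_i\in\mathcal{A}(d)$ is the sum of $[\sigma]$ over all $\sigma\in\mathfrak{S}_d$ whose cycle decomposition consists of one $i$-cycle and fixed points (norm $i-1$). For $1\le i\le m$, $\delta_i\in\mathcal{A}(d)$ is the sum of $[\sigma]$ over all $\sigma\in\mathfrak{S}_d$ whose cycle decomposition consists of $i$ transpositions and fixed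 points (norm $i$). *)

theory Defs
  imports Complex_Main "HOL-Algebra.Sym_Groups" "HOL-Algebra.Module"
begin

definition transpositions :: "nat \<Rightarrow> (nat \<Rightarrow> nat) set" where
  "transpositions d = {transpose a b |a b. a \<in> {1..d} \<and> b \<in> {1..d} \<and> a \<noteq> b}"

definition perm_norm :: "nat \<Rightarrow> (nat \<Rightarrow> nat) \<Rightarrow> nat" where
  "perm_norm d \<sigma> =
     (LEAST k. \<exists>ts. length ts = k \<and> set ts \<subseteq> transpositions d \<and> foldr (\<circ>) ts id = \<sigma>)"

text \<open>A vector with basis indexed by the symmetric group is represented by its coefficient
  function, vanishing off the group; \<open>basis_vec \<sigma>\<close> is \<open>[\<sigma>]\<close>.\<close>

definition basis_vec :: "(nat \<Rightarrow> nat) \<Rightarrow> (nat \<Rightarrow> nat) \<Rightarrow> rat" where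
  "basis_vec \<sigma> = (\<lambda>\<rho>. if \<rho> = \<sigma> then 1 else 0)"

definition basis_mult :: "nat \<Rightarrow> (nat \<Rightarrow> nat) \<Rightarrow> (nat \<Rightarrow> nat) \<Rightarrow> (nat \<Rightarrow> nat) \<Rightarrow> rat" where
  "basis_mult d \<sigma> \<tau> =
     (if perm_norm d (\<sigma> \<otimes>\<^bsub>sym_group d\<^esub> \<tau>) = perm_norm d \<sigma> + perm_norm d \<tau>
      then basis_vec (\<sigma> \<otimes>\<^bsub>sym_group d\<^esub> \<tau>) else (\<lambda>_. 0))"

definition grad_group_algebra :: "nat \<Rightarrow> (rat, (nat \<Rightarrow> nat) \<Rightarrow> rat) module" where
  "grad_group_algebra d =
     \<lparr> carrier = {f. \<forall>\<sigma>. \<sigma> \<notin> carrier (sym_group d) \<longrightarrow> f \<sigma> = 0},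
       mult = (\<lambda>f g \<rho>. \<Sum>\<sigma>\<in>carrier (sym_group d). \<Sum>\<tau>\<in>carrier (sym_group d).
                         f \<sigma> * g \<tau> * basis_mult d \<sigma> \<tau> \<rho>),
       one = basis_vec \<one>\<^bsub>sym_group d\<^esub>,
       zero = (\<lambda>_. 0),
       add = (\<lambda>f g \<rho>. f \<rho> + g \<rho>),
       smult = (\<lambda>c f \<rho>. c * f \<rho>) \<rparr>"

text \<open>The linear extension of \<open>[\<sigma>] \<mapsto> [\<pi> \<sigma> \<pi>\<^sup>-\<^sup>1]\<close>.\<close>

definition conj_action ::
    "nat \<Rightarrow> (nat \<Rightarrow> nat) \<Rightarrow> ((nat \<Rightarrow> nat) \<Rightarrow> rat) \<Rightarrow> (nat \<Rightarrow> nat) \<Rightarrow> rat" where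
  "conj_action d \<pi> f =
     (\<lambda>\<rho>. \<Sum>\<sigma>\<in>carrier (sym_group d).
        f \<sigma> * basis_vec (\<pi> \<otimes>\<^bsub>sym_group d\<^esub> \<sigma> \<otimes>\<^bsub>sym_group d\<^esub> inv\<^bsub>sym_group d\<^esub> \<pi>) \<rho>)"

definition invariant_algebra :: "nat \<Rightarrow> (rat, (nat \<Rightarrow> nat) \<Rightarrow> rat) module" where
  "invariant_algebra d = (grad_group_algebra d)
     \<lparr> carrier := {f \<in> carrier (grad_group_algebra d).
                    \<forall>\<pi>\<in>carrier (sym_group d). conj_action d \<pi> f = f} \<rparr>"

text \<open>The disjoint cycle decomposition of \<open>\<sigma>\<close> consists of cycles whose lengths are listed in
  \<open>ls\<close>, together with fixed points. The entries of \<open>ls\<close> are meant to be at least 2.\<close>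

definition has_cycle_lengths :: "nat \<Rightarrow> nat list \<Rightarrow> (nat \<Rightarrow> nat) \<Rightarrow> bool" where
  "has_cycle_lengths d ls \<sigma> \<longleftrightarrow>
     (\<exists>css. map length css = ls \<and> distinct (concat css) \<and> set (concat css) \<subseteq> {1..d} \<and>
            \<sigma> = foldr (\<circ>) (map cycle_of_list css) id)"

definition cycle_class_sum :: "nat \<Rightarrow> nat list \<Rightarrow> (nat \<Rightarrow> nat) \<Rightarrow> rat" where
  "cycle_class_sum d ls =
     (\<lambda>\<rho>. \<Sum>\<sigma>\<in>{\<sigma> \<in> carrier (sym_group d). has_cycle_lengths d ls \<sigma>}. basis_vec \<sigma> \<rho>)"

definition gamma_elt :: "nat \<Rightarrow> nat \<Rightarrow> (nat \<Rightarrow> nat) \<Rightarrow> rat" where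
  "gamma_elt d i = cycle_class_sum d [i]"

definition delta_elt :: "nat \<Rightarrow> nat \<Rightarrow> (nat \<Rightarrow> nat) \<Rightarrow> rat" where
  "delta_elt d i = cycle_class_sum d (replicate i 2)"

inductive_set subalgebra_generated ::
    "(rat, 'a, 'm) module_scheme \<Rightarrow> 'a set \<Rightarrow> 'a set" for M and S where
  one: "\<one>\<^bsub>M\<^esub> \<in> subalgebra_generated M S"
| incl: "x \<in> S \<Longrightarrow> x \<in> subalgebra_generated M S"
| add: "x \<in> subalgebra_generated M S \<Longrightarrow> y \<in> subalgebra_generated M S \<Longrightarrow>
    x \<oplus>\<^bsub>M\<^esub> y \<in> subalgebra_generated M S"
| mult: "x \<in> subalgebra_generated M S \<Longrightarrow> y \<in> subalgebra_generated M S \<Longrightarrow>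
    x \<otimes>\<^bsub>M\<^esub> y \<in> subalgebra_generated M S"
| smult: "x \<in> subalgebra_generated M S \<Longrightarrow> c \<odot>\<^bsub>M\<^esub> x \<in> subalgebra_generated M S"

definition generates_algebra :: "(rat, 'a, 'm) module_scheme \<Rightarrow> 'a set \<Rightarrow> bool" where
  "generates_algebra M S \<longleftrightarrow> S \<subseteq> carrier M \<and> subalgebra_generated M S = carrier M"

definition minimal_generating_set :: "(rat, 'a, 'm) module_scheme \<Rightarrow> 'a set \<Rightarrow> bool" where
  "minimal_generating_set M S \<longleftrightarrow>
     generates_algebra M S \<and> (\<forall>T. T \<subset> S \<longrightarrow> \<not> generates_algebra M T)"

end

theory Submission
  imports Defs "HOL-Combinatorics.Orbits" "HOL-Library.Function_Algebras" "HOL-Library.Multiset"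
begin

text \<open>
  Write \<open>\<gamma>\<^sub>i\<close> and \<open>\<delta>\<^sub>i\<close> for the class sums \<open>gamma_elt d i\<close> and \<open>delta_elt d i\<close>. The theorem rests on three facts.

  First, all \<open>\<gamma>\<^sub>i\<close> together generate (\<open>generated_by_all_gamma\<close>): modulo classes moving fewer points, every class
  sum is a multiple of the product of one \<open>\<gamma>\<^sub>i\<close> and the class sum of a permutation with one cycle less.

  Second, there is a Newton identity (\<open>newton_identity\<close>)
  \<open>2 j \<delta>\<^sub>j = (\<Sum>k=1..j. c\<^sub>k \<gamma>\<^bsub>k+1\<^esub> \<delta>\<^bsub>j-k\<^esub>)\<close> in which no \<open>c\<^sub>k\<close> vanishes. Up to sums of products of elements of smaller
  norm, \<open>\<delta>\<^sub>j\<close> is therefore a nonzero multiple of \<open>\<gamma>\<^bsub>j+1\<^esub>\<close>. For \<open>2 j > d\<close> the left-hand side is zero, so the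
  long cycles are polynomials in the short ones, and both families of \<open>d div 2\<close> elements generate. To prove
  the identity, fix a point \<open>x\<close>, let \<open>T\<close> be the sum of the transpositions moving \<open>x\<close>, and let \<open>Z\<^bsub>n,j\<^esub>\<close> be the sum of
  all permutations in which \<open>x\<close> lies on a cycle of length \<open>n + 1\<close> and the other points form \<open>j\<close> transpositions
  and fixed points. In the graded algebra \<open>T Z\<^bsub>n,j\<^esub> = Z\<^bsub>n+1,j\<^esub> + Z\<^bsub>n+2,j-1\<^esub>\<close>, as the cycle of \<open>x\<close> can only absorb a fixed
  point or a transposition. Together with \<open>\<delta>\<^sub>j = Z\<^bsub>0,j\<^esub> + Z\<^bsub>1,j-1\<^esub>\<close> this determines \<open>Z\<^bsub>0,j\<^esub>\<close> as a combination of
  the \<open>T\<^sup>r \<delta>\<^bsub>j-r\<^esub>\<close> with signed Catalan numbers as coefficients, and summation over \<open>x\<close> turns \<open>T\<^sup>r\<close>, for \<open>r > 0\<close>, into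
  \<open>(r + 1) \<gamma>\<^bsub>r+1\<^esub>\<close> and \<open>Z\<^bsub>0,j\<^esub>\<close> into \<open>(d - 2 j) \<delta>\<^sub>j\<close>.

  Third, no generator can be dropped (\<open>not_generating\<close>). Both families have exactly one element in each norm
  \<open>k\<close> with \<open>1 \<le> k \<le> d div 2\<close>, and in such a norm every partition of \<open>k\<close> is the type of a conjugacy class. Without the generator
  of norm \<open>k\<close>, the number of commutative monomials of norm \<open>k\<close> is one less than the number of partitions of \<open>k\<close>.
\<close>

section \<open>The norm counts orbits\<close>

lemma orbit_closed:
  assumes "f y \<in> C" and "\<And>z. z \<in> C \<Longrightarrow> f z \<in> C"
  shows "orbit f y \<subseteq> C"
proof
  fix z assume "z \<in> orbit f y"
  then show "z \<in> C" by induction (use assms in auto)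
qed

lemma orbit_eq_of_mem:
  assumes "permutation f" "y \<in> orbit f x"
  shows "orbit f y = orbit f x"
  using assms by (meson orbit_cyclic_eq3 cyclic_on_def permutation_self_in_orbit orbit_swap orbit_trans subsetI subset_antisym)

lemma orbit_transpose_half:
  assumes "permutation \<sigma>" "a \<notin> orbit \<sigma> x"
  shows "orbit \<sigma> a \<union> orbit \<sigma> x \<subseteq> orbit (transpose a x \<circ> \<sigma>) a"
proof -
  define \<tau> where "\<tau> = transpose a x \<circ> \<sigma>"
  have perm: "permutation \<tau>"
    unfolding \<tau>_def using assms(1) by (intro permutation_compose) (auto simp: permutation_swap_id)
  have *: "orbit \<sigma> b \<subseteq> orbit \<tau> b \<and> c \<in> orbit \<tau> b"
    if bc: "{b, c} = {a, x}" "c \<notin> orbit \<sigma> b" for b c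
  proof -
    have \<tau>: "\<tau> z = (if \<sigma> z = b then c else if \<sigma> z = c then b else \<sigma> z)" for z
      using bc(1) unfolding \<tau>_def transpose_def by (auto simp: doubleton_eq_iff)
    have sub: "orbit \<sigma> b \<subseteq> orbit \<tau> b"
    proof
      fix z assume "z \<in> orbit \<sigma> b"
      then show "z \<in> orbit \<tau> b"
      proof induction
        case base
        have "\<sigma> b \<noteq> c" using bc(2) orbit.base by metis
        then show ?case
          using \<tau>[of b] permutation_self_in_orbit[OF perm, of b] orbit.base[of \<tau> b] by metis
      next
        case (step z)
        have "\<sigma> z \<noteq> c" using bc(2) step(1) orbit.step by metis
        then show ?case
          using \<tau>[of z] permutation_self_in_orbit[OF perm, of b] orbit.step[OF step(2)] by metis
      qed
    qed
    obtain u where u: "u \<in> orbit \<sigma> b" "\<sigma> u = b"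
    proof -
      have "b \<in> orbit \<sigma> b" using permutation_self_in_orbit[OF assms(1)] .
      then show ?thesis
      proof cases
        case base
        then show ?thesis using that permutation_self_in_orbit[OF assms(1)] by metis
      next
        case (step z) then show ?thesis using that by metis
      qed
    qed
    have "\<tau> u = c" using \<tau> u by simp
    then show ?thesis using sub u orbit.step[of u \<tau> b] by auto
  qed
  have "x \<notin> orbit \<sigma> a"
    using assms permutation_self_in_orbit orbit_swap by metis
  then have 1: "orbit \<sigma> a \<subseteq> orbit \<tau> a" "x \<in> orbit \<tau> a" using *[of a x] by auto
  have "orbit \<sigma> x \<subseteq> orbit \<tau> x" using *[of x a] assms(2) by auto
  moreover have "orbit \<tau> x = orbit \<tau> a" using orbit_eq_of_mem[OF perm 1(2)] .
  ultimately show ?thesis using 1 unfolding \<tau>_def by simp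
qed

text \<open>Left multiplication by a transposition of points in different orbits fuses the two orbits:
  walking from \<open>a\<close> one runs through the orbit of \<open>a\<close> until the step that would return to \<open>a\<close>, which is
  redirected to \<open>x\<close>, and then through the orbit of \<open>x\<close>. This fact and its counterpart below carry
  all information about the norm.\<close>

lemma orbit_transpose_merge:
  assumes "permutation \<sigma>" "a \<notin> orbit \<sigma> x"
  shows "orbit (transpose a x \<circ> \<sigma>) y =
    (if y \<in> orbit \<sigma> a \<union> orbit \<sigma> x then orbit \<sigma> a \<union> orbit \<sigma> x else orbit \<sigma> y)"
proof -
  define \<tau> where "\<tau> = transpose a x \<circ> \<sigma>"
  have \<tau>: "\<tau> z = (if \<sigma> z = a then x else if \<sigma> z = x then a else \<sigma> z)" for z
    unfolding \<tau>_def transpose_def by auto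
  have perm: "permutation \<tau>"
    unfolding \<tau>_def using assms(1) by (intro permutation_compose) (auto simp: permutation_swap_id)
  have self: "z \<in> orbit \<sigma> z" for z using permutation_self_in_orbit[OF assms(1)] .
  have eq: "orbit \<tau> a = orbit \<sigma> a \<union> orbit \<sigma> x"
  proof
    show "orbit \<sigma> a \<union> orbit \<sigma> x \<subseteq> orbit \<tau> a"
      using orbit_transpose_half[OF assms] unfolding \<tau>_def .
    have "\<tau> z \<in> orbit \<sigma> a \<union> orbit \<sigma> x" if "z \<in> orbit \<sigma> a \<union> orbit \<sigma> x" for z
      using that \<tau>[of z] self[of a] self[of x] orbit.step[of z \<sigma> a] orbit.step[of z \<sigma> x] by auto
    then show "orbit \<tau> a \<subseteq> orbit \<sigma> a \<union> orbit \<sigma> x"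
      using self by (intro orbit_closed) auto
  qed
  show ?thesis
  proof (cases "y \<in> orbit \<sigma> a \<union> orbit \<sigma> x")
    case True
    then show ?thesis using eq orbit_eq_of_mem[OF perm, of y a] unfolding \<tau>_def by simp
  next
    case False
    have ne: "\<sigma> z \<noteq> a \<and> \<sigma> z \<noteq> x" if "z \<in> orbit \<sigma> y \<or> z = y" for z
    proof -
      have "\<sigma> z \<in> orbit \<sigma> y" using that orbit.intros by metis
      then have "orbit \<sigma> (\<sigma> z) = orbit \<sigma> y" using orbit_eq_of_mem[OF assms(1)] by auto
      then show ?thesis using False self[of y] by auto
    qed
    have "orbit \<tau> y = orbit \<sigma> y"
    proof
      show "orbit \<tau> y \<subseteq> orbit \<sigma> y"
        using ne \<tau> orbit.base[of \<sigma> y] orbit.step[of _ \<sigma> y] by (intro orbit_closed) auto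
      show "orbit \<sigma> y \<subseteq> orbit \<tau> y"
      proof
        fix z assume "z \<in> orbit \<sigma> y"
        then show "z \<in> orbit \<tau> y"
        proof induction
          case base then show ?case using ne[of y] \<tau>[of y] orbit.base[of \<tau> y] by simp
        next
          case (step z)
          then show ?case using ne[of z] \<tau>[of z] orbit.step[of z \<tau> y] by simp
        qed
      qed
    qed
    then show ?thesis using False unfolding \<tau>_def by simp
  qed
qed

text \<open>The points visited on the way from \<open>x\<close> to the first occurrence of \<open>a\<close> become closed, because the
  step into \<open>a\<close> is redirected back to \<open>x\<close>. Minimality of the exponent \<open>n\<close> keeps \<open>a\<close> out of this set.\<close>

lemma orbit_transpose_split:
  assumes "permutation \<sigma>" "a \<in> orbit \<sigma> x" "a \<noteq> x"
  shows "a \<notin> orbit (transpose a x \<circ> \<sigma>) x"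
proof -
  define \<tau> where "\<tau> = transpose a x \<circ> \<sigma>"
  have \<tau>: "\<tau> z = (if \<sigma> z = a then x else if \<sigma> z = x then a else \<sigma> z)" for z
    unfolding \<tau>_def transpose_def by auto
  define n where "n = (LEAST n. (\<sigma> ^^ n) x = a)"
  have "\<exists>n. (\<sigma> ^^ n) x = a" using assms(2) unfolding orbit_altdef by auto
  then have n: "(\<sigma> ^^ n) x = a" unfolding n_def by (rule LeastI_ex)
  have least: "(\<sigma> ^^ i) x \<noteq> a" if "i < n" for i
    using that not_less_Least unfolding n_def by metis
  have ret: "(\<sigma> ^^ i) x \<noteq> x" if "0 < i" "i \<le> n" for i
  proof
    assume "(\<sigma> ^^ i) x = x"
    then have "(\<sigma> ^^ (n - i)) x = (\<sigma> ^^ (n - i)) ((\<sigma> ^^ i) x)" by simp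
    also have "\<dots> = (\<sigma> ^^ (n - i + i)) x" by (metis comp_apply funpow_add)
    also have "\<dots> = a" using that n by simp
    finally show False using least[of "n - i"] that by simp
  qed
  have n0: "n > 0" using n assms(3) by (cases n) auto
  define C where "C = (\<lambda>i. (\<sigma> ^^ i) x) ` {..<n}"
  have x: "x \<in> C" unfolding C_def using n0 by (force intro: image_eqI[of _ _ 0])
  have cl: "\<tau> z \<in> C" if zC: "z \<in> C" for z
  proof -
    obtain i where i: "i < n" "z = (\<sigma> ^^ i) x" using zC unfolding C_def by auto
    then have s: "\<sigma> z = (\<sigma> ^^ Suc i) x" by simp
    show ?thesis
    proof (cases "Suc i = n")
      case True then show ?thesis using \<tau>[of z] s n x by simp
    next
      case False
      then have "Suc i < n" using i by simp
      then have "\<tau> z = (\<sigma> ^^ Suc i) x" using \<tau>[of z] s least[of "Suc i"] ret[of "Suc i"] by simp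
      with \<open>Suc i < n\<close> show ?thesis unfolding C_def by (metis image_eqI lessThan_iff)
    qed
  qed
  have "orbit \<tau> x \<subseteq> C" using cl x by (intro orbit_closed) auto
  moreover have "a \<notin> C" using least unfolding C_def by auto
  ultimately show ?thesis unfolding \<tau>_def by auto
qed

definition orbit_count :: "nat \<Rightarrow> (nat \<Rightarrow> nat) \<Rightarrow> nat" where
  "orbit_count d \<sigma> = card (orbit \<sigma> ` {1..d})"

lemma permutation_of_permutes: "\<sigma> permutes {1..d::nat} \<Longrightarrow> permutation \<sigma>"
  unfolding permutation_permutes by auto

lemma orbit_count_le: "orbit_count d \<sigma> \<le> d"
  unfolding orbit_count_def using card_image_le[of "{1..d}" "orbit \<sigma>"] by simp

lemma orbit_count_id: "orbit_count d id = d"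
proof -
  have "orbit id x = {x}" for x :: nat by (simp add: orbit_eq_singleton_iff)
  then have "orbit id ` {1..d} = (\<lambda>x. {x}) ` {1..d}" by auto
  then show ?thesis unfolding orbit_count_def by (simp add: card_image)
qed

lemma orbit_count_merge:
  assumes "\<sigma> permutes {1..d}" "a \<in> {1..d}" "x \<in> {1..d}" "a \<notin> orbit \<sigma> x"
  shows "orbit_count d \<sigma> = Suc (orbit_count d (transpose a x \<circ> \<sigma>))"
proof -
  have perm: "permutation \<sigma>" using permutation_of_permutes[OF assms(1)] .
  have self: "z \<in> orbit \<sigma> z" for z using permutation_self_in_orbit[OF perm] .
  let ?A = "orbit \<sigma> a" and ?B = "orbit \<sigma> x"
  define R where "R = orbit \<sigma> ` ({1..d} - (?A \<union> ?B))"
  have AB: "?A \<noteq> ?B" using self[of a] assms(4) by auto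
  have \<tau>: "orbit (transpose a x \<circ> \<sigma>) ` {1..d} = insert (?A \<union> ?B) R"
    unfolding R_def orbit_transpose_merge[OF perm assms(4)]
    using assms(2) self[of a] by (auto simp: image_iff)
  have \<sigma>: "orbit \<sigma> ` {1..d} = insert ?A (insert ?B R)"
  proof
    show "orbit \<sigma> ` {1..d} \<subseteq> insert ?A (insert ?B R)"
      unfolding R_def using orbit_eq_of_mem[OF perm] by (auto simp: image_iff)
  qed (use assms in \<open>auto simp: R_def\<close>)
  have mem: "z \<notin> ?A \<union> ?B" if zS: "z \<in> S" and SR: "S \<in> R" for z S
  proof -
    obtain y where y: "y \<notin> ?A \<union> ?B" "S = orbit \<sigma> y" using SR unfolding R_def by auto
    have "orbit \<sigma> z = S" using y(2) zS orbit_eq_of_mem[OF perm] by simp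
    then have "y \<in> orbit \<sigma> z" using y(2) self[of y] by simp
    then show ?thesis using y(1) orbit_eq_of_mem[OF perm, of z] by auto
  qed
  have "?A \<notin> R" "?B \<notin> R" "?A \<union> ?B \<notin> R"
    using mem[of a] mem[of x] self[of a] self[of x] by auto
  moreover have "finite R" unfolding R_def by simp
  ultimately show ?thesis unfolding orbit_count_def \<sigma> \<tau> using AB by simp
qed

lemma transpose_comp_permutes:
  assumes "\<sigma> permutes {1..d}" "a \<in> {1..d}" "x \<in> {1..d::nat}"
  shows "transpose a x \<circ> \<sigma> permutes {1..d}"
  using assms by (intro permutes_compose permutes_swap_id)

lemma orbit_count_split:
  assumes "\<sigma> permutes {1..d}" "a \<in> {1..d}" "x \<in> {1..d}" "a \<in> orbit \<sigma> x" "a \<noteq> x"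
  shows "orbit_count d (transpose a x \<circ> \<sigma>) = Suc (orbit_count d \<sigma>)"
proof -
  have perm: "permutation \<sigma>" using permutation_of_permutes[OF assms(1)] .
  have "transpose a x \<circ> (transpose a x \<circ> \<sigma>) = \<sigma>" by (simp add: fun_eq_iff)
  then show ?thesis
    using orbit_count_merge[OF transpose_comp_permutes[OF assms(1-3)] assms(2,3)]
      orbit_transpose_split[OF perm assms(4,5)] by simp
qed

lemma foldr_comp_Cons: "foldr (\<circ>) (t # ts) id = t \<circ> foldr (\<circ>) ts id"
  by (subst foldr_Cons) (rule o_apply)

lemma transpositions_word_permutes:
  assumes "set ts \<subseteq> transpositions d"
  shows "foldr (\<circ>) ts id permutes {1..d}"
  using assms
proof (induction ts)
  case (Cons t ts)
  then obtain a b where "t = transpose a b" "a \<in> {1..d}" "b \<in> {1..d}"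
    by (auto simp: transpositions_def)
  moreover have "set ts \<subseteq> transpositions d" using Cons.prems by simp
  from Cons.IH[OF this] have "foldr (\<circ>) ts id permutes {1..d}" .
  ultimately have "t \<circ> foldr (\<circ>) ts id permutes {1..d}" using transpose_comp_permutes by blast
  then show ?case unfolding foldr_comp_Cons .
qed (simp add: permutes_id)

lemma orbit_count_word:
  assumes "set ts \<subseteq> transpositions d"
  shows "d \<le> length ts + orbit_count d (foldr (\<circ>) ts id)"
  using assms
proof (induction ts)
  case (Cons t ts)
  then obtain a b where t: "t = transpose a b" "a \<in> {1..d}" "b \<in> {1..d}" "a \<noteq> b"
    by (auto simp: transpositions_def)
  define \<rho> where "\<rho> = foldr (\<circ>) ts id"
  have perm: "\<rho> permutes {1..d}"
    unfolding \<rho>_def using Cons.prems transpositions_word_permutes by simp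
  have "orbit_count d \<rho> \<le> Suc (orbit_count d (t \<circ> \<rho>))"
    using t orbit_count_merge[OF perm t(2,3)] orbit_count_split[OF perm t(2,3)]
    by (cases "a \<in> orbit \<rho> b") auto
  moreover have "set ts \<subseteq> transpositions d" using Cons.prems by simp
  from Cons.IH[OF this] have "d \<le> length ts + orbit_count d \<rho>" unfolding \<rho>_def .
  ultimately have "d \<le> length (t # ts) + orbit_count d (t \<circ> \<rho>)" by simp
  then show ?case unfolding foldr_comp_Cons \<rho>_def .
qed (simp add: orbit_count_id)

text \<open>The transposition exchanging \<open>x\<close> and its image always splits an orbit, so a factorization reaches
  the identity after exactly \<open>d\<close> minus the number of orbits steps.\<close>

lemma short_word_exists:
  assumes "\<sigma> permutes {1..d}"
  shows "\<exists>ts. length ts + orbit_count d \<sigma> = d \<and> set ts \<subseteq> transpositions d \<and> foldr (\<circ>) ts id = \<sigma>"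
  using assms
proof (induction "d - orbit_count d \<sigma>" arbitrary: \<sigma> rule: less_induct)
  case less
  show ?case
  proof (cases "\<sigma> = id")
    case True then show ?thesis by (intro exI[of _ "[]"]) (simp add: orbit_count_id)
  next
    case False
    then obtain x where x: "\<sigma> x \<noteq> x" by (auto simp: fun_eq_iff)
    have xd: "x \<in> {1..d}" using x less.prems by (metis permutes_not_in)
    have ad: "\<sigma> x \<in> {1..d}" using xd less.prems by (metis permutes_in_image)
    have c: "orbit_count d (transpose (\<sigma> x) x \<circ> \<sigma>) = Suc (orbit_count d \<sigma>)"
      using orbit_count_split[OF less.prems ad xd] x by (simp add: orbit.base)
    have "Suc (orbit_count d \<sigma>) \<le> d" using c orbit_count_le[of d "transpose (\<sigma> x) x \<circ> \<sigma>"] by simp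
    then have "d - orbit_count d (transpose (\<sigma> x) x \<circ> \<sigma>) < d - orbit_count d \<sigma>" using c by simp
    from less.hyps[OF this transpose_comp_permutes[OF less.prems ad xd]] c
    obtain ts where ts: "length ts + Suc (orbit_count d \<sigma>) = d" "set ts \<subseteq> transpositions d"
      "foldr (\<circ>) ts id = transpose (\<sigma> x) x \<circ> \<sigma>" by auto
    have "transpose (\<sigma> x) x \<in> transpositions d" using x xd ad by (auto simp: transpositions_def)
    moreover have "transpose (\<sigma> x) x \<circ> (transpose (\<sigma> x) x \<circ> \<sigma>) = \<sigma>" by (simp add: fun_eq_iff)
    ultimately show ?thesis
      using ts by (intro exI[of _ "transpose (\<sigma> x) x # ts"]) auto
  qed
qed

lemma perm_norm_orbit_count:
  assumes "\<sigma> permutes {1..d}"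
  shows "perm_norm d \<sigma> + orbit_count d \<sigma> = d"
proof -
  obtain ts where ts: "length ts + orbit_count d \<sigma> = d" "set ts \<subseteq> transpositions d"
    "foldr (\<circ>) ts id = \<sigma>" using short_word_exists[OF assms] by blast
  have "perm_norm d \<sigma> = length ts"
    unfolding perm_norm_def
  proof (rule Least_equality)
    show "\<exists>us. length us = length ts \<and> set us \<subseteq> transpositions d \<and> foldr (\<circ>) us id = \<sigma>"
      using ts by blast
  next
    fix k assume "\<exists>us. length us = k \<and> set us \<subseteq> transpositions d \<and> foldr (\<circ>) us id = \<sigma>"
    then show "length ts \<le> k" using orbit_count_word ts(1) by fastforce
  qed
  then show ?thesis using ts by simp
qed

lemma perm_norm_id: "perm_norm d id = 0"
  using perm_norm_orbit_count[OF permutes_id, of d] orbit_count_id[of d] by simp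

lemma perm_norm_merge:
  assumes "\<sigma> permutes {1..d}" "a \<in> {1..d}" "x \<in> {1..d}" "a \<notin> orbit \<sigma> x"
  shows "perm_norm d (transpose a x \<circ> \<sigma>) = Suc (perm_norm d \<sigma>)"
  using perm_norm_orbit_count[OF assms(1)] orbit_count_merge[OF assms]
    perm_norm_orbit_count[OF transpose_comp_permutes[OF assms(1-3)]] by simp

lemma perm_norm_split:
  assumes "\<sigma> permutes {1..d}" "a \<in> {1..d}" "x \<in> {1..d}" "a \<in> orbit \<sigma> x" "a \<noteq> x"
  shows "Suc (perm_norm d (transpose a x \<circ> \<sigma>)) = perm_norm d \<sigma>"
  using perm_norm_orbit_count[OF assms(1)] orbit_count_split[OF assms]
    perm_norm_orbit_count[OF transpose_comp_permutes[OF assms(1-3)]] by simp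

lemma perm_norm_witness:
  assumes "\<sigma> permutes {1..d}"
  obtains ts where "length ts = perm_norm d \<sigma>" "set ts \<subseteq> transpositions d" "foldr (\<circ>) ts id = \<sigma>"
  using short_word_exists[OF assms] perm_norm_orbit_count[OF assms] that by (metis add_right_cancel)

lemma perm_norm_le_word:
  "set ts \<subseteq> transpositions d \<Longrightarrow> perm_norm d (foldr (\<circ>) ts id) \<le> length ts"
  unfolding perm_norm_def by (rule Least_le) blast

lemma foldr_comp_append: "foldr (\<circ>) (us @ vs) id = foldr (\<circ>) us id \<circ> foldr (\<circ>) vs id"
  by (induction us) (auto simp: o_assoc)

lemma perm_norm_subadditive:
  assumes "\<sigma> permutes {1..d}" "\<tau> permutes {1..d}"
  shows "perm_norm d (\<sigma> \<circ> \<tau>) \<le> perm_norm d \<sigma> + perm_norm d \<tau>"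
proof -
  obtain us where us: "length us = perm_norm d \<sigma>" "set us \<subseteq> transpositions d"
    "foldr (\<circ>) us id = \<sigma>" using perm_norm_witness[OF assms(1)] .
  obtain vs where vs: "length vs = perm_norm d \<tau>" "set vs \<subseteq> transpositions d"
    "foldr (\<circ>) vs id = \<tau>" using perm_norm_witness[OF assms(2)] .
  show ?thesis
    using perm_norm_le_word[of "us @ vs" d] us vs foldr_comp_append[of us vs] by simp
qed

lemma perm_norm_conj:
  assumes "\<sigma> permutes {1..d}" "\<pi> permutes {1..d}"
  shows "perm_norm d (\<pi> \<circ> \<sigma> \<circ> inv' \<pi>) = perm_norm d \<sigma>"
proof -
  have le: "perm_norm d (\<pi> \<circ> \<sigma> \<circ> inv' \<pi>) \<le> perm_norm d \<sigma>"
    if s: "\<sigma> permutes {1..d}" and p: "\<pi> permutes {1..d}" for \<sigma> \<pi>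
  proof -
    obtain ts where ts: "length ts = perm_norm d \<sigma>" "set ts \<subseteq> transpositions d"
      "foldr (\<circ>) ts id = \<sigma>" using perm_norm_witness[OF s] .
    have b: "bij \<pi>" using permutes_bij[OF p] .
    define c where "c t = \<pi> \<circ> t \<circ> inv' \<pi>" for t
    have "foldr (\<circ>) (map c ts) id = c (foldr (\<circ>) ts id)"
      by (induction ts)
        (auto simp: c_def fun_eq_iff permutes_inverses[OF p])
    moreover have "set (map c ts) \<subseteq> transpositions d"
    proof
      fix t assume "t \<in> set (map c ts)"
      then obtain a e where t: "t = c (transpose a e)" "a \<in> {1..d}" "e \<in> {1..d}" "a \<noteq> e"
        using ts(2) by (auto simp: transpositions_def)
      have "c (transpose a e) = transpose (\<pi> a) (\<pi> e)"
        using conjugation_of_cycle[of "[a,e]" \<pi>] b t(4) by (simp add: c_def)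
      then show "t \<in> transpositions d"
        using t permutes_in_image[OF p] inj_eq[OF permutes_inj[OF p]]
        unfolding transpositions_def by blast
    qed
    ultimately show ?thesis using perm_norm_le_word[of "map c ts" d] ts by (simp add: c_def)
  qed
  have "inv' \<pi> \<circ> (\<pi> \<circ> \<sigma> \<circ> inv' \<pi>) \<circ> inv' (inv' \<pi>) = \<sigma>"
    by (simp add: fun_eq_iff permutes_inverses[OF assms(2)] inv_inv_eq[OF permutes_bij[OF assms(2)]])
  moreover have "\<pi> \<circ> \<sigma> \<circ> inv' \<pi> permutes {1..d}"
    using assms by (intro permutes_compose permutes_inv)
  ultimately show ?thesis
    using le[OF assms] le[OF _ permutes_inv[OF assms(2)], of "\<pi> \<circ> \<sigma> \<circ> inv' \<pi>"] by simp
qed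

lemma orbit_fixed: "\<sigma> a = a \<Longrightarrow> orbit \<sigma> a = {a}"
  by (simp add: orbit_eq_singleton_iff)

lemma cycle_permutes_superset:
  assumes "set cs \<subseteq> {1..d}" shows "cycle_of_list cs permutes {1..d}"
  using cycle_permutes permutes_subset assms by blast

text \<open>Adding the points of a cycle one at a time fuses a fixed point to the orbit in
  each step, so every step costs exactly one transposition.\<close>

lemma perm_norm_cycle_comp:
  assumes "distinct cs" "set cs \<subseteq> {1..d}" "\<rho> permutes {1..d}" "\<forall>y\<in>set cs. \<rho> y = y"
  shows "perm_norm d (cycle_of_list cs \<circ> \<rho>) = length cs - 1 + perm_norm d \<rho>"
  using assms
proof (induction cs rule: cycle_of_list.induct)
  case (1 i j cs)
  let ?r = "cycle_of_list (j # cs) \<circ> \<rho>"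
  have fixd: "?r i = i"
    using 1 id_outside_supp[of i "j # cs"] by auto
  have perm: "?r permutes {1..d}"
    using 1 cycle_permutes_superset[of "j # cs" d] by (intro permutes_compose) auto
  have "orbit ?r i = {i}" using orbit_fixed[of ?r i] fixd by simp
  then have "i \<notin> orbit ?r j"
    using orbit_swap[OF permutation_self_in_orbit[OF permutation_of_permutes[OF perm]], of i j] 1
    by auto
  then have "perm_norm d (transpose i j \<circ> ?r) = Suc (perm_norm d ?r)"
    using 1 by (intro perm_norm_merge[OF perm]) auto
  moreover have "perm_norm d ?r = length (j # cs) - 1 + perm_norm d \<rho>"
    by (rule "1.IH") (use "1.prems" in auto)
  ultimately have "perm_norm d (transpose i j \<circ> ?r) = length (i # j # cs) - 1 + perm_norm d \<rho>"
    by simp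
  then show ?case by (simp only: cycle_of_list.simps o_assoc)
qed auto

lemma perm_norm_cycle:
  assumes "distinct cs" "set cs \<subseteq> {1..d}"
  shows "perm_norm d (cycle_of_list cs) = length cs - 1"
  using perm_norm_cycle_comp[OF assms permutes_id] perm_norm_id[of d] by simp

section \<open>The graded group algebra and its invariants\<close>

abbreviation perms :: "nat \<Rightarrow> (nat \<Rightarrow> nat) set" where
  "perms d \<equiv> {\<sigma>. \<sigma> permutes {1..d}}"

text \<open>The product is taken on all coefficient functions, because the proof of the Newton identity
  multiplies elements that are not invariant, such as sums over the transpositions moving a given point.\<close>

definition gmul :: "nat \<Rightarrow> ((nat \<Rightarrow> nat) \<Rightarrow> rat) \<Rightarrow> ((nat \<Rightarrow> nat) \<Rightarrow> rat) \<Rightarrow> (nat \<Rightarrow> nat) \<Rightarrow> rat" where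
  "gmul d f g \<rho> = (\<Sum>\<sigma>\<in>perms d. \<Sum>\<tau>\<in>perms d. f \<sigma> * g \<tau> * basis_mult d \<sigma> \<tau> \<rho>)"

definition supported :: "nat \<Rightarrow> ((nat \<Rightarrow> nat) \<Rightarrow> rat) \<Rightarrow> bool" where
  "supported d f \<longleftrightarrow> (\<forall>\<sigma>. \<not> \<sigma> permutes {1..d} \<longrightarrow> f \<sigma> = 0)"

definition invariant :: "nat \<Rightarrow> ((nat \<Rightarrow> nat) \<Rightarrow> rat) \<Rightarrow> bool" where
  "invariant d f \<longleftrightarrow> supported d f \<and>
     (\<forall>\<pi> \<sigma>. \<pi> permutes {1..d} \<longrightarrow> \<sigma> permutes {1..d} \<longrightarrow> f (\<pi> \<circ> \<sigma> \<circ> inv' \<pi>) = f \<sigma>)"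

lemma finite_perms: "finite (perms d)"
  by (rule finite_permutations) simp

lemma carrier_sym_group: "carrier (sym_group d) = perms d"
  by (simp add: sym_group_def)

lemma basis_mult_eq:
  "basis_mult d \<sigma> \<tau> \<rho> =
     (if perm_norm d (\<sigma> \<circ> \<tau>) = perm_norm d \<sigma> + perm_norm d \<tau> \<and> \<rho> = \<sigma> \<circ> \<tau> then 1 else 0)"
  by (simp add: basis_mult_def basis_vec_def sym_group_mult)

lemma invariant_algebra_mult: "mult (invariant_algebra d) = gmul d"
  by (simp add: invariant_algebra_def grad_group_algebra_def carrier_sym_group gmul_def fun_eq_iff)

lemma invariant_algebra_one: "one (invariant_algebra d) = basis_vec id"
  by (simp add: invariant_algebra_def grad_group_algebra_def sym_group_one)

lemma invariant_algebra_add: "add (invariant_algebra d) = (\<lambda>f g \<rho>. f \<rho> + g \<rho>)"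
  by (simp add: invariant_algebra_def grad_group_algebra_def)

lemma invariant_algebra_smult: "smult (invariant_algebra d) = (\<lambda>c f \<rho>. c * f \<rho>)"
  by (simp add: invariant_algebra_def grad_group_algebra_def)

lemma permutes_conj:
  assumes "\<sigma> permutes A" "\<pi> permutes A"
  shows "\<pi> \<circ> \<sigma> \<circ> inv' \<pi> permutes A"
  using assms by (intro permutes_compose permutes_inv)

lemma conj_conj_inv:
  assumes "\<pi> permutes A"
  shows "inv' \<pi> \<circ> (\<pi> \<circ> \<sigma> \<circ> inv' \<pi>) \<circ> \<pi> = \<sigma>" "\<pi> \<circ> (inv' \<pi> \<circ> \<sigma> \<circ> \<pi>) \<circ> inv' \<pi> = \<sigma>"
  by (simp_all add: fun_eq_iff permutes_inverses[OF assms])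

lemma conj_action_eq:
  assumes \<pi>: "\<pi> permutes {1..d}" and f: "supported d f"
  shows "conj_action d \<pi> f = (\<lambda>\<rho>. f (inv' \<pi> \<circ> \<rho> \<circ> \<pi>))"
proof
  fix \<rho>
  have "conj_action d \<pi> f \<rho> = (\<Sum>\<sigma>\<in>perms d. f \<sigma> * basis_vec (\<pi> \<circ> \<sigma> \<circ> inv' \<pi>) \<rho>)"
    unfolding conj_action_def carrier_sym_group
    using \<pi> by (intro sum.cong refl) (simp add: sym_group_mult carrier_sym_group)
  also have "\<dots> = (\<Sum>\<sigma>\<in>perms d. if \<sigma> = inv' \<pi> \<circ> \<rho> \<circ> \<pi> then f \<sigma> else 0)"
  proof (intro sum.cong refl)
    fix \<sigma>
    have "\<rho> = \<pi> \<circ> \<sigma> \<circ> inv' \<pi> \<longleftrightarrow> \<sigma> = inv' \<pi> \<circ> \<rho> \<circ> \<pi>"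
      using conj_conj_inv[OF \<pi>] by metis
    then show "f \<sigma> * basis_vec (\<pi> \<circ> \<sigma> \<circ> inv' \<pi>) \<rho> = (if \<sigma> = inv' \<pi> \<circ> \<rho> \<circ> \<pi> then f \<sigma> else 0)"
      by (simp add: basis_vec_def)
  qed
  also have "\<dots> = f (inv' \<pi> \<circ> \<rho> \<circ> \<pi>)"
    using f finite_perms by (simp add: supported_def)
  finally show "conj_action d \<pi> f \<rho> = f (inv' \<pi> \<circ> \<rho> \<circ> \<pi>)" .
qed

lemma carrier_invariant_algebra: "carrier (invariant_algebra d) = {f. invariant d f}"
proof -
  have "(\<forall>\<pi>\<in>perms d. conj_action d \<pi> f = f) \<longleftrightarrow>
      (\<forall>\<pi> \<sigma>. \<pi> permutes {1..d} \<longrightarrow> \<sigma> permutes {1..d} \<longrightarrow> f (\<pi> \<circ> \<sigma> \<circ> inv' \<pi>) = f \<sigma>)"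
    (is "?L \<longleftrightarrow> ?R") if f: "supported d f" for f
  proof
    assume L: ?L
    show ?R
    proof (intro allI impI)
      fix \<pi> \<sigma> assume p: "\<pi> permutes {1..d}" "\<sigma> permutes {1..d}"
      have "f (\<pi> \<circ> \<sigma> \<circ> inv' \<pi>) = conj_action d \<pi> f (\<pi> \<circ> \<sigma> \<circ> inv' \<pi>)" using L p by simp
      then show "f (\<pi> \<circ> \<sigma> \<circ> inv' \<pi>) = f \<sigma>"
        using conj_action_eq[OF p(1) f] conj_conj_inv(1)[OF p(1)] by simp
    qed
  next
    assume R: ?R
    show ?L
    proof
      fix \<pi> assume "\<pi> \<in> perms d"
      then have p: "\<pi> permutes {1..d}" by simp
      have "f (inv' \<pi> \<circ> \<rho> \<circ> \<pi>) = f \<rho>" for \<rho>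
      proof (cases "\<rho> permutes {1..d}")
        case True
        then have "inv' \<pi> \<circ> \<rho> \<circ> \<pi> permutes {1..d}"
          using p by (intro permutes_compose permutes_inv)
        then show ?thesis using R p conj_conj_inv(2)[OF p] by metis
      next
        case False
        then have "\<not> inv' \<pi> \<circ> \<rho> \<circ> \<pi> permutes {1..d}"
          using permutes_conj[of "inv' \<pi> \<circ> \<rho> \<circ> \<pi>" "{1..d}" \<pi>] p conj_conj_inv(2)[OF p] by metis
        then show ?thesis using f False by (simp add: supported_def)
      qed
      then show "conj_action d \<pi> f = f" using conj_action_eq[OF p f] by simp
    qed
  qed
  then show ?thesis
    unfolding invariant_algebra_def grad_group_algebra_def invariant_def supported_def carrier_sym_group
    by auto
qed

lemma invariantD: "invariant d f \<Longrightarrow> supported d f"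
  by (simp add: invariant_def)

lemma supported_basis_vec: "\<sigma> permutes {1..d} \<Longrightarrow> supported d (basis_vec \<sigma>)"
  by (auto simp: supported_def basis_vec_def)

lemma supported_sum: "(\<And>i. i \<in> I \<Longrightarrow> supported d (F i)) \<Longrightarrow> supported d (\<lambda>\<rho>. \<Sum>i\<in>I. F i \<rho>)"
  by (simp add: supported_def)

lemma basis_vec_id_invariant: "invariant d (basis_vec id)"
proof -
  have "basis_vec id (\<pi> \<circ> \<sigma> \<circ> inv' \<pi>) = basis_vec id \<sigma>" if p: "\<pi> permutes {1..d}" for \<pi> \<sigma>
  proof -
    have "\<pi> \<circ> \<sigma> \<circ> inv' \<pi> = id \<longleftrightarrow> \<sigma> = id"
    proof
      assume "\<pi> \<circ> \<sigma> \<circ> inv' \<pi> = id"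
      then have "\<sigma> = inv' \<pi> \<circ> id \<circ> \<pi>" using conj_conj_inv(1)[OF p, of \<sigma>] by simp
      then show "\<sigma> = id" by (simp add: fun_eq_iff permutes_inverses[OF p])
    qed (simp add: fun_eq_iff permutes_inverses[OF p])
    then show ?thesis by (simp add: basis_vec_def)
  qed
  then show ?thesis using supported_basis_vec[OF permutes_id] by (simp add: invariant_def)
qed

lemma supported_gmul: "supported d (gmul d f g)"
  unfolding supported_def gmul_def
proof (intro allI impI sum.neutral ballI)
  fix \<rho> \<sigma> \<tau> assume "\<not> \<rho> permutes {1..d}" "\<sigma> \<in> perms d" "\<tau> \<in> perms d"
  moreover from this have "\<rho> \<noteq> \<sigma> \<circ> \<tau>" using permutes_compose by blast
  ultimately show "f \<sigma> * g \<tau> * basis_mult d \<sigma> \<tau> \<rho> = 0" by (simp add: basis_mult_eq)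
qed

lemma gmul_sum_left: "gmul d (\<lambda>\<rho>. \<Sum>i\<in>I. F i \<rho>) g = (\<lambda>\<rho>. \<Sum>i\<in>I. gmul d (F i) g \<rho>)"
proof
  fix \<rho>
  have "gmul d (\<lambda>\<rho>. \<Sum>i\<in>I. F i \<rho>) g \<rho> =
      (\<Sum>\<sigma>\<in>perms d. \<Sum>\<tau>\<in>perms d. \<Sum>i\<in>I. F i \<sigma> * g \<tau> * basis_mult d \<sigma> \<tau> \<rho>)"
    unfolding gmul_def by (simp add: sum_distrib_right)
  also have "\<dots> = (\<Sum>\<sigma>\<in>perms d. \<Sum>i\<in>I. \<Sum>\<tau>\<in>perms d. F i \<sigma> * g \<tau> * basis_mult d \<sigma> \<tau> \<rho>)"
    by (intro sum.cong refl sum.swap)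
  also have "\<dots> = (\<Sum>i\<in>I. gmul d (F i) g \<rho>)" unfolding gmul_def by (rule sum.swap)
  finally show "gmul d (\<lambda>\<rho>. \<Sum>i\<in>I. F i \<rho>) g \<rho> = (\<Sum>i\<in>I. gmul d (F i) g \<rho>)" .
qed

lemma gmul_sum_right: "gmul d g (\<lambda>\<rho>. \<Sum>i\<in>I. F i \<rho>) = (\<lambda>\<rho>. \<Sum>i\<in>I. gmul d g (F i) \<rho>)"
proof
  fix \<rho>
  have "gmul d g (\<lambda>\<rho>. \<Sum>i\<in>I. F i \<rho>) \<rho> =
      (\<Sum>\<sigma>\<in>perms d. \<Sum>\<tau>\<in>perms d. \<Sum>i\<in>I. g \<sigma> * F i \<tau> * basis_mult d \<sigma> \<tau> \<rho>)"
    unfolding gmul_def by (simp add: sum_distrib_right sum_distrib_left)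
  also have "\<dots> = (\<Sum>\<sigma>\<in>perms d. \<Sum>i\<in>I. \<Sum>\<tau>\<in>perms d. g \<sigma> * F i \<tau> * basis_mult d \<sigma> \<tau> \<rho>)"
    by (intro sum.cong refl sum.swap)
  also have "\<dots> = (\<Sum>i\<in>I. gmul d g (F i) \<rho>)" unfolding gmul_def by (rule sum.swap)
  finally show "gmul d g (\<lambda>\<rho>. \<Sum>i\<in>I. F i \<rho>) \<rho> = (\<Sum>i\<in>I. gmul d g (F i) \<rho>)" .
qed

lemma gmul_scale_left: "gmul d (\<lambda>\<rho>. c * f \<rho>) g = (\<lambda>\<rho>. c * gmul d f g \<rho>)"
  by (simp add: gmul_def fun_eq_iff sum_distrib_left mult_ac)

lemma gmul_scale_right: "gmul d f (\<lambda>\<rho>. c * g \<rho>) = (\<lambda>\<rho>. c * gmul d f g \<rho>)"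
  by (simp add: gmul_def fun_eq_iff sum_distrib_left mult_ac)

lemma gmul_add_left: "gmul d (\<lambda>\<rho>. f \<rho> + f' \<rho>) g = (\<lambda>\<rho>. gmul d f g \<rho> + gmul d f' g \<rho>)"
  by (simp add: gmul_def fun_eq_iff sum.distrib ring_distribs)

lemma gmul_add_right: "gmul d f (\<lambda>\<rho>. g \<rho> + g' \<rho>) = (\<lambda>\<rho>. gmul d f g \<rho> + gmul d f g' \<rho>)"
  by (simp add: gmul_def fun_eq_iff sum.distrib ring_distribs)

lemma gmul_zero: "gmul d (\<lambda>_. 0) g = (\<lambda>_. 0)" "gmul d f (\<lambda>_. 0) = (\<lambda>_. 0)"
  by (simp_all add: gmul_def fun_eq_iff)

lemma gmul_basis_vec:
  assumes "\<sigma> permutes {1..d}" "\<tau> permutes {1..d}"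
  shows "gmul d (basis_vec \<sigma>) (basis_vec \<tau>) = basis_mult d \<sigma> \<tau>"
proof
  fix \<rho>
  have "gmul d (basis_vec \<sigma>) (basis_vec \<tau>) \<rho> =
    (\<Sum>\<sigma>'\<in>perms d. if \<sigma>' = \<sigma> then (\<Sum>\<tau>'\<in>perms d. if \<tau>' = \<tau> then basis_mult d \<sigma> \<tau> \<rho> else 0) else 0)"
    unfolding gmul_def basis_vec_def by (intro sum.cong refl) (auto intro!: sum.cong)
  also have "\<dots> = basis_mult d \<sigma> \<tau> \<rho>"
    using assms finite_perms by simp
  finally show "gmul d (basis_vec \<sigma>) (basis_vec \<tau>) \<rho> = basis_mult d \<sigma> \<tau> \<rho>" .
qed

lemma supported_expand:
  assumes "supported d f"
  shows "f = (\<lambda>\<rho>. \<Sum>\<sigma>\<in>perms d. f \<sigma> * basis_vec \<sigma> \<rho>)"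
proof
  fix \<rho>
  have "(\<Sum>\<sigma>\<in>perms d. f \<sigma> * basis_vec \<sigma> \<rho>) = (\<Sum>\<sigma>\<in>perms d. if \<sigma> = \<rho> then f \<sigma> else 0)"
    by (intro sum.cong refl) (auto simp: basis_vec_def)
  also have "\<dots> = f \<rho>" using assms finite_perms by (auto simp: supported_def)
  finally show "f \<rho> = (\<Sum>\<sigma>\<in>perms d. f \<sigma> * basis_vec \<sigma> \<rho>)" ..
qed

lemma gmul_one_left:
  assumes "supported d f" shows "gmul d (basis_vec id) f = f"
proof -
  have "gmul d (basis_vec id) f = (\<lambda>\<rho>. \<Sum>\<sigma>\<in>perms d. f \<sigma> * gmul d (basis_vec id) (basis_vec \<sigma>) \<rho>)"
    by (subst supported_expand[OF assms]) (simp add: gmul_sum_right gmul_scale_right)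
  also have "\<dots> = (\<lambda>\<rho>. \<Sum>\<sigma>\<in>perms d. f \<sigma> * basis_vec \<sigma> \<rho>)"
    using gmul_basis_vec[OF permutes_id]
    by (intro ext sum.cong refl) (simp add: basis_mult_eq basis_vec_def perm_norm_id)
  finally show ?thesis using supported_expand[OF assms] by simp
qed

lemma sum_rotate:
  "(\<Sum>a\<in>A. \<Sum>b\<in>B. \<Sum>c\<in>C. F a b c) = (\<Sum>b\<in>B. \<Sum>c\<in>C. \<Sum>a\<in>A. F a b c)"
  by (rule trans[OF sum.swap], rule sum.cong[OF refl], rule sum.swap)

text \<open>By subadditivity of the norm, either bracketing of three basis vectors is nonzero exactly when the
  norm of the triple product is the sum of the three norms.\<close>

lemma gmul_assoc: "gmul d (gmul d f g) h = gmul d f (gmul d g h)"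
proof
  fix \<rho>
  let ?P = "perms d"
  let ?N = "perm_norm d"
  let ?T = "\<lambda>\<sigma> \<tau> \<upsilon>. f \<sigma> * g \<tau> * h \<upsilon> *
    (if ?N (\<sigma> \<circ> \<tau> \<circ> \<upsilon>) = ?N \<sigma> + ?N \<tau> + ?N \<upsilon> \<and> \<rho> = \<sigma> \<circ> \<tau> \<circ> \<upsilon> then 1 else 0)"
  have l: "(\<Sum>\<pi>\<in>?P. basis_mult d \<sigma> \<tau> \<pi> * basis_mult d \<pi> \<upsilon> \<rho>) =
      (if ?N (\<sigma> \<circ> \<tau> \<circ> \<upsilon>) = ?N \<sigma> + ?N \<tau> + ?N \<upsilon> \<and> \<rho> = \<sigma> \<circ> \<tau> \<circ> \<upsilon> then 1 else 0)"
    if "\<sigma> \<in> ?P" "\<tau> \<in> ?P" "\<upsilon> \<in> ?P" for \<sigma> \<tau> \<upsilon>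
  proof -
    have st: "\<sigma> \<circ> \<tau> \<in> ?P" using that by (simp add: permutes_compose)
    have "(\<Sum>\<pi>\<in>?P. basis_mult d \<sigma> \<tau> \<pi> * basis_mult d \<pi> \<upsilon> \<rho>) =
      (\<Sum>\<pi>\<in>?P. if \<pi> = \<sigma> \<circ> \<tau> then (if ?N (\<sigma> \<circ> \<tau>) = ?N \<sigma> + ?N \<tau> then basis_mult d (\<sigma> \<circ> \<tau>) \<upsilon> \<rho> else 0) else 0)"
      by (intro sum.cong refl) (auto simp: basis_mult_eq)
    also have "\<dots> = (if ?N (\<sigma> \<circ> \<tau>) = ?N \<sigma> + ?N \<tau> then basis_mult d (\<sigma> \<circ> \<tau>) \<upsilon> \<rho> else 0)"
      using st finite_perms by simp
    finally show ?thesis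
      using perm_norm_subadditive[of \<sigma> d \<tau>] perm_norm_subadditive[of "\<sigma> \<circ> \<tau>" d \<upsilon>] that st
      by (auto simp: basis_mult_eq)
  qed
  have r: "(\<Sum>\<pi>\<in>?P. basis_mult d \<sigma> \<pi> \<rho> * basis_mult d \<tau> \<upsilon> \<pi>) =
      (if ?N (\<sigma> \<circ> \<tau> \<circ> \<upsilon>) = ?N \<sigma> + ?N \<tau> + ?N \<upsilon> \<and> \<rho> = \<sigma> \<circ> \<tau> \<circ> \<upsilon> then 1 else 0)"
    if "\<sigma> \<in> ?P" "\<tau> \<in> ?P" "\<upsilon> \<in> ?P" for \<sigma> \<tau> \<upsilon>
  proof -
    have tu: "\<tau> \<circ> \<upsilon> \<in> ?P" using that by (simp add: permutes_compose)
    have "(\<Sum>\<pi>\<in>?P. basis_mult d \<sigma> \<pi> \<rho> * basis_mult d \<tau> \<upsilon> \<pi>) =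
      (\<Sum>\<pi>\<in>?P. if \<pi> = \<tau> \<circ> \<upsilon> then (if ?N (\<tau> \<circ> \<upsilon>) = ?N \<tau> + ?N \<upsilon> then basis_mult d \<sigma> (\<tau> \<circ> \<upsilon>) \<rho> else 0) else 0)"
      by (intro sum.cong refl) (auto simp: basis_mult_eq)
    also have "\<dots> = (if ?N (\<tau> \<circ> \<upsilon>) = ?N \<tau> + ?N \<upsilon> then basis_mult d \<sigma> (\<tau> \<circ> \<upsilon>) \<rho> else 0)"
      using tu finite_perms by simp
    finally show ?thesis
      using perm_norm_subadditive[of \<tau> d \<upsilon>] perm_norm_subadditive[of \<sigma> d "\<tau> \<circ> \<upsilon>"] that tu
      by (auto simp: basis_mult_eq o_assoc)
  qed
  have "gmul d (gmul d f g) h \<rho> = (\<Sum>\<pi>\<in>?P. \<Sum>\<upsilon>\<in>?P. \<Sum>\<sigma>\<in>?P. \<Sum>\<tau>\<in>?P.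
      f \<sigma> * g \<tau> * h \<upsilon> * (basis_mult d \<sigma> \<tau> \<pi> * basis_mult d \<pi> \<upsilon> \<rho>))"
    unfolding gmul_def by (simp add: sum_distrib_left sum_distrib_right mult_ac)
  also have "\<dots> = (\<Sum>\<upsilon>\<in>?P. \<Sum>\<sigma>\<in>?P. \<Sum>\<tau>\<in>?P. \<Sum>\<pi>\<in>?P.
      f \<sigma> * g \<tau> * h \<upsilon> * (basis_mult d \<sigma> \<tau> \<pi> * basis_mult d \<pi> \<upsilon> \<rho>))"
    by (rule trans[OF sum.swap], rule sum.cong[OF refl], rule sum_rotate)
  also have "\<dots> = (\<Sum>\<upsilon>\<in>?P. \<Sum>\<sigma>\<in>?P. \<Sum>\<tau>\<in>?P. ?T \<sigma> \<tau> \<upsilon>)"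
    by (intro sum.cong refl) (simp only: sum_distrib_left[symmetric] l)
  also have "\<dots> = (\<Sum>\<sigma>\<in>?P. \<Sum>\<tau>\<in>?P. \<Sum>\<upsilon>\<in>?P. ?T \<sigma> \<tau> \<upsilon>)"
    by (rule sum_rotate)
  also have "\<dots> = (\<Sum>\<sigma>\<in>?P. \<Sum>\<tau>\<in>?P. \<Sum>\<upsilon>\<in>?P. \<Sum>\<pi>\<in>?P.
      f \<sigma> * g \<tau> * h \<upsilon> * (basis_mult d \<sigma> \<pi> \<rho> * basis_mult d \<tau> \<upsilon> \<pi>))"
    by (intro sum.cong refl) (simp only: sum_distrib_left[symmetric] r)
  also have "\<dots> = (\<Sum>\<sigma>\<in>?P. \<Sum>\<pi>\<in>?P. \<Sum>\<tau>\<in>?P. \<Sum>\<upsilon>\<in>?P.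
      f \<sigma> * g \<tau> * h \<upsilon> * (basis_mult d \<sigma> \<pi> \<rho> * basis_mult d \<tau> \<upsilon> \<pi>))"
    by (rule sum.cong[OF refl], rule sum_rotate[symmetric])
  also have "\<dots> = gmul d f (gmul d g h) \<rho>"
    unfolding gmul_def by (simp add: sum_distrib_left sum_distrib_right mult_ac)
  finally show "gmul d (gmul d f g) h \<rho> = gmul d f (gmul d g h) \<rho>" .
qed

lemma bij_betw_conj:
  assumes "\<pi> permutes {1..d}"
  shows "bij_betw (\<lambda>\<sigma>. \<pi> \<circ> \<sigma> \<circ> inv' \<pi>) (perms d) (perms d)"
proof (rule bij_betw_byWitness[where f' = "\<lambda>\<sigma>. inv' \<pi> \<circ> \<sigma> \<circ> \<pi>"])
  show "(\<lambda>\<sigma>. \<pi> \<circ> \<sigma> \<circ> inv' \<pi>) ` perms d \<subseteq> perms d" using permutes_conj assms by blast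
  show "(\<lambda>\<sigma>. inv' \<pi> \<circ> \<sigma> \<circ> \<pi>) ` perms d \<subseteq> perms d"
    using assms by (auto intro!: permutes_compose permutes_inv)
qed (use conj_conj_inv[OF assms] in auto)

lemma sum_conj:
  assumes "\<pi> permutes {1..d}"
  shows "(\<Sum>\<sigma>\<in>perms d. F \<sigma>) = (\<Sum>\<sigma>\<in>perms d. F (\<pi> \<circ> \<sigma> \<circ> inv' \<pi>))"
  by (rule sum.reindex_bij_betw[OF bij_betw_conj[OF assms], symmetric])

text \<open>Since \<open>\<sigma>\<tau> = (\<sigma>\<tau>\<sigma>\<inverse>)\<sigma>\<close> and \<open>g\<close> takes the same value on \<open>\<tau>\<close> and its conjugate, every invariant
  element is central.\<close>

lemma gmul_commute:
  assumes "invariant d g"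
  shows "gmul d f g = gmul d g f"
proof
  fix \<rho>
  have "gmul d f g \<rho> = (\<Sum>\<sigma>\<in>perms d. \<Sum>\<tau>\<in>perms d. g \<tau> * f \<sigma> * basis_mult d \<tau> \<sigma> \<rho>)"
    unfolding gmul_def
  proof (rule sum.cong[OF refl])
    fix \<sigma> assume "\<sigma> \<in> perms d"
    then have s: "\<sigma> permutes {1..d}" by simp
    have "(\<Sum>\<tau>\<in>perms d. g \<tau> * f \<sigma> * basis_mult d \<tau> \<sigma> \<rho>) =
        (\<Sum>\<tau>\<in>perms d. g (\<sigma> \<circ> \<tau> \<circ> inv' \<sigma>) * f \<sigma> * basis_mult d (\<sigma> \<circ> \<tau> \<circ> inv' \<sigma>) \<sigma> \<rho>)"
      by (rule sum_conj[OF s])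
    also have "\<dots> = (\<Sum>\<tau>\<in>perms d. f \<sigma> * g \<tau> * basis_mult d \<sigma> \<tau> \<rho>)"
    proof (intro sum.cong refl)
      fix \<tau> assume "\<tau> \<in> perms d"
      then have t: "\<tau> permutes {1..d}" by simp
      have "\<sigma> \<circ> \<tau> \<circ> inv' \<sigma> \<circ> \<sigma> = \<sigma> \<circ> \<tau>" by (simp add: fun_eq_iff permutes_inverses[OF s])
      then show "g (\<sigma> \<circ> \<tau> \<circ> inv' \<sigma>) * f \<sigma> * basis_mult d (\<sigma> \<circ> \<tau> \<circ> inv' \<sigma>) \<sigma> \<rho> =
          f \<sigma> * g \<tau> * basis_mult d \<sigma> \<tau> \<rho>"
        using assms s t perm_norm_conj[OF t s] by (simp add: invariant_def basis_mult_eq)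
    qed
    finally show "(\<Sum>\<tau>\<in>perms d. f \<sigma> * g \<tau> * basis_mult d \<sigma> \<tau> \<rho>) =
      (\<Sum>\<tau>\<in>perms d. g \<tau> * f \<sigma> * basis_mult d \<tau> \<sigma> \<rho>)" ..
  qed
  also have "\<dots> = gmul d g f \<rho>" unfolding gmul_def by (rule sum.swap)
  finally show "gmul d f g \<rho> = gmul d g f \<rho>" .
qed

lemma invariant_gmul:
  assumes f: "invariant d f" and g: "invariant d g"
  shows "invariant d (gmul d f g)"
  unfolding invariant_def
proof (intro conjI supported_gmul allI impI)
  fix \<pi> \<rho> assume p: "\<pi> permutes {1..d}" and "\<rho> permutes {1..d}"
  let ?c = "\<lambda>\<sigma>. \<pi> \<circ> \<sigma> \<circ> inv' \<pi>"
  have "gmul d f g (?c \<rho>) = (\<Sum>\<sigma>\<in>perms d. \<Sum>\<tau>\<in>perms d. f (?c \<sigma>) * g (?c \<tau>) * basis_mult d (?c \<sigma>) (?c \<tau>) (?c \<rho>))"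
    unfolding gmul_def
    by (rule trans[OF sum_conj[OF p]], rule sum.cong[OF refl], rule sum_conj[OF p])
  also have "\<dots> = gmul d f g \<rho>"
    unfolding gmul_def
  proof (intro sum.cong refl)
    fix \<sigma> \<tau> assume st: "\<sigma> \<in> perms d" "\<tau> \<in> perms d"
    have c: "?c \<sigma> \<circ> ?c \<tau> = ?c (\<sigma> \<circ> \<tau>)" by (simp add: fun_eq_iff permutes_inverses[OF p])
    have e: "?c \<rho> = ?c (\<sigma> \<circ> \<tau>) \<longleftrightarrow> \<rho> = \<sigma> \<circ> \<tau>" using conj_conj_inv(1)[OF p] by metis
    have "basis_mult d (?c \<sigma>) (?c \<tau>) (?c \<rho>) = basis_mult d \<sigma> \<tau> \<rho>"
      unfolding basis_mult_eq c e using st p by (simp only: perm_norm_conj permutes_compose mem_Collect_eq)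
    then show "f (?c \<sigma>) * g (?c \<tau>) * basis_mult d (?c \<sigma>) (?c \<tau>) (?c \<rho>) = f \<sigma> * g \<tau> * basis_mult d \<sigma> \<tau> \<rho>"
      using f g st p by (simp add: invariant_def)
  qed
  finally show "gmul d f g (?c \<rho>) = gmul d f g \<rho>" .
qed

lemma invariant_add: "invariant d f \<Longrightarrow> invariant d g \<Longrightarrow> invariant d (\<lambda>\<rho>. f \<rho> + g \<rho>)"
  by (simp add: invariant_def supported_def)

lemma invariant_scale: "invariant d f \<Longrightarrow> invariant d (\<lambda>\<rho>. c * f \<rho>)"
  by (simp add: invariant_def supported_def)

section \<open>Generated subalgebras\<close>

abbreviation subalg :: "nat \<Rightarrow> ((nat \<Rightarrow> nat) \<Rightarrow> rat) set \<Rightarrow> ((nat \<Rightarrow> nat) \<Rightarrow> rat) set" where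
  "subalg d \<equiv> subalgebra_generated (invariant_algebra d)"

lemma subalg_one: "basis_vec id \<in> subalg d S"
  using subalgebra_generated.one[of "invariant_algebra d" S] by (simp add: invariant_algebra_one)

lemma subalg_add: "f \<in> subalg d S \<Longrightarrow> g \<in> subalg d S \<Longrightarrow> (\<lambda>\<rho>. f \<rho> + g \<rho>) \<in> subalg d S"
  using subalgebra_generated.add[of f "invariant_algebra d" S g] by (simp add: invariant_algebra_add)

lemma subalg_gmul: "f \<in> subalg d S \<Longrightarrow> g \<in> subalg d S \<Longrightarrow> gmul d f g \<in> subalg d S"
  using subalgebra_generated.mult[of f "invariant_algebra d" S g] by (simp add: invariant_algebra_mult)

lemma subalg_scale: "f \<in> subalg d S \<Longrightarrow> (\<lambda>\<rho>. c * f \<rho>) \<in> subalg d S"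
  using subalgebra_generated.smult[of f "invariant_algebra d" S c] by (simp add: invariant_algebra_smult)

lemma subalg_zero: "(\<lambda>_. 0) \<in> subalg d S"
  using subalg_scale[OF subalg_one, where c = 0] by simp

lemma subalg_diff:
  assumes "f \<in> subalg d S" "g \<in> subalg d S" shows "(\<lambda>\<rho>. f \<rho> - g \<rho>) \<in> subalg d S"
  using subalg_add[OF assms(1) subalg_scale[OF assms(2), where c = "-1"]] by simp

lemma subalg_sum:
  assumes "\<And>i. i \<in> I \<Longrightarrow> F i \<in> subalg d S"
  shows "(\<lambda>\<rho>. \<Sum>i\<in>I. F i \<rho>) \<in> subalg d S"
  using assms by (induction I rule: infinite_finite_induct) (auto intro: subalg_zero subalg_add)

lemma subalg_induct [consumes 1, case_names one incl add gmul scale]: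
  assumes "f \<in> subalg d S" "P (basis_vec id)" "\<And>f. f \<in> S \<Longrightarrow> P f"
    "\<And>f g. f \<in> subalg d S \<Longrightarrow> g \<in> subalg d S \<Longrightarrow> P f \<Longrightarrow> P g \<Longrightarrow> P (\<lambda>\<rho>. f \<rho> + g \<rho>)"
    "\<And>f g. f \<in> subalg d S \<Longrightarrow> g \<in> subalg d S \<Longrightarrow> P f \<Longrightarrow> P g \<Longrightarrow> P (gmul d f g)"
    "\<And>f c. f \<in> subalg d S \<Longrightarrow> P f \<Longrightarrow> P (\<lambda>\<rho>. c * f \<rho>)"
  shows "P f"
  using assms(1)
  by (induction rule: subalgebra_generated.induct)
    (use assms in \<open>simp_all add: invariant_algebra_one invariant_algebra_add invariant_algebra_mult invariant_algebra_smult\<close>)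

lemma subalg_subset:
  assumes "S \<subseteq> subalg d T" shows "subalg d S \<subseteq> subalg d T"
proof
  fix f assume "f \<in> subalg d S"
  then show "f \<in> subalg d T"
    by (induction rule: subalg_induct)
      (use assms in \<open>auto intro: subalg_one subalg_add subalg_gmul subalg_scale\<close>)
qed

lemma subalg_invariant:
  assumes "\<And>f. f \<in> S \<Longrightarrow> invariant d f" "f \<in> subalg d S" shows "invariant d f"
  using assms(2)
  by (induction rule: subalg_induct)
    (use assms(1) in \<open>auto intro: basis_vec_id_invariant invariant_add invariant_gmul invariant_scale\<close>)

section \<open>Cycles and their orbits\<close>

lemma cycle_of_list_nth:
  assumes "distinct cs" "Suc i < length cs"
  shows "cycle_of_list cs (cs ! i) = cs ! Suc i"
proof -
  have "map (cycle_of_list cs) cs ! i = rotate1 cs ! i"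
    using cyclic_rotation[OF assms(1), of 1] by simp
  then show ?thesis using assms(2) by (simp add: nth_rotate1)
qed

lemma funpow_cycle_comp:
  assumes "distinct cs" "\<forall>y\<in>set cs. M y = y" "i < length cs"
  shows "((cycle_of_list cs \<circ> M) ^^ i) (hd cs) = cs ! i"
  using assms(3)
proof (induction i)
  case 0
  then show ?case by (simp add: hd_conv_nth)
next
  case (Suc i)
  have "((cycle_of_list cs \<circ> M) ^^ i) (hd cs) = cs ! i" by (rule Suc.IH[OF Suc_lessD[OF Suc.prems]])
  moreover have "M (cs ! i) = cs ! i" using assms(2) Suc.prems by simp
  moreover have "(f ^^ Suc i) z = f ((f ^^ i) z)" for f :: "'a \<Rightarrow> 'a" and z by simp
  ultimately show ?case using cycle_of_list_nth[OF assms(1) Suc.prems] by (metis o_apply)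
qed

lemma orbit_cycle_comp:
  assumes cs: "distinct cs" and M: "M permutes A" "finite A" and fixd: "\<forall>y\<in>set cs. M y = y"
    and x: "x \<in> set cs"
  shows "orbit (cycle_of_list cs \<circ> M) x = set cs"
proof -
  let ?f = "cycle_of_list cs \<circ> M"
  have "permutation ?f"
    using permutation_of_cycle M by (intro permutation_compose) (auto simp: permutation_permutes)
  note self = permutation_self_in_orbit[OF this] and eq = orbit_eq_of_mem[OF this]
  have "set cs \<subseteq> orbit ?f (hd cs)"
  proof
    fix y assume "y \<in> set cs"
    then obtain i where "i < length cs" "y = cs ! i" by (auto simp: in_set_conv_nth)
    then have "y = (?f ^^ i) (hd cs)" using funpow_cycle_comp[OF cs fixd] by simp
    then show "y \<in> orbit ?f (hd cs)" using self funpow_in_orbit[of "hd cs" ?f "hd cs" i] by simp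
  qed
  moreover have "?f y \<in> set cs" if "y \<in> set cs" for y
    using that fixd permutes_in_image[OF cycle_permutes, of cs y] by simp
  then have "orbit ?f x \<subseteq> set cs" using x by (intro orbit_closed) auto
  ultimately show ?thesis using eq[of x "hd cs"] x by auto
qed

lemma cycle_of_list_eq_iff_hd:
  assumes "distinct cs" "distinct cs'" "length cs = length cs'" "hd cs = hd cs'"
    "cycle_of_list cs = cycle_of_list cs'"
  shows "cs = cs'"
proof (rule nth_equalityI[OF assms(3)])
  fix i assume "i < length cs"
  then show "cs ! i = cs' ! i"
    using funpow_cycle_comp[of cs id i] funpow_cycle_comp[of cs' id i] assms by simp
qed

lemma cycle_of_list_moves:
  assumes "distinct cs" "length cs \<ge> 2"
  shows "cycle_of_list cs y \<noteq> y \<longleftrightarrow> y \<in> set cs"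
proof
  assume y: "y \<in> set cs"
  show "cycle_of_list cs y \<noteq> y"
  proof
    assume "cycle_of_list cs y = y"
    then have "orbit (cycle_of_list cs) y = {y}" by (rule orbit_fixed)
    moreover have "orbit (cycle_of_list cs) y = set cs"
      using orbit_cycle_comp[OF assms(1) permutes_id[of "{}"] _ _ y] by simp
    ultimately have "card (set cs) = 1" by simp
    then show False using assms distinct_card[OF assms(1)] by simp
  qed
qed (use id_outside_supp in metis)

lemma cycle_of_list_rotate_left:
  assumes "distinct (a # x # w)"
  shows "transpose a x \<circ> cycle_of_list (x # w) = cycle_of_list (x # w @ [a])"
  using cycle_of_list_rotate_independent[OF assms, of 1] by simp

text \<open>If \<open>a\<close> is matched with \<open>b\<close>, multiplication by the transposition of \<open>a\<close> and the root \<open>x\<close> pulls the whole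
  pair into the cycle, in the order \<open>a\<close>, \<open>b\<close> before returning to \<open>x\<close>.\<close>

lemma cycle_of_list_rotate_left2:
  assumes "distinct (a # b # x # w)"
  shows "transpose a x \<circ> cycle_of_list (x # w) \<circ> transpose a b = cycle_of_list (x # w @ [a, b])"
proof -
  have "bij (transpose a b)" "inv' (transpose a b) = transpose a b"
    by (simp_all add: bij_swap inv_equality)
  moreover have "map (transpose a b) (a # x # w) = b # x # w"
    using assms by (auto intro!: map_idI simp: transpose_def)
  ultimately have "transpose a b \<circ> cycle_of_list (a # x # w) \<circ> transpose a b = cycle_of_list (b # x # w)"
    using conjugation_of_cycle[of "a # x # w" "transpose a b"] assms by simp
  then have "transpose a b \<circ> (transpose a b \<circ> cycle_of_list (a # x # w) \<circ> transpose a b) =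
      cycle_of_list (a # b # x # w)" by simp
  moreover have "transpose a b \<circ> (transpose a b \<circ> cycle_of_list (a # x # w) \<circ> transpose a b) =
      cycle_of_list (a # x # w) \<circ> transpose a b" by (simp add: fun_eq_iff)
  moreover have "cycle_of_list (a # b # x # w) = cycle_of_list (x # w @ [a, b])"
    using cycle_of_list_rotate_independent[OF assms, of 2] by (simp add: numeral_2_eq_2)
  ultimately show ?thesis by simp
qed

section \<open>Matchings\<close>

text \<open>Products of \<open>j\<close> disjoint transpositions, described without choosing an order of the factors.\<close>

definition matchings :: "nat \<Rightarrow> nat set \<Rightarrow> (nat \<Rightarrow> nat) set" where
  "matchings j A = {M. M permutes A \<and> M \<circ> M = id \<and> card {y. M y \<noteq> y} = 2 * j}"

lemma matchings_0:
  assumes "finite A" shows "matchings 0 A = {id}"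
proof -
  have "M = id" if M: "M permutes A" "card {y. M y \<noteq> y} = 0" for M :: "nat \<Rightarrow> nat"
  proof -
    have "{y. M y \<noteq> y} \<subseteq> A" using M(1) by (auto simp: permutes_def)
    then have "{y. M y \<noteq> y} = {}" using M(2) assms finite_subset by fastforce
    then show ?thesis by auto
  qed
  then show ?thesis by (auto simp: matchings_def permutes_id)
qed

lemma matchings_involution: "M \<in> matchings j A \<Longrightarrow> M (M y) = y"
  unfolding matchings_def by (auto dest: pointfree_idE)

lemma matchings_restrict:
  "M \<in> matchings j A \<and> (\<forall>y\<in>C. M y = y) \<longleftrightarrow> M \<in> matchings j (A - C)"
proof
  assume "M \<in> matchings j A \<and> (\<forall>y\<in>C. M y = y)"
  then show "M \<in> matchings j (A - C)"
    by (auto simp: matchings_def intro: permutes_superset)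
next
  assume "M \<in> matchings j (A - C)"
  then show "M \<in> matchings j A \<and> (\<forall>y\<in>C. M y = y)"
    by (auto simp: matchings_def permutes_not_in intro: permutes_subset)
qed

lemma finite_matchings: "finite A \<Longrightarrow> finite (matchings j A)"
  by (rule finite_subset[OF _ finite_permutations[of A]]) (auto simp: matchings_def)

lemma matchings_insert_pair:
  assumes "finite A" "M \<in> matchings j (A - {a, b})" "a \<noteq> b" "a \<in> A" "b \<in> A"
  shows "transpose a b \<circ> M \<in> matchings (Suc j) A"
proof -
  let ?M = "transpose a b \<circ> M"
  have M: "M permutes A - {a, b}" "\<And>y. M (M y) = y" "card {y. M y \<noteq> y} = 2 * j"
    using assms(2) matchings_involution[OF assms(2)] by (auto simp: matchings_def)
  have ab: "M a = a" "M b = b" using M(1) by (auto simp: permutes_def)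
  have "M permutes A" using M(1) by (rule permutes_subset) auto
  then have 1: "?M permutes A" using assms by (intro permutes_compose permutes_swap_id)
  have inv: "?M (?M y) = y" for y
    using M(2) ab by (auto simp: transpose_def)
  have supp: "{y. ?M y \<noteq> y} = {a, b} \<union> {y. M y \<noteq> y}"
    using ab assms(3) M(2) by (auto simp: transpose_def)
  have "{y. M y \<noteq> y} \<subseteq> A" using M(1) by (auto simp: permutes_def)
  then have "finite {y. M y \<noteq> y}" using assms(1) finite_subset by blast
  then have "card {y. ?M y \<noteq> y} = 2 * Suc j"
    unfolding supp using ab assms(3) M(3) by (subst card_Un_disjoint) auto
  then show ?thesis unfolding matchings_def using 1 inv by (simp add: fun_eq_iff)
qed

lemma matchings_remove_pair:
  assumes "finite A" "M \<in> matchings j A" "M a \<noteq> a"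
  shows "\<exists>j'. j = Suc j' \<and> transpose a (M a) \<circ> M \<in> matchings j' (A - {a, M a})"
proof -
  let ?M = "transpose a (M a) \<circ> M"
  have M: "M permutes A" "\<And>y. M (M y) = y" "card {y. M y \<noteq> y} = 2 * j"
    using assms(2) matchings_involution[OF assms(2)] by (auto simp: matchings_def)
  have a: "a \<in> A" using assms(3) M(1) by (auto simp: permutes_def)
  then have b: "M a \<in> A" using M(1) permutes_in_image by metis
  have eq: "?M y = (if y = a then a else if y = M a then M a else M y)" for y
  proof -
    have "M y = a \<longleftrightarrow> y = M a" "M y = M a \<longleftrightarrow> y = a" using M(2) by metis+
    then show ?thesis using M(2)[of a] by (auto simp: transpose_def)
  qed
  have "?M permutes A" using M(1) a b by (intro permutes_compose permutes_swap_id)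
  then have 1: "?M permutes A - {a, M a}"
    by (rule permutes_superset) (auto simp: eq simp del: o_apply)
  have inv: "?M (?M y) = y" for y
    unfolding eq using M(2) by (auto) (metis+)
  have supp: "{y. M y \<noteq> y} = {a, M a} \<union> {y. ?M y \<noteq> y}"
    using assms(3) M(2) unfolding eq by auto
  have "{y. ?M y \<noteq> y} \<subseteq> A" using 1 by (auto simp: permutes_def)
  then have fin: "finite {y. ?M y \<noteq> y}" using assms(1) finite_subset by blast
  have "card {y. M y \<noteq> y} = 2 + card {y. ?M y \<noteq> y}"
    unfolding supp using assms(3) fin by (subst card_Un_disjoint) (auto simp: eq simp del: o_apply)
  then have "card {y. ?M y \<noteq> y} = 2 * (j - 1)" "j = Suc (j - 1)" using M(3) by auto
  then show ?thesis unfolding matchings_def using 1 inv by (auto simp: fun_eq_iff intro!: exI[of _ "j - 1"])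
qed

text \<open>Any matching with a moved point \<open>a\<close> is the transposition of \<open>a\<close> and its partner
  times a matching of the remaining points, so induction on \<open>j\<close> peels off one pair at a time.\<close>

lemma matchings_iff_cycles:
  assumes "finite A"
  shows "M \<in> matchings j A \<longleftrightarrow>
    (\<exists>css. map length css = replicate j 2 \<and> distinct (concat css) \<and> set (concat css) \<subseteq> A \<and>
      M = foldr (\<circ>) (map cycle_of_list css) id)"
  using assms
proof (induction j arbitrary: M A)
  case 0
  then show ?case by (auto simp: matchings_0)
next
  case (Suc j)
  show ?case
  proof
    assume M: "M \<in> matchings (Suc j) A"
    then have "{y. M y \<noteq> y} \<noteq> {}" unfolding matchings_def by fastforce
    then obtain a where a: "M a \<noteq> a" by auto
    let ?M = "transpose a (M a) \<circ> M"
    have mem: "?M \<in> matchings j (A - {a, M a})"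
      using matchings_remove_pair[OF Suc.prems M a] by auto
    have aA: "a \<in> A" "M a \<in> A"
      using M a permutes_in_image[of M A a] by (auto simp: matchings_def permutes_def)
    have "\<exists>css. map length css = replicate j 2 \<and> distinct (concat css) \<and>
        set (concat css) \<subseteq> A - {a, M a} \<and> ?M = foldr (\<circ>) (map cycle_of_list css) id"
      by (rule iffD1[OF Suc.IH mem]) (use Suc.prems in simp)
    then obtain css where css: "map length css = replicate j 2" "distinct (concat css)"
      "set (concat css) \<subseteq> A - {a, M a}" "?M = foldr (\<circ>) (map cycle_of_list css) id" by blast
    have "M = transpose a (M a) \<circ> ?M" by (simp add: fun_eq_iff)
    also have "\<dots> = foldr (\<circ>) (map cycle_of_list ([a, M a] # css)) id"
      unfolding css(4) by simp
    finally show "\<exists>css. map length css = replicate (Suc j) 2 \<and> distinct (concat css) \<and>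
        set (concat css) \<subseteq> A \<and> M = foldr (\<circ>) (map cycle_of_list css) id"
      using css(1-3) a aA by (intro exI[of _ "[a, M a] # css"]) auto
  next
    assume "\<exists>css. map length css = replicate (Suc j) 2 \<and> distinct (concat css) \<and>
        set (concat css) \<subseteq> A \<and> M = foldr (\<circ>) (map cycle_of_list css) id"
    then obtain c css where c: "length c = 2" "map length css = replicate j 2"
      "distinct (concat (c # css))" "set (concat (c # css)) \<subseteq> A"
      "M = foldr (\<circ>) (map cycle_of_list (c # css)) id"
      by (auto simp: map_eq_Cons_conv)
    obtain a b where ab: "c = [a, b]"
      using c(1) by (auto simp: length_Suc_conv numeral_2_eq_2)
    have "foldr (\<circ>) (map cycle_of_list css) id \<in> matchings j (A - {a, b})"
    proof (rule iffD2[OF Suc.IH], goal_cases)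
      case 2
      show ?case by (intro exI[of _ css] conjI refl) (use c ab in auto)
    qed (use Suc.prems in simp)
    then have "transpose a b \<circ> foldr (\<circ>) (map cycle_of_list css) id \<in> matchings (Suc j) A"
      using c ab by (intro matchings_insert_pair[OF Suc.prems]) auto
    moreover have "M = transpose a b \<circ> foldr (\<circ>) (map cycle_of_list css) id"
      unfolding c(5) ab by (simp only: list.map foldr_Cons o_apply cycle_of_list.simps comp_id)
    ultimately show "M \<in> matchings (Suc j) A" by simp
  qed
qed

section \<open>A Newton identity between cycles and matchings\<close>

definition basis_sum :: "('i \<Rightarrow> nat \<Rightarrow> nat) \<Rightarrow> 'i set \<Rightarrow> (nat \<Rightarrow> nat) \<Rightarrow> rat" where
  "basis_sum F I = (\<lambda>\<rho>. \<Sum>i\<in>I. basis_vec (F i) \<rho>)"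

lemma delta_elt_eq: "delta_elt d j = basis_sum (\<lambda>M. M) (matchings j {1..d})"
proof -
  have "{\<sigma> \<in> perms d. has_cycle_lengths d (replicate j 2) \<sigma>} = matchings j {1..d}"
    using matchings_iff_cycles[of "{1..d}" _ j] unfolding has_cycle_lengths_def
    by (auto simp: matchings_def)
  then show ?thesis
    by (simp add: delta_elt_def cycle_class_sum_def basis_sum_def carrier_sym_group)
qed

lemma supported_basis_sum:
  "(\<And>i. i \<in> I \<Longrightarrow> F i permutes {1..d}) \<Longrightarrow> supported d (basis_sum F I)"
  unfolding basis_sum_def by (intro supported_sum supported_basis_vec)

lemma gmul_basis_sum:
  assumes "\<And>i. i \<in> I \<Longrightarrow> F i permutes {1..d}" "\<And>i. i \<in> J \<Longrightarrow> G i permutes {1..d}"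
  shows "gmul d (basis_sum F I) (basis_sum G J) = (\<lambda>\<rho>. \<Sum>i\<in>I. \<Sum>j\<in>J. basis_mult d (F i) (G j) \<rho>)"
  unfolding basis_sum_def gmul_sum_left gmul_sum_right
  by (intro ext sum.cong refl fun_cong[OF gmul_basis_vec] assms)

lemma basis_sum_reindex:
  assumes "bij_betw h I J" "\<And>i. i \<in> I \<Longrightarrow> G (h i) = F i"
  shows "basis_sum F I = basis_sum G J"
  unfolding basis_sum_def
  by (rule ext, subst sum.reindex_bij_betw[OF assms(1), symmetric]) (simp add: assms(2))

text \<open>A pair \<open>(w, M)\<close> stands for the permutation with the cycle \<open>x # w\<close> through the marked point \<open>x\<close> and
  the \<open>j\<close> disjoint transpositions of \<open>M\<close> elsewhere; for \<open>w = []\<close> the point \<open>x\<close> is fixed. Summing over the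
  pairs instead of the permutations turns all products below into bijections between index sets.\<close>

definition rooted :: "nat \<Rightarrow> nat \<Rightarrow> nat \<Rightarrow> nat \<Rightarrow> (nat list \<times> (nat \<Rightarrow> nat)) set" where
  "rooted d x n j = {(w, M). length w = n \<and> distinct (x # w) \<and> set w \<subseteq> {1..d} \<and>
     M \<in> matchings j ({1..d} - set (x # w))}"

definition rooted_perm :: "nat \<Rightarrow> nat list \<times> (nat \<Rightarrow> nat) \<Rightarrow> nat \<Rightarrow> nat" where
  "rooted_perm x = (\<lambda>(w, M). cycle_of_list (x # w) \<circ> M)"

definition rooted_sum :: "nat \<Rightarrow> nat \<Rightarrow> nat \<Rightarrow> nat \<Rightarrow> (nat \<Rightarrow> nat) \<Rightarrow> rat" where
  "rooted_sum d x n j = basis_sum (rooted_perm x) (rooted d x n j)"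

definition star :: "nat \<Rightarrow> nat \<Rightarrow> (nat \<Rightarrow> nat) \<Rightarrow> rat" where
  "star d x = basis_sum (\<lambda>a. transpose a x) ({1..d} - {x})"

lemma finite_rooted: "finite (rooted d x n j)"
proof (rule finite_subset)
  show "rooted d x n j \<subseteq> {w. set w \<subseteq> {1..d} \<and> length w = n} \<times> perms d"
    by (auto simp: rooted_def matchings_def intro: permutes_subset)
  show "finite ({w. set w \<subseteq> {1..d} \<and> length w = n} \<times> perms d)"
    using finite_lists_length_eq[of "{1..d}" n] finite_perms by simp
qed

lemma rootedD:
  assumes "(w, M) \<in> rooted d x n j" "x \<in> {1..d}"
  shows "M permutes {1..d}" "\<forall>y\<in>set (x # w). M y = y" "rooted_perm x (w, M) permutes {1..d}"
    "orbit (rooted_perm x (w, M)) x = set (x # w)"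
proof -
  have M: "M permutes {1..d} - set (x # w)" using assms(1) by (simp add: rooted_def matchings_def)
  show 1: "M permutes {1..d}" using M by (rule permutes_subset) auto
  show 2: "\<forall>y\<in>set (x # w). M y = y" using M by (auto simp: permutes_def)
  have w: "distinct (x # w)" "set (x # w) \<subseteq> {1..d}" using assms by (auto simp: rooted_def)
  show "rooted_perm x (w, M) permutes {1..d}"
    unfolding rooted_perm_def using 1 cycle_permutes_superset[OF w(2)]
    by (simp add: permutes_compose)
  show "orbit (rooted_perm x (w, M)) x = set (x # w)"
    unfolding rooted_perm_def using orbit_cycle_comp[OF w(1) 1 _ 2] by simp
qed

lemma basis_mult_transpose:
  assumes "\<sigma> permutes {1..d}" "a \<in> {1..d}" "x \<in> {1..d}" "a \<noteq> x"
  shows "basis_mult d (transpose a x) \<sigma> =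
    (if a \<in> orbit \<sigma> x then (\<lambda>_. 0) else basis_vec (transpose a x \<circ> \<sigma>))"
proof -
  have "perm_norm d (transpose a x) = 1" using perm_norm_cycle[of "[a, x]" d] assms by simp
  then show ?thesis
    using perm_norm_merge[OF assms(1-3)] perm_norm_split[OF assms(1-3) _ assms(4)]
    by (auto simp: fun_eq_iff basis_mult_eq basis_vec_def)
qed

text \<open>The cycle of \<open>x\<close> can grow in two ways under a transposition \<open>(a x)\<close> with \<open>a\<close> outside the cycle: either
  \<open>a\<close> is a fixed point and becomes the last letter of the word, or \<open>a\<close> is matched and becomes the last letter
  but one, followed by its partner. Both are reversible, the second since the last two letters can be
  released as a pair.\<close>

lemma extend_by_free:
  assumes x: "x \<in> {1..d}"
  shows "bij_betw (\<lambda>(a, w, M). (w @ [a], M))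
    {(a, w, M). a \<in> {1..d} - {x} \<and> (w, M) \<in> rooted d x n j \<and> a \<notin> set w \<and> M a = a}
    (rooted d x (Suc n) j)" (is "bij_betw ?h ?P ?R")
proof -
  have iff: "(w @ [a], M) \<in> ?R \<longleftrightarrow> (a, w, M) \<in> ?P" for a w M
  proof -
    have *: "{1..d} - set (x # w @ [a]) = ({1..d} - set (x # w)) - {a}" by auto
    show ?thesis
      unfolding rooted_def prod.case mem_Collect_eq * matchings_restrict[symmetric] by auto
  qed
  show ?thesis
  proof (rule bij_betw_imageI)
    show "inj_on ?h ?P" by (auto simp: inj_on_def)
    show "?h ` ?P = ?R"
    proof
      show "?h ` ?P \<subseteq> ?R" using iff by auto
      show "?R \<subseteq> ?h ` ?P"
      proof
        fix p assume p: "p \<in> ?R"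
        obtain w' M where wM: "p = (w', M)" by (cases p)
        then have "length w' = Suc n" using p by (simp add: rooted_def)
        then obtain w a where "w' = w @ [a]" by (cases w' rule: rev_cases) auto
        then show "p \<in> ?h ` ?P" using p wM iff[of w a M] by (auto intro!: image_eqI[of _ _ "(a, w, M)"])
      qed
    qed
  qed
qed

lemma extend_by_pair:
  assumes x: "x \<in> {1..d}"
  shows "bij_betw (\<lambda>(a, w, M). (w @ [a, M a], transpose a (M a) \<circ> M))
    {(a, w, M). a \<in> {1..d} - {x} \<and> (w, M) \<in> rooted d x n (Suc j) \<and> a \<notin> set w \<and> M a \<noteq> a}
    (rooted d x (n + 2) j)" (is "bij_betw ?h ?P ?R")
proof (rule bij_betw_byWitness[where f' = "\<lambda>(w, M). (w ! n, take n w, transpose (w ! n) (w ! Suc n) \<circ> M)"])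
  let ?h' = "\<lambda>(w, M). (w ! n, take n w, transpose (w ! n) (w ! Suc n) \<circ> M)"
  show "\<forall>p\<in>?P. ?h' (?h p) = p"
    by (auto simp: rooted_def nth_append fun_eq_iff)
  have split: "\<exists>u a b. w = u @ [a, b] \<and> length u = n" if "length w = n + 2" for w :: "nat list"
  proof -
    have "drop n w = [w ! n, w ! Suc n]"
      using that by (simp add: Cons_nth_drop_Suc[symmetric])
    then show ?thesis using that append_take_drop_id[of n w]
      by (intro exI[of _ "take n w"] exI[of _ "w ! n"] exI[of _ "w ! Suc n"]) simp
  qed
  have fwd: "?h (a, w, M) \<in> ?R" if "(a, w, M) \<in> ?P" for a w M
  proof -
    have p: "a \<in> {1..d} - {x}" "(w, M) \<in> rooted d x n (Suc j)" "a \<notin> set w" "M a \<noteq> a"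
      using that by auto
    let ?A = "{1..d} - set (x # w)"
    have M: "M \<in> matchings (Suc j) ?A" using p(2) by (simp add: rooted_def)
    have "transpose a (M a) \<circ> M \<in> matchings j (?A - {a, M a})"
      using matchings_remove_pair[OF _ M p(4)] by auto
    moreover have "?A - {a, M a} = {1..d} - set (x # w @ [a, M a])" by auto
    moreover have "M a \<in> ?A"
      using M p permutes_in_image[of M ?A a] by (auto simp: matchings_def)
    ultimately show ?thesis using p by (auto simp: rooted_def)
  qed
  show "?h ` ?P \<subseteq> ?R"
  proof
    fix q assume "q \<in> ?h ` ?P"
    then obtain a w M where "(a, w, M) \<in> ?P" "q = ?h (a, w, M)" by auto
    then show "q \<in> ?R" using fwd[of a w M] by (simp only:)
  qed
  have bwd: "?h (?h' p) = p \<and> ?h' p \<in> ?P" if pR: "p \<in> ?R" for p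
  proof -
    obtain w' M where p: "p = (w', M)" by (cases p)
    obtain u a b where u: "w' = u @ [a, b]" "length u = n"
      using split[of w'] pR p by (auto simp: rooted_def)
    have d: "distinct (x # u @ [a, b])" "set (u @ [a, b]) \<subseteq> {1..d}"
      "M \<in> matchings j ({1..d} - set (x # u @ [a, b]))"
      using pR unfolding p u(1) by (auto simp: rooted_def)
    let ?A = "{1..d} - set (x # u)"
    have "{1..d} - set (x # u @ [a, b]) = ?A - {a, b}" by auto
    then have "M \<in> matchings j (?A - {a, b})" using d(3) by simp
    then have T: "transpose a b \<circ> M \<in> matchings (Suc j) ?A"
      using d by (intro matchings_insert_pair) auto
    have "M a = a" "M b = b" using d(3) by (auto simp: matchings_def permutes_def)
    then have Ta: "(transpose a b \<circ> M) a = b" by simp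
    have "(u @ [a, b]) ! n = a" "(u @ [a, b]) ! Suc n = b" "take n (u @ [a, b]) = u"
      using u(2) by (simp_all add: nth_append)
    then have h': "?h' p = (a, u, transpose a b \<circ> M)" unfolding p u(1) prod.case by (simp only:)
    have "transpose a b \<circ> (transpose a b \<circ> M) = M" by (simp add: fun_eq_iff)
    then have "?h (?h' p) = p" unfolding h' unfolding prod.case Ta p u(1) by (simp only: append_assoc)
    moreover have "(a, u, transpose a b \<circ> M) \<in> ?P"
      using T d u(2) Ta by (auto simp: rooted_def simp del: o_apply)
    ultimately show ?thesis unfolding h' by blast
  qed
  show "\<forall>p\<in>?R. ?h (?h' p) = p" by (rule ballI, rule conjunct1, rule bwd)
  show "?h' ` ?R \<subseteq> ?P" by (rule image_subsetI, rule conjunct2, rule bwd)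
qed

lemma no_pair_without_matching:
  "{(a, w, M). a \<in> {1..d} - {x} \<and> (w, M) \<in> rooted d x n 0 \<and> a \<notin> set w \<and> M a \<noteq> a} = {}"
  by (auto simp: rooted_def matchings_0)

text \<open>The one product computation behind the Newton identity. If \<open>a\<close> lies on the cycle through \<open>x\<close>, the
  transposition splits that cycle and the product vanishes in the graded algebra; what remains are the two
  kinds of extension just described.\<close>

lemma star_rooted_sum:
  assumes x: "x \<in> {1..d}"
  shows "gmul d (star d x) (rooted_sum d x n j) =
    (\<lambda>\<rho>. rooted_sum d x (Suc n) j \<rho> + (if j = 0 then 0 else rooted_sum d x (n + 2) (j - 1) \<rho>))"
proof
  fix \<rho>
  let ?R = "rooted d x n j" and ?A = "{1..d} - {x}"
  let ?F = "\<lambda>(a, w, M). transpose a x \<circ> rooted_perm x (w, M)"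
  let ?P1 = "{(a, w, M). a \<in> ?A \<and> (w, M) \<in> ?R \<and> a \<notin> set w \<and> M a = a}"
  let ?P2 = "{(a, w, M). a \<in> ?A \<and> (w, M) \<in> ?R \<and> a \<notin> set w \<and> M a \<noteq> a}"
  have fin: "finite (?A \<times> ?R)" using finite_rooted by simp
  have "gmul d (star d x) (rooted_sum d x n j) \<rho> =
      (\<Sum>a\<in>?A. \<Sum>p\<in>?R. basis_mult d (transpose a x) (rooted_perm x p) \<rho>)"
  proof -
    have "transpose a x permutes {1..d}" if "a \<in> ?A" for a
      using that x by (intro permutes_swap_id) auto
    moreover have "rooted_perm x p permutes {1..d}" if "p \<in> ?R" for p
      using that rootedD(3)[OF _ x] by (cases p) auto
    ultimately show ?thesis
      unfolding star_def rooted_sum_def by (subst gmul_basis_sum) auto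
  qed
  also have "\<dots> = (\<Sum>(a, p)\<in>?A \<times> ?R. basis_mult d (transpose a x) (rooted_perm x p) \<rho>)"
    by (rule sum.cartesian_product)
  also have "\<dots> = (\<Sum>q\<in>?A \<times> ?R. if q \<in> ?P1 \<union> ?P2 then basis_vec (?F q) \<rho> else 0)"
  proof (rule sum.cong[OF refl])
    fix q assume q: "q \<in> ?A \<times> ?R"
    obtain a w M where [simp]: "q = (a, w, M)" by (cases q) auto
    have a: "a \<in> {1..d}" "a \<noteq> x" and r: "(w, M) \<in> ?R" using q by auto
    have "a \<in> orbit (rooted_perm x (w, M)) x \<longleftrightarrow> a \<in> set w"
      using rootedD(4)[OF r x] a by simp
    then show "(case q of (a, p) \<Rightarrow> basis_mult d (transpose a x) (rooted_perm x p) \<rho>) =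
        (if q \<in> ?P1 \<union> ?P2 then basis_vec (?F q) \<rho> else 0)"
      using basis_mult_transpose[OF rootedD(3)[OF r x] a(1) x a(2)] a r by auto
  qed
  also have "\<dots> = (\<Sum>q\<in>(?A \<times> ?R) \<inter> (?P1 \<union> ?P2). basis_vec (?F q) \<rho>)"
    by (rule sum.inter_restrict[OF fin, symmetric])
  also have "(?A \<times> ?R) \<inter> (?P1 \<union> ?P2) = ?P1 \<union> ?P2" by auto
  also have "(\<Sum>q\<in>?P1 \<union> ?P2. basis_vec (?F q) \<rho>) = basis_sum ?F ?P1 \<rho> + basis_sum ?F ?P2 \<rho>"
    unfolding basis_sum_def
  proof (rule sum.union_disjoint)
    show "finite ?P1" by (rule finite_subset[OF _ fin]) auto
    show "finite ?P2" by (rule finite_subset[OF _ fin]) auto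
  qed auto
  also have "basis_sum ?F ?P1 = rooted_sum d x (Suc n) j"
    unfolding rooted_sum_def
  proof (rule basis_sum_reindex[OF extend_by_free[OF x]])
    fix q assume q: "q \<in> ?P1"
    obtain a w M where [simp]: "q = (a, w, M)" by (cases q) auto
    have "distinct (a # x # w)" using q by (auto simp: rooted_def)
    then show "rooted_perm x ((\<lambda>(a, w, M). (w @ [a], M)) q) = ?F q"
      using cycle_of_list_rotate_left[of a x w] by (simp add: rooted_perm_def o_assoc)
  qed
  also have "basis_sum ?F ?P2 \<rho> = (if j = 0 then 0 else rooted_sum d x (n + 2) (j - 1) \<rho>)"
  proof (cases j)
    case 0
    show ?thesis unfolding 0 no_pair_without_matching by (simp add: basis_sum_def)
  next
    case (Suc j')
    have "basis_sum ?F ?P2 = rooted_sum d x (n + 2) j'"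
      unfolding rooted_sum_def Suc
    proof (rule basis_sum_reindex[OF extend_by_pair[OF x]])
      fix q assume q: "q \<in> {(a, w, M). a \<in> ?A \<and> (w, M) \<in> rooted d x n (Suc j') \<and> a \<notin> set w \<and> M a \<noteq> a}"
      obtain a w M where [simp]: "q = (a, w, M)" by (cases q) auto
      have r: "(w, M) \<in> rooted d x n (Suc j')" using q by simp
      then have M: "M \<in> matchings (Suc j') ({1..d} - set (x # w))" by (simp add: rooted_def)
      have "M a \<notin> set (x # w)"
        using matchings_involution[OF M, of a] rootedD(2)[OF r x] q by auto
      then have "distinct (a # M a # x # w)" using q r by (auto simp: rooted_def)
      from cycle_of_list_rotate_left2[OF this]
      have "cycle_of_list (x # w @ [a, M a]) \<circ> (transpose a (M a) \<circ> M) =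
          transpose a x \<circ> cycle_of_list (x # w) \<circ> transpose a (M a) \<circ> (transpose a (M a) \<circ> M)"
        by simp
      also have "\<dots> = transpose a x \<circ> (cycle_of_list (x # w) \<circ> M)" by (simp add: fun_eq_iff)
      finally show "rooted_perm x ((\<lambda>(a, w, M). (w @ [a, M a], transpose a (M a) \<circ> M)) q) = ?F q"
        by (simp add: rooted_perm_def)
    qed
    then show ?thesis using Suc by simp
  qed
  finally show "gmul d (star d x) (rooted_sum d x n j) \<rho> =
    rooted_sum d x (Suc n) j \<rho> + (if j = 0 then 0 else rooted_sum d x (n + 2) (j - 1) \<rho>)" .
qed

text \<open>The marked point is either fixed by the matching or matched itself, and in the latter case its pair
  is a cycle of length two through the root.\<close>

lemma delta_elt_root:
  assumes x: "x \<in> {1..d}"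
  shows "delta_elt d j \<rho> = rooted_sum d x 0 j \<rho> + (if j = 0 then 0 else rooted_sum d x 1 (j - 1) \<rho>)"
proof -
  let ?A = "{1..d}"
  let ?F = "{M \<in> matchings j ?A. M x = x}" and ?G = "{M \<in> matchings j ?A. M x \<noteq> x}"
  have "delta_elt d j \<rho> = (\<Sum>M\<in>?F \<union> ?G. basis_vec M \<rho>)"
    unfolding delta_elt_eq basis_sum_def by (rule sum.cong) auto
  also have "\<dots> = basis_sum (\<lambda>M. M) ?F \<rho> + basis_sum (\<lambda>M. M) ?G \<rho>"
    unfolding basis_sum_def using finite_matchings[of ?A j] by (intro sum.union_disjoint) auto
  also have "basis_sum (\<lambda>M. M) ?F = rooted_sum d x 0 j"
    unfolding rooted_sum_def
  proof (rule basis_sum_reindex)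
    show "bij_betw (\<lambda>M. ([], M)) ?F (rooted d x 0 j)"
    proof (rule bij_betw_imageI)
      have "?F = matchings j (?A - {x})" using matchings_restrict[of _ j ?A "{x}"] by auto
      then show "(\<lambda>M. ([], M)) ` ?F = rooted d x 0 j" unfolding rooted_def by auto
    qed (simp add: inj_on_def)
  qed (simp add: rooted_perm_def)
  also have "basis_sum (\<lambda>M. M) ?G \<rho> = (if j = 0 then 0 else rooted_sum d x 1 (j - 1) \<rho>)"
  proof (cases j)
    case 0
    have G: "?G = {}" unfolding 0 matchings_0[OF finite_atLeastAtMost] by auto
    have "basis_sum (\<lambda>M. M) ?G \<rho> = 0" unfolding G by (simp add: basis_sum_def)
    then show ?thesis by (simp only: 0 refl if_True)
  next
    case (Suc j')
    have "basis_sum (\<lambda>M. M) ?G = rooted_sum d x 1 j'"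
      unfolding rooted_sum_def
    proof (rule basis_sum_reindex)
      show "bij_betw (\<lambda>M. ([M x], transpose x (M x) \<circ> M)) ?G (rooted d x 1 j')"
      proof (rule bij_betw_byWitness[where f' = "\<lambda>(w, M). transpose x (hd w) \<circ> M"])
        show "\<forall>M\<in>?G. (\<lambda>(w, M). transpose x (hd w) \<circ> M) ([M x], transpose x (M x) \<circ> M) = M"
          by (simp add: fun_eq_iff)
        show "(\<lambda>M. ([M x], transpose x (M x) \<circ> M)) ` ?G \<subseteq> rooted d x 1 j'"
        proof
          fix p assume "p \<in> (\<lambda>M. ([M x], transpose x (M x) \<circ> M)) ` ?G"
          then obtain M where M: "M \<in> matchings (Suc j') ?A" "M x \<noteq> x"
            and p: "p = ([M x], transpose x (M x) \<circ> M)" using Suc by auto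
          have "M permutes ?A" using M(1) by (simp add: matchings_def)
          then have "M x \<in> ?A" using permutes_in_image[of M ?A x] x by simp
          moreover have "transpose x (M x) \<circ> M \<in> matchings j' (?A - set [x, M x])"
            using matchings_remove_pair[OF _ M] by auto
          ultimately show "p \<in> rooted d x 1 j'" using M(2) by (auto simp: p rooted_def)
        qed
        have bck: "transpose x (hd w) \<circ> M \<in> ?G \<and> (transpose x (hd w) \<circ> M) x = hd w \<and> [hd w] = w"
          if wM: "(w, M) \<in> rooted d x 1 j'" for w M
        proof -
          obtain b where w: "w = [b]" using wM by (auto simp: rooted_def length_Suc_conv)
          have b: "b \<noteq> x" "b \<in> ?A" and M: "M \<in> matchings j' (?A - {x, b})"
            using wM unfolding w rooted_def by auto
          have T: "transpose x b \<circ> M \<in> matchings j ?A"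
            using matchings_insert_pair[OF _ M] b x Suc by auto
          have "M x = x" using rootedD(2)[OF wM x] by simp
          then show ?thesis using T b w by simp
        qed
        show "(\<lambda>(w, M). transpose x (hd w) \<circ> M) ` rooted d x 1 j' \<subseteq> ?G"
          using bck by (intro image_subsetI) (metis (no_types, lifting) case_prod_beta prod.collapse)
        show "\<forall>p\<in>rooted d x 1 j'. (\<lambda>M. ([M x], transpose x (M x) \<circ> M)) ((\<lambda>(w, M). transpose x (hd w) \<circ> M) p) = p"
        proof
          fix p assume pr: "p \<in> rooted d x 1 j'"
          obtain w M where p: "p = (w, M)" by (cases p)
          have b: "(transpose x (hd w) \<circ> M) x = hd w" "[hd w] = w" using bck pr unfolding p by blast+
          have "transpose x (hd w) \<circ> (transpose x (hd w) \<circ> M) = M" by (simp add: fun_eq_iff)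
          then show "(\<lambda>M. ([M x], transpose x (M x) \<circ> M)) ((\<lambda>(w, M). transpose x (hd w) \<circ> M) p) = p"
            unfolding p prod.case b by (simp only: b)
        qed
      qed
    next
      fix M :: "nat \<Rightarrow> nat"
      show "rooted_perm x ([M x], transpose x (M x) \<circ> M) = M"
        by (simp add: rooted_perm_def fun_eq_iff)
    qed
    then show ?thesis using Suc by simp
  qed
  finally show ?thesis .
qed

lemma rooted_sum_0_0: "rooted_sum d x 0 0 = basis_vec id"
proof -
  have "rooted d x 0 0 = {([], id)}" unfolding rooted_def by (auto simp: matchings_0)
  then show ?thesis by (simp add: rooted_sum_def basis_sum_def rooted_perm_def)
qed

lemma rooted_sum_Suc_0:
  "x \<in> {1..d} \<Longrightarrow> rooted_sum d x (Suc n) 0 = gmul d (star d x) (rooted_sum d x n 0)"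
  by (simp only: star_rooted_sum) simp

text \<open>Ballot numbers, with the Catalan numbers as \<open>ballot 0 r\<close>. If a cycle word of length \<open>n\<close> is recorded as
  \<open>z\<^sup>n\<close> and the number of matched pairs is ignored, \<open>star\<close> acts as multiplication by \<open>z + z\<^sup>2\<close> and
  \<open>delta_elt\<close> corresponds to \<open>1 + z\<close>; up to the signs \<open>(-1)\<^sup>r\<close>, the number \<open>ballot n r\<close> is the coefficient of
  \<open>(z + z\<^sup>2)\<^bsup>n+r\<^esup>\<close> in the expansion of \<open>z\<^sup>n / (1 + z)\<close>. The recursion shows at once that they are positive,
  which is all that matters later.\<close>

fun ballot :: "nat \<Rightarrow> nat \<Rightarrow> nat" where
  "ballot n 0 = 1"
| "ballot 0 (Suc r) = ballot 1 r"
| "ballot (Suc n) (Suc r) = ballot n (Suc r) + ballot (n + 2) r"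

lemma ballot_pos: "ballot n r > 0"
  by (induction n r rule: ballot.induct) auto

lemma supported_delta_elt: "supported d (delta_elt d j)"
  unfolding delta_elt_eq by (rule supported_basis_sum) (simp add: matchings_def)

lemma star_gmul_rooted_sum:
  assumes "x \<in> {1..d}"
  shows "gmul d (star d x) (gmul d (rooted_sum d x n 0) f) = gmul d (rooted_sum d x (Suc n) 0) f"
  by (simp add: rooted_sum_Suc_0[OF assms] gmul_assoc)

text \<open>Read \<open>star_rooted_sum\<close> and \<open>delta_elt_root\<close> as formulas for a rooted sum with a longer word, or with
  empty word, in terms of rooted sums with fewer matched pairs. Unwinding them expresses every rooted sum
  through powers of \<open>star\<close>, that is rooted sums without pairs, applied to matchings; the recursion for
  the coefficients is the one defining the ballot numbers.\<close>

lemma rooted_sum_expand: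
  assumes x: "x \<in> {1..d}"
  shows "rooted_sum d x n j = (\<lambda>\<rho>. \<Sum>r\<le>j. (-1) ^ r * of_nat (ballot n r) *
    gmul d (rooted_sum d x (n + r) 0) (delta_elt d (j - r)) \<rho>)"
proof (induction j arbitrary: n rule: less_induct)
  case (less j)
  let ?W = "\<lambda>k i. gmul d (rooted_sum d x k 0) (delta_elt d i)"
  have W0: "?W 0 i = delta_elt d i" for i
    by (simp add: rooted_sum_0_0 gmul_one_left supported_delta_elt)
  show ?case
  proof (induction n)
    case 0
    show ?case
    proof
      fix \<rho>
      show "rooted_sum d x 0 j \<rho> = (\<Sum>r\<le>j. (-1) ^ r * of_nat (ballot 0 r) * ?W (0 + r) (j - r) \<rho>)"
      proof (cases j)
        case 0
        then show ?thesis using delta_elt_root[OF x, of 0 \<rho>] by (simp add: W0)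
      next
        case (Suc j')
        have "rooted_sum d x 0 j \<rho> = delta_elt d j \<rho> - rooted_sum d x 1 j' \<rho>"
          using delta_elt_root[OF x, of j \<rho>] Suc by simp
        also have "rooted_sum d x 1 j' \<rho> =
            (\<Sum>r\<le>j'. (-1) ^ r * of_nat (ballot 1 r) * ?W (1 + r) (j' - r) \<rho>)"
          using less.IH[of j' 1] Suc by simp
        also have "delta_elt d j \<rho> - \<dots> = delta_elt d j \<rho> +
            (\<Sum>r\<le>j'. (-1) ^ Suc r * of_nat (ballot 0 (Suc r)) * ?W (0 + Suc r) (j - Suc r) \<rho>)"
          by (simp add: sum_negf Suc)
        also have "\<dots> = (\<Sum>r\<le>j. (-1) ^ r * of_nat (ballot 0 r) * ?W (0 + r) (j - r) \<rho>)"
          unfolding Suc sum.atMost_Suc_shift by (simp add: W0)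
        finally show ?thesis .
      qed
    qed
  next
    case (Suc n)
    show ?case
    proof
      fix \<rho>
      have T: "gmul d (star d x) (rooted_sum d x n j) \<rho> =
          (\<Sum>r\<le>j. (-1) ^ r * of_nat (ballot n r) * ?W (Suc n + r) (j - r) \<rho>)"
        by (subst Suc) (simp add: gmul_sum_right gmul_scale_right star_gmul_rooted_sum[OF x])
      have S: "rooted_sum d x (Suc n) j \<rho> = gmul d (star d x) (rooted_sum d x n j) \<rho> -
          (if j = 0 then 0 else rooted_sum d x (n + 2) (j - 1) \<rho>)"
        using star_rooted_sum[OF x, of n j] by (simp add: fun_eq_iff)
      show "rooted_sum d x (Suc n) j \<rho> =
          (\<Sum>r\<le>j. (-1) ^ r * of_nat (ballot (Suc n) r) * ?W (Suc n + r) (j - r) \<rho>)"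
      proof (cases j)
        case 0
        then show ?thesis unfolding S T by simp
      next
        case (Suc j')
        have "rooted_sum d x (n + 2) j' \<rho> =
            (\<Sum>r\<le>j'. (-1) ^ r * of_nat (ballot (n + 2) r) * ?W (n + 2 + r) (j' - r) \<rho>)"
          using less.IH[of j' "n + 2"] Suc by simp
        then have "rooted_sum d x (Suc n) j \<rho> = ?W (Suc n) j \<rho> +
            (\<Sum>r\<le>j'. (-1) ^ Suc r * of_nat (ballot n (Suc r)) * ?W (Suc n + Suc r) (j - Suc r) \<rho>) -
            (\<Sum>r\<le>j'. (-1) ^ r * of_nat (ballot (n + 2) r) * ?W (n + 2 + r) (j' - r) \<rho>)"
          unfolding S T unfolding Suc sum.atMost_Suc_shift by simp
        also have "\<dots> = ?W (Suc n) j \<rho> +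
            (\<Sum>r\<le>j'. (-1) ^ Suc r * of_nat (ballot (Suc n) (Suc r)) * ?W (Suc n + Suc r) (j - Suc r) \<rho>)"
          unfolding add_diff_eq[symmetric] sum_subtractf[symmetric]
          by (intro arg_cong2[where f = "(+)"] refl sum.cong) (simp add: Suc algebra_simps)
        also have "\<dots> = (\<Sum>r\<le>j. (-1) ^ r * of_nat (ballot (Suc n) r) * ?W (Suc n + r) (j - r) \<rho>)"
          unfolding Suc sum.atMost_Suc_shift by simp
        finally show ?thesis .
      qed
    qed
  qed
qed

text \<open>With an empty word the root is any one of the \<open>d - 2 j\<close> fixed points of the matching.\<close>

lemma sum_rooted_sum_matchings:
  "(\<Sum>x\<in>{1..d}. rooted_sum d x 0 j \<rho>) = (of_nat d - 2 * of_nat j) * delta_elt d j \<rho>"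
proof -
  let ?A = "{1..d}"
  have "rooted_sum d x 0 j \<rho> = (\<Sum>M\<in>matchings j ?A. if M x = x then basis_vec M \<rho> else 0)"
    if x: "x \<in> ?A" for x
  proof -
    have "rooted d x 0 j = (\<lambda>M. ([], M)) ` {M \<in> matchings j ?A. M x = x}"
      using matchings_restrict[of _ j ?A "{x}"] by (auto simp: rooted_def)
    then have "rooted_sum d x 0 j \<rho> = (\<Sum>M\<in>{M \<in> matchings j ?A. M x = x}. basis_vec M \<rho>)"
      unfolding rooted_sum_def basis_sum_def
      by (simp only:) (subst sum.reindex, auto simp: inj_on_def rooted_perm_def)
    then show ?thesis using finite_matchings[of ?A j] by (simp only: sum.inter_filter finite_atLeastAtMost)
  qed
  then have "(\<Sum>x\<in>?A. rooted_sum d x 0 j \<rho>) =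
      (\<Sum>x\<in>?A. \<Sum>M\<in>matchings j ?A. if M x = x then basis_vec M \<rho> else 0)" by (rule sum.cong[OF refl])
  also have "\<dots> = (\<Sum>M\<in>matchings j ?A. \<Sum>x\<in>?A. if M x = x then basis_vec M \<rho> else 0)"
    by (rule sum.swap)
  also have "\<dots> = (\<Sum>M\<in>matchings j ?A. (of_nat d - 2 * of_nat j) * basis_vec M \<rho>)"
  proof (rule sum.cong[OF refl])
    fix M assume M: "M \<in> matchings j ?A"
    have sub: "{x. M x \<noteq> x} \<subseteq> ?A" using M by (auto simp: matchings_def permutes_def)
    have c: "card {x. M x \<noteq> x} = 2 * j" using M by (simp add: matchings_def)
    have "{x \<in> ?A. M x = x} = ?A - {x. M x \<noteq> x}" by auto
    then have "card {x \<in> ?A. M x = x} = d - 2 * j"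
      using card_Diff_subset[OF finite_subset[OF sub] sub] c by simp
    moreover have "2 * j \<le> d" using card_mono[OF _ sub] c by simp
    moreover have "(\<Sum>x\<in>?A. if M x = x then basis_vec M \<rho> else 0) =
        of_nat (card {x \<in> ?A. M x = x}) * basis_vec M \<rho>"
      by (simp add: sum.inter_filter[symmetric])
    ultimately show "(\<Sum>x\<in>?A. if M x = x then basis_vec M \<rho> else 0) =
        (of_nat d - 2 * of_nat j) * basis_vec M \<rho>" by (simp add: of_nat_diff)
  qed
  also have "\<dots> = (of_nat d - 2 * of_nat j) * delta_elt d j \<rho>"
    unfolding delta_elt_eq basis_sum_def by (rule sum_distrib_left[symmetric])
  finally show ?thesis .
qed

lemma has_single_cycle_length:
  "has_cycle_lengths d [l] \<sigma> \<longleftrightarrow>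
    (\<exists>cs. length cs = l \<and> distinct cs \<and> set cs \<subseteq> {1..d} \<and> \<sigma> = cycle_of_list cs)"
proof
  assume "has_cycle_lengths d [l] \<sigma>"
  then obtain css where css: "map length css = [l]" "distinct (concat css)"
    "set (concat css) \<subseteq> {1..d}" "\<sigma> = foldr (\<circ>) (map cycle_of_list css) id"
    unfolding has_cycle_lengths_def by (elim exE conjE)
  then obtain cs where "css = [cs]" "length cs = l" by auto
  then show "\<exists>cs. length cs = l \<and> distinct cs \<and> set cs \<subseteq> {1..d} \<and> \<sigma> = cycle_of_list cs"
    using css by auto
next
  assume "\<exists>cs. length cs = l \<and> distinct cs \<and> set cs \<subseteq> {1..d} \<and> \<sigma> = cycle_of_list cs"
  then obtain cs where "length cs = l" "distinct cs" "set cs \<subseteq> {1..d}" "\<sigma> = cycle_of_list cs"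
    by blast
  then show "has_cycle_lengths d [l] \<sigma>"
    unfolding has_cycle_lengths_def by (intro exI[of _ "[cs]"]) simp
qed

text \<open>A cycle of length \<open>k + 1 \<ge> 2\<close> is listed once for each of its \<open>k + 1\<close> points as root. For \<open>k = 0\<close> the
  sum is \<open>d\<close> times the identity instead, as every point is a root.\<close>

lemma sum_rooted_sum_cycles:
  assumes k: "k > 0"
  shows "(\<Sum>x\<in>{1..d}. rooted_sum d x k 0 \<rho>) = of_nat (Suc k) * gamma_elt d (Suc k) \<rho>"
proof -
  let ?L = "{cs. length cs = Suc k \<and> distinct cs \<and> set cs \<subseteq> {1..d}}"
  let ?W = "\<lambda>x. {w. length w = k \<and> distinct (x # w) \<and> set w \<subseteq> {1..d}}"
  have finL: "finite ?L"
    by (rule finite_subset[OF _ finite_lists_length_eq[of "{1..d}" "Suc k"]]) auto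
  have rs: "rooted_sum d x k 0 \<rho> = (\<Sum>w\<in>?W x. basis_vec (cycle_of_list (x # w)) \<rho>)" for x
  proof -
    have "rooted d x k 0 = (\<lambda>w. (w, id)) ` ?W x"
      unfolding rooted_def by (auto simp: matchings_0)
    then show ?thesis unfolding rooted_sum_def basis_sum_def
      by (simp only:) (subst sum.reindex, auto simp: inj_on_def rooted_perm_def)
  qed
  have finW: "finite (?W x)" for x
    by (rule finite_subset[OF _ finite_lists_length_eq[of "{1..d}" k]]) auto
  have "(\<Sum>x\<in>{1..d}. rooted_sum d x k 0 \<rho>) =
      (\<Sum>(x, w)\<in>(SIGMA x:{1..d}. ?W x). basis_vec (cycle_of_list (x # w)) \<rho>)"
    unfolding rs by (rule sum.Sigma) (use finW in auto)
  also have "\<dots> = (\<Sum>cs\<in>?L. basis_vec (cycle_of_list cs) \<rho>)"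
    by (rule sum.reindex_bij_witness[where i = "\<lambda>cs. (hd cs, tl cs)" and j = "\<lambda>(x, w). x # w"])
      (auto simp: length_Suc_conv)
  also have "\<dots> = of_nat (card {cs \<in> ?L. cycle_of_list cs = \<rho>})"
    using finL by (simp add: basis_vec_def sum.inter_filter[symmetric] eq_commute[of \<rho>])
  also have "\<dots> = of_nat (Suc k) * gamma_elt d (Suc k) \<rho>"
  proof -
    let ?C = "{\<sigma> \<in> perms d. has_cycle_lengths d [Suc k] \<sigma>}"
    have g: "gamma_elt d (Suc k) \<rho> = (if \<rho> \<in> ?C then 1 else 0)"
    proof -
      have "finite ?C" using finite_perms by simp
      then have "(\<Sum>\<sigma>\<in>?C. basis_vec \<sigma> \<rho>) = (if \<rho> \<in> ?C then 1 else 0)"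
        unfolding basis_vec_def by (rule sum.delta')
      then show ?thesis
        by (simp only: gamma_elt_def cycle_class_sum_def carrier_sym_group)
    qed
    show ?thesis
    proof (cases "\<exists>cs\<in>?L. cycle_of_list cs = \<rho>")
      case True
      then obtain cs where cs: "cs \<in> ?L" "cycle_of_list cs = \<rho>" by blast
      have "\<rho> \<in> ?C" using cs cycle_permutes_superset[of cs d] by (auto simp: has_single_cycle_length)
      moreover have "bij_betw hd {cs \<in> ?L. cycle_of_list cs = \<rho>} (set cs)"
      proof (rule bij_betw_imageI)
        show "inj_on hd {cs \<in> ?L. cycle_of_list cs = \<rho>}"
          by (intro inj_onI, rule cycle_of_list_eq_iff_hd) auto
        have len: "length cs \<ge> 2" using cs(1) k by auto
        show "hd ` {cs \<in> ?L. cycle_of_list cs = \<rho>} = set cs"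
        proof
          show "hd ` {cs \<in> ?L. cycle_of_list cs = \<rho>} \<subseteq> set cs"
          proof
            fix y assume "y \<in> hd ` {cs \<in> ?L. cycle_of_list cs = \<rho>}"
            then obtain cs' where c: "cs' \<in> ?L" "cycle_of_list cs' = \<rho>" "y = hd cs'" by auto
            then have "y \<in> set cs'" by (cases cs') auto
            then have "\<rho> y \<noteq> y" using cycle_of_list_moves[of cs' y] c k by auto
            then show "y \<in> set cs" using cycle_of_list_moves[of cs y] cs len by auto
          qed
          show "set cs \<subseteq> hd ` {cs \<in> ?L. cycle_of_list cs = \<rho>}"
          proof
            fix y assume "y \<in> set cs"
            then obtain i where i: "i < length cs" "y = cs ! i" by (auto simp: in_set_conv_nth)
            have "hd (rotate i cs) = y"
              using i by (metis hd_rotate_conv_nth length_0_conv mod_less not_less_zero)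
            moreover have "cycle_of_list (rotate i cs) = \<rho>"
              using cycle_of_list_rotate_independent[of cs i] cs by simp
            ultimately show "y \<in> hd ` {cs \<in> ?L. cycle_of_list cs = \<rho>}"
              using cs by (intro image_eqI[of _ _ "rotate i cs"]) auto
          qed
        qed
      qed
      then have "card {cs \<in> ?L. cycle_of_list cs = \<rho>} = Suc k"
        using cs distinct_card[of cs] by (simp add: bij_betw_same_card)
      ultimately show ?thesis unfolding g by simp
    next
      case False
      then have "\<rho> \<notin> ?C" by (auto simp: has_single_cycle_length)
      moreover have "{cs \<in> ?L. cycle_of_list cs = \<rho>} = {}" using False by blast
      ultimately show ?thesis unfolding g by (simp only: card.empty) simp
    qed
  qed
  finally show ?thesis .
qed

definition newton_coeff :: "nat \<Rightarrow> rat" where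
  "newton_coeff k = (-1) ^ Suc k * of_nat (ballot 0 k * Suc k)"

lemma newton_coeff_nonzero: "newton_coeff k \<noteq> 0"
  using ballot_pos[of 0 k]
  by (simp add: newton_coeff_def del: of_nat_mult of_nat_Suc mult_Suc_right)

text \<open>Sum the expansion of the rooted sums with empty word over all roots. The term \<open>r = 0\<close> contributes
  \<open>d\<close> times \<open>delta_elt d j\<close>, against \<open>d - 2 j\<close> times the same element on the left.\<close>

lemma newton_identity:
  "2 * of_nat j * delta_elt d j \<rho> =
    (\<Sum>k=1..j. newton_coeff k * gmul d (gamma_elt d (Suc k)) (delta_elt d (j - k)) \<rho>)"
proof -
  let ?D = "\<lambda>r. delta_elt d (j - r)"
  let ?c = "\<lambda>r. (-1) ^ r * of_nat (ballot 0 r) :: rat"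
  have G: "(\<Sum>x\<in>{1..d}. gmul d (rooted_sum d x r 0) (?D r) \<rho>) =
      of_nat (Suc r) * gmul d (gamma_elt d (Suc r)) (?D r) \<rho>" if "r > 0" for r
  proof -
    have "(\<Sum>x\<in>{1..d}. gmul d (rooted_sum d x r 0) (?D r) \<rho>) =
        gmul d (\<lambda>\<rho>. \<Sum>x\<in>{1..d}. rooted_sum d x r 0 \<rho>) (?D r) \<rho>"
      by (simp only: gmul_sum_left)
    then show ?thesis by (simp only: sum_rooted_sum_cycles[OF that] gmul_scale_left)
  qed
  have "(of_nat d - 2 * of_nat j) * delta_elt d j \<rho> = (\<Sum>x\<in>{1..d}. rooted_sum d x 0 j \<rho>)"
    by (rule sum_rooted_sum_matchings[symmetric])
  also have "\<dots> = (\<Sum>x\<in>{1..d}. \<Sum>r\<le>j. ?c r * gmul d (rooted_sum d x r 0) (?D r) \<rho>)"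
  proof (rule sum.cong[OF refl])
    fix x assume "x \<in> {1..d}"
    from fun_cong[OF rooted_sum_expand[OF this, of 0 j], of \<rho>]
    show "rooted_sum d x 0 j \<rho> = (\<Sum>r\<le>j. ?c r * gmul d (rooted_sum d x r 0) (?D r) \<rho>)"
      by (simp only: add_0)
  qed
  also have "\<dots> = (\<Sum>r\<le>j. \<Sum>x\<in>{1..d}. ?c r * gmul d (rooted_sum d x r 0) (?D r) \<rho>)"
    by (rule sum.swap)
  also have "\<dots> = (\<Sum>r\<le>j. ?c r * (\<Sum>x\<in>{1..d}. gmul d (rooted_sum d x r 0) (?D r) \<rho>))"
    by (simp only: sum_distrib_left)
  also have "\<dots> = of_nat d * delta_elt d j \<rho> +
      (\<Sum>r=1..j. ?c r * (\<Sum>x\<in>{1..d}. gmul d (rooted_sum d x r 0) (?D r) \<rho>))"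
  proof -
    have "{..j} = insert 0 {1..j}" by auto
    then show ?thesis
      by (simp add: rooted_sum_0_0 gmul_one_left supported_delta_elt)
  qed
  also have "(\<Sum>r=1..j. ?c r * (\<Sum>x\<in>{1..d}. gmul d (rooted_sum d x r 0) (?D r) \<rho>)) =
      (\<Sum>r=1..j. - (newton_coeff r * gmul d (gamma_elt d (Suc r)) (?D r) \<rho>))"
  proof (rule sum.cong[OF refl])
    fix r assume "r \<in> {1..j}"
    then have "r > 0" by simp
    show "?c r * (\<Sum>x\<in>{1..d}. gmul d (rooted_sum d x r 0) (?D r) \<rho>) =
        - (newton_coeff r * gmul d (gamma_elt d (Suc r)) (?D r) \<rho>)"
      unfolding G[OF \<open>r > 0\<close>] by (simp add: newton_coeff_def algebra_simps)
  qed
  also have "\<dots> = - (\<Sum>r=1..j. newton_coeff r * gmul d (gamma_elt d (Suc r)) (?D r) \<rho>)"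
    by (rule sum_negf)
  finally show ?thesis by (simp add: algebra_simps)
qed

lemma delta_elt_0: "delta_elt d 0 = basis_vec id"
  unfolding delta_elt_eq by (simp add: matchings_0 basis_sum_def)

lemma delta_elt_large:
  assumes "2 * j > d" shows "delta_elt d j = (\<lambda>_. 0)"
proof -
  have "matchings j {1..d} = {}"
  proof (rule ccontr)
    assume "matchings j {1..d} \<noteq> {}"
    then obtain M where M: "M permutes {1..d}" "card {y. M y \<noteq> y} = 2 * j"
      by (auto simp: matchings_def)
    then have "{y. M y \<noteq> y} \<subseteq> {1..d}" by (auto simp: permutes_def)
    from card_mono[OF finite_atLeastAtMost this] have "2 * j \<le> d" using M(2) by simp
    then show False using assms by simp
  qed
  then show ?thesis by (simp add: delta_elt_eq basis_sum_def)
qed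

text \<open>The coefficient of the cycle sum of norm \<open>j\<close> in the Newton identity is nonzero, so the identity can be
  solved for it. This also applies when \<open>2 j > d\<close> and the matching sum vanishes.\<close>

lemma gamma_from_delta:
  assumes "j \<ge> 1" "\<And>i. i \<le> j \<Longrightarrow> delta_elt d i \<in> subalg d S"
    "\<And>k. 1 \<le> k \<Longrightarrow> k < j \<Longrightarrow> gamma_elt d (Suc k) \<in> subalg d S"
    "supported d (gamma_elt d (Suc j))"
  shows "gamma_elt d (Suc j) \<in> subalg d S"
proof -
  let ?t = "\<lambda>k \<rho>. newton_coeff k * gmul d (gamma_elt d (Suc k)) (delta_elt d (j - k)) \<rho>"
  let ?rest = "\<lambda>\<rho>. 2 * of_nat j * delta_elt d j \<rho> - (\<Sum>k\<in>{1..<j}. ?t k \<rho>)"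
  have one: "gmul d (gamma_elt d (Suc j)) (delta_elt d 0) = gamma_elt d (Suc j)"
    unfolding delta_elt_0 gmul_commute[OF basis_vec_id_invariant] by (rule gmul_one_left[OF assms(4)])
  have "newton_coeff j * gamma_elt d (Suc j) \<rho> = ?rest \<rho>" for \<rho>
  proof -
    have "{1..j} = insert j {1..<j}" using assms(1) by auto
    then show ?thesis using newton_identity[of j d \<rho>] one by simp
  qed
  then have eq: "gamma_elt d (Suc j) = (\<lambda>\<rho>. inverse (newton_coeff j) * ?rest \<rho>)"
    using newton_coeff_nonzero[of j] by (simp add: fun_eq_iff field_simps)
  have "?rest \<in> subalg d S"
    using assms by (intro subalg_diff subalg_scale subalg_sum subalg_gmul) auto
  then show ?thesis unfolding eq by (rule subalg_scale)
qed

lemma delta_from_gamma: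
  assumes "j \<ge> 1" "\<And>k. 1 \<le> k \<Longrightarrow> k \<le> j \<Longrightarrow> gamma_elt d (Suc k) \<in> subalg d S"
    "\<And>i. i < j \<Longrightarrow> delta_elt d i \<in> subalg d S"
  shows "delta_elt d j \<in> subalg d S"
proof -
  let ?t = "\<lambda>k \<rho>. newton_coeff k * gmul d (gamma_elt d (Suc k)) (delta_elt d (j - k)) \<rho>"
  have eq: "delta_elt d j = (\<lambda>\<rho>. inverse (2 * of_nat j) * (\<Sum>k=1..j. ?t k \<rho>))"
    using assms(1) unfolding newton_identity[symmetric] by (simp add: fun_eq_iff)
  have "(\<lambda>\<rho>. \<Sum>k=1..j. ?t k \<rho>) \<in> subalg d S"
    using assms by (intro subalg_sum subalg_scale subalg_gmul) auto
  then show ?thesis by (subst eq) (rule subalg_scale)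
qed

section \<open>Generation by the cycle classes\<close>

definition conjugate :: "nat \<Rightarrow> (nat \<Rightarrow> nat) \<Rightarrow> (nat \<Rightarrow> nat) \<Rightarrow> bool" where
  "conjugate d \<sigma> \<tau> \<longleftrightarrow> (\<exists>\<pi>. \<pi> permutes {1..d} \<and> \<pi> \<circ> \<sigma> = \<tau> \<circ> \<pi>)"

lemma conjugate_refl: "conjugate d \<sigma> \<sigma>"
  unfolding conjugate_def by (rule exI[of _ id]) (simp add: permutes_id)

lemma conjugate_conj: "\<pi> permutes {1..d} \<Longrightarrow> conjugate d \<sigma> (\<pi> \<circ> \<sigma> \<circ> inv' \<pi>)"
  unfolding conjugate_def by (rule exI[of _ \<pi>]) (simp add: fun_eq_iff permutes_inverses)

lemma conjugate_sym:
  assumes "conjugate d \<sigma> \<tau>" shows "conjugate d \<tau> \<sigma>"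
proof -
  obtain \<pi> where \<pi>: "\<pi> permutes {1..d}" "\<And>y. \<pi> (\<sigma> y) = \<tau> (\<pi> y)"
    using assms unfolding conjugate_def fun_eq_iff by auto
  have "inv' \<pi> (\<tau> y) = \<sigma> (inv' \<pi> y)" for y
    using \<pi>(2)[of "inv' \<pi> y"] permutes_inverses[OF \<pi>(1)] by metis
  then show ?thesis unfolding conjugate_def
    using permutes_inv[OF \<pi>(1)] by (intro exI[of _ "inv' \<pi>"]) (simp add: fun_eq_iff)
qed

lemma conjugate_trans:
  assumes "conjugate d \<sigma> \<tau>" "conjugate d \<tau> \<upsilon>" shows "conjugate d \<sigma> \<upsilon>"
proof -
  obtain \<pi> where \<pi>: "\<pi> permutes {1..d}" "\<And>y. \<pi> (\<sigma> y) = \<tau> (\<pi> y)"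
    using assms unfolding conjugate_def fun_eq_iff by auto
  obtain \<pi>' where \<pi>': "\<pi>' permutes {1..d}" "\<And>y. \<pi>' (\<tau> y) = \<upsilon> (\<pi>' y)"
    using assms unfolding conjugate_def fun_eq_iff by auto
  show ?thesis unfolding conjugate_def
    using permutes_compose[OF \<pi>(1) \<pi>'(1)] \<pi>(2) \<pi>'(2)
    by (intro exI[of _ "\<pi>' \<circ> \<pi>"]) (simp add: fun_eq_iff)
qed

lemma invariant_conjugate:
  assumes f: "invariant d f" and \<sigma>: "\<sigma> permutes {1..d}" and c: "conjugate d \<sigma> \<tau>"
  shows "f \<tau> = f \<sigma>"
proof -
  obtain \<pi> where \<pi>: "\<pi> permutes {1..d}" "\<pi> \<circ> \<sigma> = \<tau> \<circ> \<pi>"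
    using c unfolding conjugate_def by blast
  have "\<tau> = \<tau> \<circ> \<pi> \<circ> inv' \<pi>" using permutes_inverses[OF \<pi>(1)] by (simp add: fun_eq_iff)
  then have "\<tau> = \<pi> \<circ> \<sigma> \<circ> inv' \<pi>" using \<pi>(2) by simp
  then show ?thesis using f \<sigma> \<pi>(1) unfolding invariant_def by metis
qed

lemma card_moved_conjugate:
  assumes "conjugate d \<sigma> \<tau>"
  shows "card {y. \<tau> y \<noteq> y} = card {y. \<sigma> y \<noteq> y}"
proof -
  obtain \<pi> where \<pi>: "\<pi> permutes {1..d}" "\<And>y. \<pi> (\<sigma> y) = \<tau> (\<pi> y)"
    using assms unfolding conjugate_def fun_eq_iff by auto
  have inj: "inj \<pi>" and surj: "surj \<pi>" using permutes_inj[OF \<pi>(1)] permutes_surj[OF \<pi>(1)] by auto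
  have eq: "\<tau> (\<pi> z) \<noteq> \<pi> z \<longleftrightarrow> \<sigma> z \<noteq> z" for z
    using \<pi>(2)[of z] inj_eq[OF inj, of "\<sigma> z" z] by simp
  have "{y. \<tau> y \<noteq> y} = \<pi> ` {y. \<sigma> y \<noteq> y}"
  proof (rule Set.set_eqI)
    fix y
    obtain z where z: "y = \<pi> z" using surj by auto
    show "y \<in> {y. \<tau> y \<noteq> y} \<longleftrightarrow> y \<in> \<pi> ` {y. \<sigma> y \<noteq> y}"
      unfolding z inj_image_mem_iff[OF inj] mem_Collect_eq by (rule eq)
  qed
  then show ?thesis using card_image[of \<pi>] inj inj_on_subset by (metis subset_UNIV)
qed

definition class_indicator :: "nat \<Rightarrow> (nat \<Rightarrow> nat) \<Rightarrow> (nat \<Rightarrow> nat) \<Rightarrow> rat" where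
  "class_indicator d \<sigma> \<rho> = (if \<rho> permutes {1..d} \<and> conjugate d \<sigma> \<rho> then 1 else 0)"

lemma class_indicator_invariant: "invariant d (class_indicator d \<sigma>)"
proof -
  have "conjugate d \<sigma> (\<pi> \<circ> \<rho> \<circ> inv' \<pi>) \<longleftrightarrow> conjugate d \<sigma> \<rho>" if "\<pi> permutes {1..d}" for \<pi> \<rho>
    using conjugate_conj[OF that] conjugate_sym conjugate_trans by blast
  then show ?thesis
    unfolding invariant_def supported_def class_indicator_def by (simp add: permutes_conj)
qed

lemma cycle_class_sum_eq:
  "cycle_class_sum d ls \<rho> = (if \<rho> permutes {1..d} \<and> has_cycle_lengths d ls \<rho> then 1 else 0)"
proof -
  let ?C = "{\<sigma> \<in> perms d. has_cycle_lengths d ls \<sigma>}"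
  have "finite ?C" using finite_perms by simp
  then have "(\<Sum>\<sigma>\<in>?C. basis_vec \<sigma> \<rho>) = (if \<rho> \<in> ?C then 1 else 0)"
    unfolding basis_vec_def by (rule sum.delta')
  then show ?thesis
    by (simp only: cycle_class_sum_def carrier_sym_group mem_Collect_eq)
qed

lemma conj_product_of_cycles:
  assumes "\<pi> permutes A" "distinct (concat css)"
  shows "\<pi> \<circ> foldr (\<circ>) (map cycle_of_list css) id \<circ> inv' \<pi> =
    foldr (\<circ>) (map cycle_of_list (map (map \<pi>) css)) id"
  using assms(2)
proof (induction css)
  case Nil
  then show ?case using permutes_inverses[OF assms(1)] by (simp add: fun_eq_iff)
next
  case (Cons cs css)
  define F where "F = foldr (\<circ>) (map cycle_of_list css) id"
  have "distinct (concat css)" "distinct cs" using Cons.prems by auto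
  note IH = Cons.IH[OF this(1), folded F_def]
  have "\<pi> \<circ> (cycle_of_list cs \<circ> F) \<circ> inv' \<pi> = (\<pi> \<circ> cycle_of_list cs \<circ> inv' \<pi>) \<circ> (\<pi> \<circ> F \<circ> inv' \<pi>)"
    using permutes_inverses[OF assms(1)] by (simp add: fun_eq_iff)
  also have "\<pi> \<circ> cycle_of_list cs \<circ> inv' \<pi> = cycle_of_list (map \<pi> cs)"
    by (rule conjugation_of_cycle[OF \<open>distinct cs\<close> permutes_bij[OF assms(1)]])
  finally show ?case unfolding list.map foldr_comp_Cons IH F_def[symmetric] .
qed

lemma has_cycle_lengths_conj:
  assumes "\<pi> permutes {1..d}" "has_cycle_lengths d ls \<sigma>"
  shows "has_cycle_lengths d ls (\<pi> \<circ> \<sigma> \<circ> inv' \<pi>)"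
proof -
  obtain css where css: "map length css = ls" "distinct (concat css)"
    "set (concat css) \<subseteq> {1..d}" "\<sigma> = foldr (\<circ>) (map cycle_of_list css) id"
    using assms(2) unfolding has_cycle_lengths_def by (elim exE conjE)
  have eq: "concat (map (map \<pi>) css) = map \<pi> (concat css)" by (simp add: map_concat)
  have "map length (map (map \<pi>) css) = ls" using css(1) by (simp add: comp_def)
  moreover have "distinct (concat (map (map \<pi>) css))"
    unfolding eq using css(2) permutes_inj_on[OF assms(1)] by (simp only: distinct_map)
  moreover have "set (concat (map (map \<pi>) css)) \<subseteq> {1..d}"
    unfolding eq set_map using css(3) permutes_image[OF assms(1)] by blast
  moreover have "\<pi> \<circ> \<sigma> \<circ> inv' \<pi> = foldr (\<circ>) (map cycle_of_list (map (map \<pi>) css)) id"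
    unfolding css(4) by (rule conj_product_of_cycles[OF assms(1) css(2)])
  ultimately show ?thesis
    unfolding has_cycle_lengths_def by (intro exI[of _ "map (map \<pi>) css"] conjI)
qed

lemma cycle_class_sum_invariant: "invariant d (cycle_class_sum d ls)"
proof -
  have "has_cycle_lengths d ls (\<pi> \<circ> \<sigma> \<circ> inv' \<pi>) \<longleftrightarrow> has_cycle_lengths d ls \<sigma>"
    if p: "\<pi> permutes {1..d}" for \<pi> \<sigma>
  proof
    assume "has_cycle_lengths d ls (\<pi> \<circ> \<sigma> \<circ> inv' \<pi>)"
    from has_cycle_lengths_conj[OF permutes_inv[OF p] this]
    show "has_cycle_lengths d ls \<sigma>"
      unfolding inv_inv_eq[OF permutes_bij[OF p]] conj_conj_inv(1)[OF p] .
  qed (rule has_cycle_lengths_conj[OF p])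
  then show ?thesis
    unfolding invariant_def supported_def by (simp add: cycle_class_sum_eq permutes_conj)
qed

lemma permutation_extension:
  assumes "finite S" "inj_on g A" "A \<subseteq> S" "g ` A \<subseteq> S"
  obtains r where "r permutes S" "\<forall>y\<in>A. r y = g y"
proof -
  have "card (S - A) = card (S - g ` A)"
    using assms by (simp add: card_Diff_subset finite_subset card_image)
  then obtain h where h: "bij_betw h (S - A) (S - g ` A)"
    using assms(1) finite_same_card_bij[of "S - A" "S - g ` A"] by auto
  define r where "r y = (if y \<in> A then g y else if y \<in> S then h y else y)" for y
  have "bij_betw r (A \<union> (S - A)) (g ` A \<union> (S - g ` A))"
  proof (rule bij_betw_combine)
    show "bij_betw r A (g ` A)"
      using assms(2) by (subst bij_betw_cong[of A r g]) (auto simp: r_def bij_betw_def)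
    show "bij_betw r (S - A) (S - g ` A)"
      using h by (subst bij_betw_cong[of "S - A" r h]) (auto simp: r_def)
  qed auto
  moreover have "A \<union> (S - A) = S" "g ` A \<union> (S - g ` A) = S" using assms by auto
  ultimately have "r permutes S" using assms(3) by (intro bij_imp_permutes) (auto simp: r_def)
  then show ?thesis using that[of r] by (simp add: r_def)
qed

text \<open>Two conjugators, one for the cycle and one for the rest, are glued along disjoint sets and the result is
  extended to a permutation.\<close>

lemma conjugate_cycle_comp:
  assumes cs: "distinct cs" "set cs \<subseteq> {1..d}" and cs': "distinct cs'" "set cs' \<subseteq> {1..d}"
    and len: "length cs = length cs'" and \<rho>: "\<rho> permutes {1..d}" "\<forall>y\<in>set cs. \<rho> y = y"
    and \<tau>: "\<forall>y\<in>set cs'. \<tau> y = y" and c: "conjugate d \<rho> \<tau>"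
  shows "conjugate d (cycle_of_list cs \<circ> \<rho>) (cycle_of_list cs' \<circ> \<tau>)"
proof -
  obtain p where p: "p permutes {1..d}" "\<And>y. p (\<rho> y) = \<tau> (p y)"
    using c unfolding conjugate_def fun_eq_iff by auto
  have injp: "p y = p z \<longleftrightarrow> y = z" for y z using inj_eq[OF permutes_inj[OF p(1)]] .
  define q where "q y = the (map_of (zip cs cs') y)" for y
  have q: "q (cs ! i) = cs' ! i" if "i < length cs" for i
    unfolding q_def using map_of_zip_nth[OF len cs(1)] that len by simp
  have mq: "map q cs = cs'" by (rule nth_equalityI) (use len q in auto)
  define U where "U = {y. \<rho> y \<noteq> y}"
  define g where "g y = (if y \<in> set cs then q y else p y)" for y
  have disj: "set cs \<inter> U = {}" using \<rho>(2) by (auto simp: U_def)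
  have gcs: "g ` set cs = set cs'" using mq by (auto simp: g_def simp flip: set_map)
  have gU: "g y = p y" if "y \<in> U" for y using disj that by (auto simp: g_def)
  have moved: "\<tau> (g y) \<noteq> g y" if "y \<in> U" for y
    using that p(2)[of y] injp gU[OF that] by (auto simp: U_def)
  have "inj_on g (set cs \<union> U)"
    unfolding inj_on_Un
  proof (intro conjI)
    have "inj_on q (set cs)" using mq cs'(1) by (metis distinct_map)
    then show "inj_on g (set cs)" by (auto simp: g_def inj_on_def)
    show "inj_on g U" using gU injp by (auto simp: inj_on_def)
    have "g ` (set cs - U) \<subseteq> set cs'" unfolding gcs[symmetric] by (rule image_mono) simp
    moreover have "g ` (U - set cs) \<subseteq> - set cs'"
    proof (rule image_subsetI)
      fix y assume "y \<in> U - set cs"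
      then have "\<tau> (g y) \<noteq> g y" using moved by simp
      then show "g y \<in> - set cs'" using \<tau> by auto
    qed
    ultimately show "g ` (set cs - U) \<inter> g ` (U - set cs) = {}" by blast
  qed
  moreover have U: "U \<subseteq> {1..d}" using \<rho>(1) unfolding U_def permutes_def by auto
  moreover have "g ` U \<subseteq> {1..d}"
    using U gU permutes_in_image[OF p(1)] by (intro image_subsetI) (metis subsetD)
  ultimately obtain r where r: "r permutes {1..d}" "\<forall>y\<in>set cs \<union> U. r y = g y"
    using permutation_extension[of "{1..d}" g "set cs \<union> U"] cs(2) cs'(2) gcs
    by (metis Un_least finite_atLeastAtMost image_Un)
  have injr: "r y = r z \<longleftrightarrow> y = z" for y z using inj_eq[OF permutes_inj[OF r(1)]] .
  have comm: "r (\<rho> y) = \<tau> (r y)" for y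
  proof (cases "y \<in> U")
    case True
    then have "\<rho> y \<in> U" using inj_eq[OF permutes_inj[OF \<rho>(1)]] by (auto simp: U_def)
    then show ?thesis using True r(2) gU p(2) by simp
  next
    case False
    have "\<tau> (r y) = r y"
    proof (rule ccontr)
      assume *: "\<tau> (r y) \<noteq> r y"
      define z where "z = inv' p (r y)"
      have z: "p z = r y" using permutes_inverses[OF p(1)] by (simp add: z_def)
      then have "\<rho> z \<noteq> z" using * p(2)[of z] by auto
      then have "z \<in> U" by (simp add: U_def)
      then have "r z = r y" using r(2) gU z by simp
      then show False using False \<open>z \<in> U\<close> injr by simp
    qed
    then show ?thesis using False by (simp add: U_def)
  qed
  have "map r cs = cs'"
    unfolding mq[symmetric] by (rule map_cong) (use r(2) in \<open>auto simp: g_def\<close>)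
  then have rc: "r \<circ> cycle_of_list cs \<circ> inv' r = cycle_of_list cs'"
    using conjugation_of_cycle[OF cs(1) permutes_bij[OF r(1)]] by simp
  have "r (cycle_of_list cs y) = cycle_of_list cs' (r y)" for y
    unfolding rc[symmetric] by (simp add: permutes_inverses[OF r(1)])
  then show ?thesis unfolding conjugate_def
    using r(1) comm by (intro exI[of _ r]) (simp add: fun_eq_iff)
qed

lemma cycle_decomp_permutes: "cycle_decomp I p \<Longrightarrow> p permutes I"
proof (induction rule: cycle_decomp.induct)
  case (comp I p cs)
  have "cycle_of_list cs permutes set cs \<union> I" by (rule permutes_subset[OF cycle_permutes]) auto
  moreover have "p permutes set cs \<union> I" by (rule permutes_subset[OF comp.IH]) auto
  ultimately show ?case by (rule permutes_compose[rotated])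
qed (rule permutes_id)

lemma split_off_cycle:
  assumes "cycle_decomp I p"
  shows "p = id \<or> (\<exists>cs p'. p = cycle_of_list cs \<circ> p' \<and> distinct cs \<and> length cs \<ge> 2 \<and>
    set cs \<subseteq> I \<and> p' permutes I - set cs)"
  using assms
proof (induction rule: cycle_decomp.induct)
  case (comp I p cs)
  show ?case
  proof (cases "length cs \<ge> 2")
    case True
    have "(set cs \<union> I) - set cs = I" using comp.hyps by auto
    then show ?thesis using True comp.hyps cycle_decomp_permutes[OF comp.hyps(1)]
      by (intro disjI2 exI[of _ cs] exI[of _ p]) auto
  next
    case False
    then have id: "cycle_of_list cs \<circ> p = p"
      by (cases cs rule: cycle_of_list.cases) auto
    have "p = id \<or> (\<exists>cs' p'. p = cycle_of_list cs' \<circ> p' \<and> distinct cs' \<and> length cs' \<ge> 2 \<and>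
      set cs' \<subseteq> set cs \<union> I \<and> p' permutes (set cs \<union> I) - set cs')" (is ?goal) using comp.IH
    proof (elim disjE exE conjE)
      fix cs' p'
      assume *: "p = cycle_of_list cs' \<circ> p'" "distinct cs'" "length cs' \<ge> 2" "set cs' \<subseteq> I"
        "p' permutes I - set cs'"
      have "p' permutes (set cs \<union> I) - set cs'" by (rule permutes_subset[OF *(5)]) auto
      then show ?goal using * by (intro disjI2 exI[of _ cs'] exI[of _ p'] conjI) auto
    qed (rule disjI1)
    then show ?thesis unfolding id .
  qed
qed simp

lemma gmul_nonneg_term:
  assumes "\<And>\<sigma>. f \<sigma> \<ge> 0" "\<And>\<sigma>. g \<sigma> \<ge> 0" "\<sigma> \<in> perms d" "\<tau> \<in> perms d"
  shows "f \<sigma> * g \<tau> * basis_mult d \<sigma> \<tau> \<rho> \<le> gmul d f g \<rho>"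
proof -
  have nn: "f \<sigma> * g \<tau> * basis_mult d \<sigma> \<tau> \<rho> \<ge> 0" for \<sigma> \<tau>
    using assms(1,2) by (simp add: basis_mult_eq)
  have "f \<sigma> * g \<tau> * basis_mult d \<sigma> \<tau> \<rho> \<le> (\<Sum>\<tau>\<in>perms d. f \<sigma> * g \<tau> * basis_mult d \<sigma> \<tau> \<rho>)"
    by (rule member_le_sum[OF assms(4) _ finite_perms]) (rule nn)
  also have "\<dots> \<le> gmul d f g \<rho>"
    unfolding gmul_def
    by (rule member_le_sum[OF assms(3) _ finite_perms, of "\<lambda>\<sigma>. \<Sum>\<tau>\<in>perms d. f \<sigma> * g \<tau> * basis_mult d \<sigma> \<tau> \<rho>"])
      (intro sum_nonneg nn)
  finally show ?thesis .
qed

lemma gmul_nonzeroE: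
  assumes "gmul d f g \<rho> \<noteq> 0"
  obtains \<sigma> \<tau> where "\<sigma> permutes {1..d}" "\<tau> permutes {1..d}" "f \<sigma> \<noteq> 0" "g \<tau> \<noteq> 0" "\<rho> = \<sigma> \<circ> \<tau>"
    "perm_norm d \<rho> = perm_norm d \<sigma> + perm_norm d \<tau>"
proof -
  obtain \<sigma> where s: "\<sigma> \<in> perms d" "(\<Sum>\<tau>\<in>perms d. f \<sigma> * g \<tau> * basis_mult d \<sigma> \<tau> \<rho>) \<noteq> 0"
    using assms unfolding gmul_def by (rule sum.not_neutral_contains_not_neutral)
  obtain \<tau> where t: "\<tau> \<in> perms d" "f \<sigma> * g \<tau> * basis_mult d \<sigma> \<tau> \<rho> \<noteq> 0"
    using s(2) by (rule sum.not_neutral_contains_not_neutral)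
  show ?thesis using that[of \<sigma> \<tau>] s(1) t by (simp add: basis_mult_eq split: if_splits)
qed

abbreviation gamma_elts :: "nat \<Rightarrow> ((nat \<Rightarrow> nat) \<Rightarrow> rat) set" where
  "gamma_elts d \<equiv> gamma_elt d ` {2..d}"

text \<open>Split a cycle of length \<open>l\<close> off \<open>\<rho>\<close> and multiply \<open>gamma_elt d l\<close> with the class of the rest. A product of
  an \<open>l\<close>-cycle and a conjugate of the rest moves as many points as \<open>\<rho>\<close> only if their supports are disjoint, and
  then it is conjugate to \<open>\<rho>\<close>. The coefficient at \<open>\<rho>\<close> does not vanish because nothing can cancel.\<close>

lemma leading_class:
  assumes \<rho>: "\<rho> permutes {1..d}"
    and IH: "\<And>f. invariant d f \<Longrightarrow> (\<And>\<pi>. f \<pi> \<noteq> 0 \<Longrightarrow> card {y. \<pi> y \<noteq> y} < card {y. \<rho> y \<noteq> y}) \<Longrightarrow>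
      f \<in> subalg d (gamma_elts d)"
  obtains h where "h \<in> subalg d (gamma_elts d)" "invariant d h" "h \<rho> \<noteq> 0"
    "\<And>\<pi>. h \<pi> \<noteq> 0 \<Longrightarrow> card {y. \<pi> y \<noteq> y} < card {y. \<rho> y \<noteq> y} \<or> conjugate d \<rho> \<pi>"
proof (cases "\<rho> = id")
  case True
  show ?thesis
    by (rule that[OF subalg_one basis_vec_id_invariant])
      (auto simp: True basis_vec_def conjugate_refl split: if_splits)
next
  case False
  then obtain cs \<rho>' where dec: "\<rho> = cycle_of_list cs \<circ> \<rho>'" "distinct cs" "length cs \<ge> 2"
    "set cs \<subseteq> {1..d}" "\<rho>' permutes {1..d} - set cs"
    using split_off_cycle[OF cycle_decomposition[OF \<rho> finite_atLeastAtMost]] by blast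
  let ?l = "length cs" and ?s = "\<lambda>\<pi>. card {y. \<pi> y \<noteq> y}"
  have \<rho>': "\<rho>' permutes {1..d}" using dec(5) by (rule permutes_subset) auto
  have fixd: "\<forall>y\<in>set cs. \<rho>' y = y" using dec(5) by (auto simp: permutes_def)
  have fin: "finite {y. \<pi> y \<noteq> y}" if "\<pi> permutes {1..d}" for \<pi>
    by (rule finite_subset[of _ "{1..d}"]) (use that in \<open>auto simp: permutes_def\<close>)
  have "{y. \<rho> y \<noteq> y} = set cs \<union> {y. \<rho>' y \<noteq> y}"
  proof (rule Set.set_eqI)
    fix y
    show "y \<in> {y. \<rho> y \<noteq> y} \<longleftrightarrow> y \<in> set cs \<union> {y. \<rho>' y \<noteq> y}"
    proof (cases "y \<in> set cs")
      case True
      then show ?thesis using fixd cycle_of_list_moves[OF dec(2,3)] by (simp add: dec(1))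
    next
      case F: False
      show ?thesis
      proof (cases "\<rho>' y = y")
        case True
        then show ?thesis using F id_outside_supp[OF F] by (simp add: dec(1))
      next
        case False
        have "y \<in> {1..d} - set cs" using False permutes_not_in[OF dec(5)] by blast
        then have "\<rho>' y \<notin> set cs" using permutes_in_image[OF dec(5), of y] by blast
        then show ?thesis using False id_outside_supp[of "\<rho>' y" cs] by (simp add: dec(1))
      qed
    qed
  qed
  moreover have "set cs \<inter> {y. \<rho>' y \<noteq> y} = {}" using fixd by auto
  ultimately have s\<rho>: "?s \<rho> = ?l + ?s \<rho>'"
    using card_Un_disjoint[OF _ fin[OF \<rho>']] distinct_card[OF dec(2)] by simp
  define K where "K = class_indicator d \<rho>'"
  have K: "K \<in> subalg d (gamma_elts d)"
  proof (rule IH)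
    show "invariant d K" unfolding K_def by (rule class_indicator_invariant)
    fix \<pi> assume "K \<pi> \<noteq> 0"
    then have "conjugate d \<rho>' \<pi>" by (simp add: K_def class_indicator_def split: if_splits)
    from card_moved_conjugate[OF this] show "?s \<pi> < ?s \<rho>" using dec(3) s\<rho> by linarith
  qed
  have "?l \<le> d" using card_mono[OF _ dec(4)] distinct_card[OF dec(2)] by simp
  then have g: "gamma_elt d ?l \<in> subalg d (gamma_elts d)"
    using dec(3) by (intro subalgebra_generated.incl) auto
  define h where "h = gmul d (gamma_elt d ?l) K"
  have ginv: "invariant d (gamma_elt d ?l)"
    unfolding gamma_elt_def by (rule cycle_class_sum_invariant)
  have gval: "gamma_elt d ?l \<sigma> = (if \<sigma> permutes {1..d} \<and> has_cycle_lengths d [?l] \<sigma> then 1 else 0)" for \<sigma>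
    unfolding gamma_elt_def by (rule cycle_class_sum_eq)
  show ?thesis
  proof (rule that[of h])
    show "h \<in> subalg d (gamma_elts d)" unfolding h_def using g K by (rule subalg_gmul)
    show "invariant d h"
      unfolding h_def K_def by (intro invariant_gmul ginv class_indicator_invariant)
    have c: "cycle_of_list cs permutes {1..d}" by (rule cycle_permutes_superset[OF dec(4)])
    have "gamma_elt d ?l (cycle_of_list cs) = 1"
      using c dec(2,4) unfolding gval has_single_cycle_length by auto
    moreover have "K \<rho>' = 1" using \<rho>' conjugate_refl by (simp add: K_def class_indicator_def)
    moreover have "basis_mult d (cycle_of_list cs) \<rho>' \<rho> = 1"
      using perm_norm_cycle_comp[OF dec(2,4) \<rho>' fixd] perm_norm_cycle[OF dec(2,4)]
      by (simp only: basis_mult_eq dec(1)) simp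
    moreover have "gamma_elt d ?l (cycle_of_list cs) * K \<rho>' * basis_mult d (cycle_of_list cs) \<rho>' \<rho> \<le> h \<rho>"
      unfolding h_def
      by (rule gmul_nonneg_term) (use c \<rho>' in \<open>simp_all add: gval K_def class_indicator_def\<close>)
    ultimately show "h \<rho> \<noteq> 0" by simp
    fix \<pi> assume "h \<pi> \<noteq> 0"
    then obtain \<sigma> \<tau> where st: "\<sigma> permutes {1..d}" "\<tau> permutes {1..d}" "gamma_elt d ?l \<sigma> \<noteq> 0"
      "K \<tau> \<noteq> 0" "\<pi> = \<sigma> \<circ> \<tau>" unfolding h_def by (rule gmul_nonzeroE)
    have "has_cycle_lengths d [?l] \<sigma>" using st(3) by (simp add: gval split: if_splits)
    then obtain cs' where cs': "length cs' = ?l" "distinct cs'" "set cs' \<subseteq> {1..d}"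
      "\<sigma> = cycle_of_list cs'" unfolding has_single_cycle_length by blast
    have conj: "conjugate d \<rho>' \<tau>" using st(4) by (simp add: K_def class_indicator_def split: if_splits)
    have s\<tau>: "?s \<tau> = ?s \<rho>'" by (rule card_moved_conjugate[OF conj])
    show "?s \<pi> < ?s \<rho> \<or> conjugate d \<rho> \<pi>"
    proof (cases "set cs' \<inter> {y. \<tau> y \<noteq> y} = {}")
      case True
      then have "\<forall>y\<in>set cs'. \<tau> y = y" by auto
      then show ?thesis
        unfolding st(5) cs'(4) dec(1)
        using conjugate_cycle_comp[OF dec(2,4) cs'(2,3) cs'(1)[symmetric] \<rho>' fixd _ conj] by blast
    next
      case False
      have "{y. \<pi> y \<noteq> y} \<subseteq> set cs' \<union> {y. \<tau> y \<noteq> y}"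
        using id_outside_supp[of _ cs'] by (auto simp: st(5) cs'(4))
      then have "?s \<pi> \<le> card (set cs' \<union> {y. \<tau> y \<noteq> y})"
        using fin[OF st(2)] by (intro card_mono) auto
      moreover have "card (set cs' \<union> {y. \<tau> y \<noteq> y}) + card (set cs' \<inter> {y. \<tau> y \<noteq> y}) = ?l + ?s \<tau>"
        using card_Un_Int[OF _ fin[OF st(2)], of "set cs'"] cs'(1) distinct_card[OF cs'(2)] by simp
      moreover have "card (set cs' \<inter> {y. \<tau> y \<noteq> y}) > 0"
        using False fin[OF st(2)] by (simp add: card_gt_0_iff)
      ultimately show ?thesis using s\<rho> s\<tau> by simp
    qed
  qed
qed

text \<open>Induction on the number of moved points, and within it on the number of permutations with the
  maximal number of moved points in the support of \<open>f\<close>: subtracting a multiple of the element from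
  \<open>leading_class\<close> removes one conjugacy class among these.\<close>

lemma generated_by_gamma_aux:
  assumes "invariant d f" "\<And>\<pi>. f \<pi> \<noteq> 0 \<Longrightarrow> card {y. \<pi> y \<noteq> y} < s"
  shows "f \<in> subalg d (gamma_elts d)"
  using assms
proof (induction s arbitrary: f)
  case 0
  then have "f = (\<lambda>_. 0)" by fastforce
  then show ?case using subalg_zero by simp
next
  case (Suc s)
  let ?s = "\<lambda>\<pi>. card {y. \<pi> y \<noteq> y}"
  let ?T = "\<lambda>f. {\<pi> \<in> perms d. f \<pi> \<noteq> 0 \<and> ?s \<pi> = s}"
  note outer = Suc.IH
  have "f \<in> subalg d (gamma_elts d)"
    if "invariant d f" "\<And>\<pi>. f \<pi> \<noteq> 0 \<Longrightarrow> ?s \<pi> < Suc s" for f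
    using that
  proof (induction "card (?T f)" arbitrary: f rule: less_induct)
    case less
    show ?case
    proof (cases "?T f = {}")
      case True
      have "?s \<pi> < s" if "f \<pi> \<noteq> 0" for \<pi>
      proof -
        have "\<pi> permutes {1..d}" using less.prems(1) that unfolding invariant_def supported_def by blast
        then have "?s \<pi> \<noteq> s" using True that by blast
        then show ?thesis using less.prems(2)[OF that] by simp
      qed
      then show ?thesis using outer less.prems(1) by blast
    next
      case False
      then obtain \<rho> where \<rho>: "\<rho> permutes {1..d}" "f \<rho> \<noteq> 0" "?s \<rho> = s" by blast
      obtain h where h: "h \<in> subalg d (gamma_elts d)" "invariant d h" "h \<rho> \<noteq> 0"
        "\<And>\<pi>. h \<pi> \<noteq> 0 \<Longrightarrow> ?s \<pi> < ?s \<rho> \<or> conjugate d \<rho> \<pi>"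
      proof (rule leading_class[OF \<rho>(1)])
        show "f' \<in> subalg d (gamma_elts d)"
          if "invariant d f'" "\<And>\<pi>. f' \<pi> \<noteq> 0 \<Longrightarrow> ?s \<pi> < ?s \<rho>" for f'
          using outer[OF that(1)] that(2) unfolding \<rho>(3) by blast
      qed blast
      define c where "c = f \<rho> / h \<rho>"
      define g where "g = (\<lambda>\<pi>. f \<pi> + (- c) * h \<pi>)"
      have inv: "invariant d g"
        unfolding g_def by (intro invariant_add invariant_scale less.prems h)
      have hs: "?s \<pi> < Suc s" if "h \<pi> \<noteq> 0" for \<pi>
        using h(4)[OF that] card_moved_conjugate[of d \<rho> \<pi>] \<rho>(3) by auto
      have "g \<in> subalg d (gamma_elts d)"
      proof (rule less.hyps)
        show "invariant d g" by (rule inv)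
        show "?s \<pi> < Suc s" if "g \<pi> \<noteq> 0" for \<pi>
          using that hs[of \<pi>] less.prems(2)[of \<pi>] unfolding g_def by fastforce
        have "?T g \<subset> ?T f"
        proof
          show "?T g \<subseteq> ?T f"
          proof
            fix \<pi> assume "\<pi> \<in> ?T g"
            then have p: "\<pi> \<in> perms d" "g \<pi> \<noteq> 0" "?s \<pi> = s" by auto
            have "f \<pi> \<noteq> 0"
            proof (cases "h \<pi> = 0")
              case True then show ?thesis using p(2) by (simp add: g_def)
            next
              case False
              then have "conjugate d \<rho> \<pi>" using h(4)[of \<pi>] p(3) \<rho>(3) by simp
              then show ?thesis using invariant_conjugate[OF less.prems(1) \<rho>(1)] \<rho>(2) by simp
            qed
            then show "\<pi> \<in> ?T f" using p by simp
          qed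
          have "g \<rho> = 0" using h(3) by (simp add: g_def c_def)
          then show "?T g \<noteq> ?T f" using \<rho> by blast
        qed
        then show "card (?T g) < card (?T f)"
          using finite_perms by (intro psubset_card_mono) auto
      qed
      then have "(\<lambda>\<pi>. g \<pi> + c * h \<pi>) \<in> subalg d (gamma_elts d)"
        by (intro subalg_add subalg_scale h)
      moreover have "(\<lambda>\<pi>. g \<pi> + c * h \<pi>) = f" by (simp add: g_def)
      ultimately show ?thesis by simp
    qed
  qed
  then show ?case using Suc.prems by blast
qed

lemma generated_by_all_gamma:
  assumes "invariant d f" shows "f \<in> subalg d (gamma_elts d)"
proof (rule generated_by_gamma_aux[OF assms, where s = "Suc d"])
  fix \<pi> assume "f \<pi> \<noteq> 0"
  then have "\<pi> permutes {1..d}" using assms unfolding invariant_def supported_def by blast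
  then have "{y. \<pi> y \<noteq> y} \<subseteq> {1..d}" by (auto simp: permutes_def)
  from card_mono[OF finite_atLeastAtMost this] show "card {y. \<pi> y \<noteq> y} < Suc d" by simp
qed

lemma gamma_elt_invariant: "invariant d (gamma_elt d l)"
  unfolding gamma_elt_def by (rule cycle_class_sum_invariant)

lemma delta_elt_invariant: "invariant d (delta_elt d j)"
  unfolding delta_elt_def by (rule cycle_class_sum_invariant)

lemma generates_algebra_iff:
  assumes "\<And>f. f \<in> S \<Longrightarrow> invariant d f"
  shows "generates_algebra (invariant_algebra d) S \<longleftrightarrow> {f. invariant d f} \<subseteq> subalg d S"
  unfolding generates_algebra_def carrier_invariant_algebra
  using assms subalg_invariant[of S d] by blast

lemma generates_if_gammas:
  assumes "\<And>f. f \<in> S \<Longrightarrow> invariant d f" "\<And>k. k \<ge> 1 \<Longrightarrow> gamma_elt d (Suc k) \<in> subalg d S"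
  shows "generates_algebra (invariant_algebra d) S"
proof -
  have "gamma_elts d \<subseteq> subalg d S"
  proof
    fix f assume "f \<in> gamma_elts d"
    then obtain l where "l \<ge> 2" "f = gamma_elt d l" by auto
    then show "f \<in> subalg d S" using assms(2)[of "l - 1"] by simp
  qed
  from subalg_subset[OF this] show ?thesis
    using assms(1) generated_by_all_gamma by (subst generates_algebra_iff) auto
qed

text \<open>For \<open>j \<le> d div 2\<close> the Newton identity gives the matching sums from the cycle sums. For larger \<open>j\<close>
  there is no matching with \<open>j\<close> pairs, and the same identity then yields the long cycles.\<close>

lemma gammas_generate:
  "generates_algebra (invariant_algebra d) (gamma_elt d ` {2..d div 2 + 1})" (is "generates_algebra _ ?S")
proof (rule generates_if_gammas)
  have small: "gamma_elt d (Suc k) \<in> subalg d ?S" if "1 \<le> k" "k \<le> d div 2" for k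
    using that by (intro subalgebra_generated.incl) auto
  have delta: "delta_elt d j \<in> subalg d ?S" for j
  proof (induction j rule: less_induct)
    case (less j)
    consider "j = 0" | "1 \<le> j" "j \<le> d div 2" | "2 * j > d" by linarith
    then show ?case
    proof cases
      case 1 then show ?thesis using subalg_one by (simp add: delta_elt_0)
    next
      case 2
      show ?thesis
      proof (rule delta_from_gamma[OF 2(1)])
        show "gamma_elt d (Suc k) \<in> subalg d ?S" if "1 \<le> k" "k \<le> j" for k
          using small[OF that(1) le_trans[OF that(2) 2(2)]] .
      qed (rule less.IH)
    next
      case 3 then show ?thesis using subalg_zero by (simp add: delta_elt_large)
    qed
  qed
  fix k :: nat assume "k \<ge> 1"
  then show "gamma_elt d (Suc k) \<in> subalg d ?S"
  proof (induction k rule: less_induct)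
    case (less k)
    show ?case
    proof (rule gamma_from_delta[OF less.prems delta _ invariantD[OF gamma_elt_invariant]])
      show "gamma_elt d (Suc i) \<in> subalg d ?S" if "1 \<le> i" "i < k" for i
        using less.IH[OF that(2,1)] .
    qed
  qed
qed (auto intro: gamma_elt_invariant)

lemma deltas_generate:
  "generates_algebra (invariant_algebra d) (delta_elt d ` {1..d div 2})" (is "generates_algebra _ ?S")
proof (rule generates_if_gammas)
  have delta: "delta_elt d j \<in> subalg d ?S" for j
  proof -
    consider "j = 0" | "1 \<le> j" "j \<le> d div 2" | "2 * j > d" by linarith
    then show ?thesis
    proof cases
      case 1 then show ?thesis using subalg_one by (simp add: delta_elt_0)
    next
      case 2 then show ?thesis by (intro subalgebra_generated.incl) auto
    next
      case 3 then show ?thesis using subalg_zero by (simp add: delta_elt_large)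
    qed
  qed
  fix k :: nat assume "k \<ge> 1"
  then show "gamma_elt d (Suc k) \<in> subalg d ?S"
  proof (induction k rule: less_induct)
    case (less k)
    show ?case
    proof (rule gamma_from_delta[OF less.prems delta _ invariantD[OF gamma_elt_invariant]])
      show "gamma_elt d (Suc i) \<in> subalg d ?S" if "1 \<le> i" "i < k" for i
        using less.IH[OF that(2,1)] .
    qed
  qed
qed (auto intro: delta_elt_invariant)

section \<open>Independence of the class sums\<close>

lemma product_of_cycles_permutes:
  "foldr (\<circ>) (map cycle_of_list css) id permutes set (concat css)"
proof (induction css)
  case Nil
  have "foldr (\<circ>) (map cycle_of_list []) id = id" by (simp add: fun_eq_iff)
  then show ?case by (metis permutes_id)
next
  case (Cons cs css)
  have "cycle_of_list cs permutes set (concat (cs # css))"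
    by (rule permutes_subset[OF cycle_permutes]) auto
  moreover have "foldr (\<circ>) (map cycle_of_list css) id permutes set (concat (cs # css))"
    by (rule permutes_subset[OF Cons.IH]) auto
  ultimately show ?case unfolding list.map foldr_comp_Cons by (rule permutes_compose[rotated])
qed

lemma perm_norm_product_of_cycles:
  assumes "distinct (concat css)" "set (concat css) \<subseteq> {1..d}"
  shows "perm_norm d (foldr (\<circ>) (map cycle_of_list css) id) = (\<Sum>cs\<leftarrow>css. length cs - 1)"
  using assms
proof (induction css)
  case Nil
  then show ?case using perm_norm_id by (simp add: id_def)
next
  case (Cons cs css)
  define F where "F = foldr (\<circ>) (map cycle_of_list css) id"
  have F: "F permutes set (concat css)" unfolding F_def by (rule product_of_cycles_permutes)
  have "F permutes {1..d}" by (rule permutes_subset[OF F]) (use Cons.prems in auto)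
  moreover have "\<forall>y\<in>set cs. F y = y"
    using permutes_not_in[OF F] Cons.prems(1) by auto
  ultimately have "perm_norm d (cycle_of_list cs \<circ> F) = length cs - 1 + perm_norm d F"
    using Cons.prems by (intro perm_norm_cycle_comp) auto
  moreover have "perm_norm d F = (\<Sum>cs\<leftarrow>css. length cs - 1)"
    unfolding F_def by (rule Cons.IH) (use Cons.prems in auto)
  ultimately show ?case
    unfolding list.map foldr_comp_Cons F_def[symmetric] by (simp only: sum_list.Cons)
qed

text \<open>Recovers the multiset of cycle lengths from the permutation alone, through the sizes of its orbits.\<close>

lemma card_points_in_orbits:
  assumes "distinct (concat css)" "n \<ge> 2"
  shows "finite {x. card (orbit (foldr (\<circ>) (map cycle_of_list css) id) x) = n} \<and>
    card {x. card (orbit (foldr (\<circ>) (map cycle_of_list css) id) x) = n} =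
      n * count (mset (map length css)) n"
  using assms(1)
proof (induction css)
  case Nil
  have "orbit id x = {x}" for x :: 'a by (rule orbit_fixed) simp
  then show ?case using assms(2) by (simp add: id_def)
next
  case (Cons cs css)
  define F where "F = foldr (\<circ>) (map cycle_of_list css) id"
  have F: "F permutes set (concat css)" unfolding F_def by (rule product_of_cycles_permutes)
  have fixd: "\<forall>y\<in>set cs. F y = y"
    using permutes_not_in[OF F] Cons.prems(1) by auto
  have cs: "distinct cs" using Cons.prems by simp
  have inside: "orbit (cycle_of_list cs \<circ> F) x = set cs" if "x \<in> set cs" for x
    by (rule orbit_cycle_comp[OF cs F _ fixd that]) simp
  have outside: "orbit (cycle_of_list cs \<circ> F) x = orbit F x" if "x \<notin> set cs" for x
  proof (rule orbit_cong0[symmetric])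
    show "x \<in> - set cs" using that by simp
    have F_out: "F y \<notin> set cs" if "y \<notin> set cs" for y
      using that fixd inj_eq[OF permutes_inj[OF F]] by metis
    then show "F \<in> - set cs \<rightarrow> - set cs" by auto
    show "F y = (cycle_of_list cs \<circ> F) y" if "y \<in> - set cs" for y
      using F_out[of y] that id_outside_supp[of "F y" cs] by simp
  qed
  have self: "card (orbit F x) \<noteq> n" if "x \<in> set cs" for x
    using orbit_fixed[of F x] fixd that assms(2) by simp
  let ?A = "{x. card (orbit F x) = n}" and ?B = "if length cs = n then set cs else {}"
  have eq: "{x. card (orbit (cycle_of_list cs \<circ> F) x) = n} = ?A \<union> ?B"
  proof (rule Set.set_eqI)
    fix x
    show "x \<in> {x. card (orbit (cycle_of_list cs \<circ> F) x) = n} \<longleftrightarrow> x \<in> ?A \<union> ?B"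
      using inside[of x] outside[of x] self[of x] distinct_card[OF cs] by (cases "x \<in> set cs") auto
  qed
  have IH: "finite ?A" "card ?A = n * count (mset (map length css)) n"
    using Cons.IH Cons.prems unfolding F_def[symmetric] by auto
  have "card (?A \<union> ?B) = card ?A + card ?B"
    using IH(1) self by (intro card_Un_disjoint) auto
  then show ?case
    unfolding list.map foldr_comp_Cons F_def[symmetric] eq using IH distinct_card[OF cs] by simp
qed

lemma cycle_lengths_unique:
  assumes "has_cycle_lengths d ls \<sigma>" "has_cycle_lengths d ls' \<sigma>"
    "\<forall>l\<in>set ls. l \<ge> 2" "\<forall>l\<in>set ls'. l \<ge> 2"
  shows "mset ls = mset ls'"
proof (rule multiset_eqI)
  fix n
  have c: "n * count (mset ls) n = card {x. card (orbit \<sigma> x) = n}"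
    if hl: "has_cycle_lengths d ls \<sigma>" and "n \<ge> 2" for ls
  proof -
    obtain css where css: "map length css = ls" "distinct (concat css)"
      "set (concat css) \<subseteq> {1..d}" "\<sigma> = foldr (\<circ>) (map cycle_of_list css) id"
      using hl unfolding has_cycle_lengths_def by (elim exE conjE)
    show ?thesis
      using card_points_in_orbits[OF css(2) \<open>n \<ge> 2\<close>] unfolding css(1) css(4)[symmetric] by simp
  qed
  show "count (mset ls) n = count (mset ls') n"
  proof (cases "n \<ge> 2")
    case True
    then have "n * count (mset ls) n = n * count (mset ls') n"
      using c[OF assms(1) True] c[OF assms(2) True] by simp
    then show ?thesis using True by simp
  next
    case False
    then have "n \<notin> set ls" "n \<notin> set ls'" using assms(3,4) by auto
    then show ?thesis by (metis count_eq_zero_iff set_mset_mset)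
  qed
qed

lemma split_list_lengths:
  assumes "length xs = sum_list ls"
  shows "\<exists>css. map length css = ls \<and> concat css = xs"
  using assms
proof (induction ls arbitrary: xs)
  case Nil
  then show ?case by simp
next
  case (Cons l ls)
  then have "length (drop l xs) = sum_list ls" using Cons.prems by simp
  from Cons.IH[OF this] obtain css where "map length css = ls" "concat css = drop l xs" by blast
  then show ?case using Cons.prems by (intro exI[of _ "take l xs # css"]) simp
qed

lemma has_cycle_lengths_exists:
  assumes "sum_list ls \<le> d"
  obtains \<rho> where "\<rho> permutes {1..d}" "has_cycle_lengths d ls \<rho>"
proof -
  let ?xs = "[1..<Suc (sum_list ls)]"
  have "length ?xs = sum_list ls" by (simp del: upt_Suc)
  then obtain css where css: "map length css = ls" "concat css = ?xs"
    using split_list_lengths by blast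
  define \<rho> where "\<rho> = foldr (\<circ>) (map cycle_of_list css) id"
  have sub: "set (concat css) \<subseteq> {1..d}" unfolding css(2) using assms by auto
  have "\<rho> permutes {1..d}"
    unfolding \<rho>_def by (rule permutes_subset[OF product_of_cycles_permutes sub])
  moreover have "distinct (concat css)" unfolding css(2) by (rule distinct_upt)
  then have "has_cycle_lengths d ls \<rho>"
    unfolding has_cycle_lengths_def \<rho>_def using css(1) sub by (intro exI[of _ css] conjI refl)
  ultimately show ?thesis by (rule that)
qed

definition homogeneous :: "nat \<Rightarrow> nat \<Rightarrow> ((nat \<Rightarrow> nat) \<Rightarrow> rat) \<Rightarrow> bool" where
  "homogeneous d k f \<longleftrightarrow> (\<forall>\<rho>. f \<rho> \<noteq> 0 \<longrightarrow> perm_norm d \<rho> = k)"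

lemma homogeneous_cycle_class_sum:
  "homogeneous d (\<Sum>l\<leftarrow>ls. l - 1) (cycle_class_sum d ls)"
  unfolding homogeneous_def
proof (intro allI impI)
  fix \<rho> assume "cycle_class_sum d ls \<rho> \<noteq> 0"
  then have "has_cycle_lengths d ls \<rho>" by (simp add: cycle_class_sum_eq split: if_splits)
  then obtain css where css: "map length css = ls" "distinct (concat css)"
    "set (concat css) \<subseteq> {1..d}" "\<rho> = foldr (\<circ>) (map cycle_of_list css) id"
    unfolding has_cycle_lengths_def by (elim exE conjE)
  have "(\<Sum>l\<leftarrow>ls. l - 1) = (\<Sum>cs\<leftarrow>css. length cs - 1)"
    unfolding css(1)[symmetric] by (simp only: list.map_comp comp_def)
  then show "perm_norm d \<rho> = (\<Sum>l\<leftarrow>ls. l - 1)"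
    unfolding css(4) perm_norm_product_of_cycles[OF css(2,3)] by simp
qed

lemma homogeneous_gmul:
  assumes "homogeneous d i f" "homogeneous d j g"
  shows "homogeneous d (i + j) (gmul d f g)"
  unfolding homogeneous_def
proof (intro allI impI)
  fix \<rho> assume "gmul d f g \<rho> \<noteq> 0"
  then obtain \<sigma> \<tau> where "f \<sigma> \<noteq> 0" "g \<tau> \<noteq> 0" "perm_norm d \<rho> = perm_norm d \<sigma> + perm_norm d \<tau>"
    by (rule gmul_nonzeroE)
  then show "perm_norm d \<rho> = i + j" using assms by (simp add: homogeneous_def)
qed

global_interpretation fun_space: vector_space "\<lambda>(c::rat) (f::(nat \<Rightarrow> nat) \<Rightarrow> rat) \<rho>. c * f \<rho>"
  by standard (simp_all add: fun_eq_iff algebra_simps)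

definition sorted_parts :: "nat \<Rightarrow> nat list set" where
  "sorted_parts k = {ys. sorted ys \<and> 0 \<notin> set ys \<and> sum_list ys = k}"

lemma length_le_sum_list: "0 \<notin> set ys \<Longrightarrow> length ys \<le> sum_list (ys :: nat list)"
  by (induction ys) auto

lemma finite_sorted_parts: "finite (sorted_parts k)"
proof (rule finite_subset)
  show "sorted_parts k \<subseteq> {ys. set ys \<subseteq> {..k} \<and> length ys \<le> k}"
    using length_le_sum_list member_le_sum_list by (force simp: sorted_parts_def)
  show "finite {ys. set ys \<subseteq> {..k} \<and> length ys \<le> k}"
    by (rule finite_lists_length_le) simp
qed

text \<open>A partition of \<open>k\<close> with parts \<open>ys\<close> needs \<open>k + length ys \<le> 2 k\<close> points for its cycles, so in this range of
  norms every partition is realised.\<close>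

lemma class_sum_witness:
  assumes "ys \<in> sorted_parts k" "2 * k \<le> d"
  obtains \<rho> where "cycle_class_sum d (map Suc ys) \<rho> = 1"
    "\<And>zs. zs \<in> sorted_parts k \<Longrightarrow> zs \<noteq> ys \<Longrightarrow> cycle_class_sum d (map Suc zs) \<rho> = 0"
proof -
  have "sum_list (map Suc ys) = sum_list ys + length ys" by (induction ys) auto
  then have "sum_list (map Suc ys) \<le> d"
    using assms length_le_sum_list[of ys] by (auto simp: sorted_parts_def)
  then obtain \<rho> where \<rho>: "\<rho> permutes {1..d}" "has_cycle_lengths d (map Suc ys) \<rho>"
    by (rule has_cycle_lengths_exists)
  have "zs = ys" if zs: "zs \<in> sorted_parts k" and h: "has_cycle_lengths d (map Suc zs) \<rho>" for zs
  proof -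
    have "mset (map Suc zs) = mset (map Suc ys)"
      by (rule cycle_lengths_unique[OF h \<rho>(2)])
        (use zs assms(1) in \<open>auto simp: sorted_parts_def Suc_le_eq numeral_2_eq_2 intro: gr0I\<close>)
    then have "image_mset Suc (mset zs) = image_mset Suc (mset ys)" by simp
    then have "mset zs = mset ys" by (rule injD[OF multiset.inj_map[OF inj_Suc]])
    then have "sort ys = zs"
      by (rule properties_for_sort) (use zs in \<open>simp add: sorted_parts_def\<close>)
    then show ?thesis using assms(1) by (simp add: sorted_parts_def sorted_sort_id)
  qed
  then show ?thesis using \<rho> by (intro that[of \<rho>]) (auto simp: cycle_class_sum_eq)
qed

lemma class_sums_independent:
  assumes "2 * k \<le> d"
  shows "fun_space.independent ((\<lambda>ys. cycle_class_sum d (map Suc ys)) ` sorted_parts k)"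
    "inj_on (\<lambda>ys. cycle_class_sum d (map Suc ys)) (sorted_parts k)"
proof -
  let ?C = "\<lambda>ys. cycle_class_sum d (map Suc ys)"
  show "inj_on ?C (sorted_parts k)"
  proof (rule inj_onI)
    fix ys zs assume *: "ys \<in> sorted_parts k" "zs \<in> sorted_parts k" "?C ys = ?C zs"
    obtain \<rho> where \<rho>: "?C ys \<rho> = 1"
      "\<And>zs. zs \<in> sorted_parts k \<Longrightarrow> zs \<noteq> ys \<Longrightarrow> ?C zs \<rho> = 0"
      by (rule class_sum_witness[OF *(1) assms]) blast
    show "ys = zs"
    proof (rule ccontr)
      assume "ys \<noteq> zs"
      then have "?C zs \<rho> = 0" using \<rho>(2)[OF *(2)] by simp
      then show False using \<rho>(1) *(3) by simp
    qed
  qed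
  show "fun_space.independent (?C ` sorted_parts k)"
    unfolding fun_space.dependent_def
  proof
    assume "\<exists>a\<in>?C ` sorted_parts k. a \<in> fun_space.span (?C ` sorted_parts k - {a})"
    then obtain ys where ys: "ys \<in> sorted_parts k"
      "?C ys \<in> fun_space.span (?C ` sorted_parts k - {?C ys})" by auto
    obtain \<rho> where \<rho>: "?C ys \<rho> = 1"
      "\<And>zs. zs \<in> sorted_parts k \<Longrightarrow> zs \<noteq> ys \<Longrightarrow> ?C zs \<rho> = 0"
      by (rule class_sum_witness[OF ys(1) assms]) blast
    have "fun_space.span (?C ` sorted_parts k - {?C ys}) \<subseteq> {f. f \<rho> = 0}"
    proof (rule fun_space.span_minimal)
      show "?C ` sorted_parts k - {?C ys} \<subseteq> {f. f \<rho> = 0}" using \<rho>(2) by auto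
      show "fun_space.subspace {f. f \<rho> = 0}" by (rule fun_space.subspaceI) auto
    qed
    then have "?C ys \<rho> = 0" using ys(2) by blast
    then show False using \<rho>(1) by simp
  qed
qed

section \<open>Counting monomials\<close>

definition monomial :: "nat \<Rightarrow> (nat \<Rightarrow> (nat \<Rightarrow> nat) \<Rightarrow> rat) \<Rightarrow> nat list \<Rightarrow> (nat \<Rightarrow> nat) \<Rightarrow> rat" where
  "monomial d F xs = foldr (\<lambda>i. gmul d (F i)) xs (basis_vec id)"

lemma monomial_Nil: "monomial d F [] = basis_vec id"
  by (simp add: monomial_def)

lemma monomial_Cons: "monomial d F (i # xs) = gmul d (F i) (monomial d F xs)"
  by (simp add: monomial_def)

lemma monomial_append: "monomial d F (xs @ ys) = gmul d (monomial d F xs) (monomial d F ys)"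
proof -
  have "supported d (monomial d F ys)"
    by (cases ys) (auto simp: monomial_Nil monomial_Cons supported_gmul invariantD[OF basis_vec_id_invariant])
  then show ?thesis
    by (induction xs) (simp_all add: monomial_Nil monomial_Cons gmul_one_left gmul_assoc)
qed

lemma homogeneous_monomial:
  assumes "\<And>i. i \<in> set xs \<Longrightarrow> homogeneous d i (F i)"
  shows "homogeneous d (sum_list xs) (monomial d F xs)"
  using assms
proof (induction xs)
  case Nil
  then show ?case by (simp add: monomial_Nil homogeneous_def basis_vec_def perm_norm_id)
qed (simp add: monomial_Cons homogeneous_gmul)

lemma monomial_sort:
  assumes "\<And>i. i \<in> set xs \<Longrightarrow> invariant d (F i)"
  shows "monomial d F (sort xs) = monomial d F xs"
proof -
  have "fold (\<lambda>i. gmul d (F i)) (rev (sort xs)) = fold (\<lambda>i. gmul d (F i)) (rev xs)"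
  proof (rule fold_multiset_equiv)
    fix i j assume "i \<in> set (rev (sort xs))" "j \<in> set (rev (sort xs))"
    then have "gmul d (F i) (F j) = gmul d (F j) (F i)" using assms by (intro gmul_commute) simp
    then have "gmul d (F i) (gmul d (F j) f) = gmul d (F j) (gmul d (F i) f)" for f
      unfolding gmul_assoc[symmetric] by simp
    then show "gmul d (F i) \<circ> gmul d (F j) = gmul d (F j) \<circ> gmul d (F i)"
      by (intro ext) simp
  qed simp
  then show ?thesis by (simp add: monomial_def foldr_conv_fold)
qed

lemma span_gmul_closed:
  assumes "f \<in> fun_space.span (monomial d F ` {xs. set xs \<subseteq> I})" (is "_ \<in> ?V")
    "g \<in> fun_space.span (monomial d F ` {xs. set xs \<subseteq> I})"
  shows "gmul d f g \<in> fun_space.span (monomial d F ` {xs. set xs \<subseteq> I})"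
proof -
  let ?B = "monomial d F ` {xs. set xs \<subseteq> I}"
  have step: "fun_space.span ?B \<subseteq> {g. gmul d h g \<in> ?V}" if "?B \<subseteq> {g. gmul d h g \<in> ?V}" for h
  proof (rule fun_space.span_minimal[OF that fun_space.subspaceI])
    show "0 \<in> {g. gmul d h g \<in> ?V}"
      using fun_space.span_zero[of ?B] by (simp add: zero_fun_def gmul_zero)
    show "x + y \<in> {g. gmul d h g \<in> ?V}" if "x \<in> {g. gmul d h g \<in> ?V}" "y \<in> {g. gmul d h g \<in> ?V}" for x y
      using that fun_space.span_add[of "gmul d h x" ?B "gmul d h y"]
      by (simp add: plus_fun_def gmul_add_right)
    show "(\<lambda>\<rho>. c * x \<rho>) \<in> {g. gmul d h g \<in> ?V}" if "x \<in> {g. gmul d h g \<in> ?V}" for c x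
      using that fun_space.span_scale[of "gmul d h x" ?B c] by (simp add: gmul_scale_right)
  qed
  have "fun_space.span ?B \<subseteq> {f. \<forall>g\<in>?V. gmul d f g \<in> ?V}"
  proof (rule fun_space.span_minimal[OF _ fun_space.subspaceI])
    show "?B \<subseteq> {f. \<forall>g\<in>?V. gmul d f g \<in> ?V}"
    proof
      fix h assume "h \<in> ?B"
      then obtain xs where xs: "h = monomial d F xs" "set xs \<subseteq> I" by auto
      have "?B \<subseteq> {g. gmul d h g \<in> ?V}"
      proof
        fix g assume "g \<in> ?B"
        then obtain ys where ys: "g = monomial d F ys" "set ys \<subseteq> I" by auto
        have eq: "gmul d h g = monomial d F (xs @ ys)" unfolding xs ys monomial_append ..
        have "set (xs @ ys) \<subseteq> I" using xs(2) ys(2) by simp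
        then have "gmul d h g \<in> ?B" unfolding eq by (intro imageI CollectI)
        from fun_space.span_base[OF this] show "g \<in> {g. gmul d h g \<in> ?V}" by simp
      qed
      from step[OF this] show "h \<in> {f. \<forall>g\<in>?V. gmul d f g \<in> ?V}" by blast
    qed
    show "0 \<in> {f. \<forall>g\<in>?V. gmul d f g \<in> ?V}"
      using fun_space.span_zero[of ?B] by (simp add: zero_fun_def gmul_zero)
    show "x + y \<in> {f. \<forall>g\<in>?V. gmul d f g \<in> ?V}"
      if "x \<in> {f. \<forall>g\<in>?V. gmul d f g \<in> ?V}" "y \<in> {f. \<forall>g\<in>?V. gmul d f g \<in> ?V}" for x y
    proof (intro CollectI ballI)
      fix g assume "g \<in> ?V"
      then have "gmul d x g \<in> ?V" "gmul d y g \<in> ?V" using that by auto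
      from fun_space.span_add[OF this] show "gmul d (x + y) g \<in> ?V"
        by (simp add: plus_fun_def gmul_add_left)
    qed
    show "(\<lambda>\<rho>. c * x \<rho>) \<in> {f. \<forall>g\<in>?V. gmul d f g \<in> ?V}"
      if "x \<in> {f. \<forall>g\<in>?V. gmul d f g \<in> ?V}" for c x
    proof (intro CollectI ballI)
      fix g assume "g \<in> ?V"
      then have "gmul d x g \<in> ?V" using that by auto
      from fun_space.span_scale[OF this] show "gmul d (\<lambda>\<rho>. c * x \<rho>) g \<in> ?V"
        by (simp add: gmul_scale_left)
    qed
  qed
  then show ?thesis using assms by blast
qed

lemma subalg_subset_span:
  "subalg d (F ` I) \<subseteq> fun_space.span (monomial d F ` {xs. set xs \<subseteq> I})"
  if inv: "\<And>i. i \<in> I \<Longrightarrow> invariant d (F i)"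
proof
  let ?B = "monomial d F ` {xs. set xs \<subseteq> I}"
  fix f assume "f \<in> subalg d (F ` I)"
  then show "f \<in> fun_space.span ?B"
  proof (induction rule: subalg_induct)
    case one
    have "basis_vec id = monomial d F []" by (simp add: monomial_Nil)
    then have "basis_vec id \<in> ?B" by auto
    then show ?case by (rule fun_space.span_base)
  next
    case (incl f)
    then obtain i where i: "i \<in> I" "f = F i" by auto
    have "monomial d F [i] = F i"
      unfolding monomial_Cons monomial_Nil gmul_commute[OF basis_vec_id_invariant]
      using inv[OF i(1)] by (intro gmul_one_left invariantD)
    then have "f \<in> ?B" using i by (intro image_eqI[of _ _ "[i]"]) auto
    then show ?case by (rule fun_space.span_base)
  next
    case (add f g)
    then show ?case using fun_space.span_add[of f ?B g] by (simp add: plus_fun_def)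
  next
    case (gmul f g)
    then show ?case by (intro span_gmul_closed)
  next
    case (scale f c)
    then show ?case using fun_space.span_scale[of f ?B c] by simp
  qed
qed

definition norm_part :: "nat \<Rightarrow> nat \<Rightarrow> ((nat \<Rightarrow> nat) \<Rightarrow> rat) \<Rightarrow> (nat \<Rightarrow> nat) \<Rightarrow> rat" where
  "norm_part d k f \<rho> = (if perm_norm d \<rho> = k then f \<rho> else 0)"

lemma norm_part_homogeneous: "homogeneous d j f \<Longrightarrow> norm_part d k f = (if j = k then f else 0)"
  by (auto simp: homogeneous_def norm_part_def fun_eq_iff)

text \<open>Compare dimensions in norm \<open>k\<close>. There is one class sum for each partition of \<open>k\<close>, and these are
  independent, while the monomials of norm \<open>k\<close> in the other generators are indexed by the partitions of \<open>k\<close> other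
  than \<open>[k]\<close> itself.\<close>

lemma not_generating:
  assumes inv: "\<And>i. i \<in> {1..m} \<Longrightarrow> invariant d (F i)"
    and hom: "\<And>i. i \<in> {1..m} \<Longrightarrow> homogeneous d i (F i)"
    and k: "k \<in> {1..m}" and d: "2 * m \<le> d"
  shows "\<not> {f. invariant d f} \<subseteq> subalg d (F ` ({1..m} - {k}))"
proof
  assume gen: "{f. invariant d f} \<subseteq> subalg d (F ` ({1..m} - {k}))"
  let ?I = "{1..m} - {k}"
  let ?B = "monomial d F ` {xs. set xs \<subseteq> ?I}"
  let ?C = "\<lambda>ys. cycle_class_sum d (map Suc ys)"
  let ?Q = "sorted_parts k - {[k]}"
  let ?W = "fun_space.span (monomial d F ` ?Q)"
  have "fun_space.span ?B \<subseteq> {f. norm_part d k f \<in> ?W}"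
  proof (rule fun_space.span_minimal[OF _ fun_space.subspaceI])
    show "?B \<subseteq> {f. norm_part d k f \<in> ?W}"
    proof
      fix f assume "f \<in> ?B"
      then obtain xs where xs: "f = monomial d F xs" "set xs \<subseteq> ?I" by auto
      have "homogeneous d (sum_list xs) f"
        unfolding xs(1) using xs(2) hom by (intro homogeneous_monomial) auto
      note part = norm_part_homogeneous[OF this, of k]
      show "f \<in> {f. norm_part d k f \<in> ?W}"
      proof (cases "sum_list xs = k")
        case True
        have "sum_list (sort xs) = sum_list xs" by (metis mset_sort sum_mset_sum_list)
        moreover have "k \<notin> set xs" "0 \<notin> set xs" using xs(2) by auto
        ultimately have "sort xs \<in> ?Q"
          using True by (auto simp: sorted_parts_def) (metis list.set_intros(1) set_sort)
        moreover have "f = monomial d F (sort xs)"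
          unfolding xs(1) using xs(2) inv by (intro monomial_sort[symmetric]) auto
        ultimately have "f \<in> ?W" by (intro fun_space.span_base) auto
        then show ?thesis using part True by simp
      next
        case False
        then show ?thesis using part fun_space.span_zero by simp
      qed
    qed
    have "norm_part d k 0 = 0" by (simp add: norm_part_def fun_eq_iff)
    then show "0 \<in> {f. norm_part d k f \<in> ?W}" using fun_space.span_zero by simp
    show "x + y \<in> {f. norm_part d k f \<in> ?W}"
      if "x \<in> {f. norm_part d k f \<in> ?W}" "y \<in> {f. norm_part d k f \<in> ?W}" for x y
    proof -
      have "norm_part d k (x + y) = norm_part d k x + norm_part d k y"
        by (simp add: norm_part_def fun_eq_iff)
      then show ?thesis using that fun_space.span_add by simp
    qed
    show "(\<lambda>\<rho>. c * x \<rho>) \<in> {f. norm_part d k f \<in> ?W}" if "x \<in> {f. norm_part d k f \<in> ?W}" for c x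
    proof -
      have "norm_part d k (\<lambda>\<rho>. c * x \<rho>) = (\<lambda>\<rho>. c * norm_part d k x \<rho>)"
        by (simp add: norm_part_def fun_eq_iff)
      then show ?thesis using that fun_space.span_scale[of "norm_part d k x" _ c] by simp
    qed
  qed
  then have part: "norm_part d k f \<in> ?W" if "invariant d f" for f
    using that gen subalg_subset_span[of ?I d F] inv by blast
  have sub: "?C ` sorted_parts k \<subseteq> ?W"
  proof
    fix f assume "f \<in> ?C ` sorted_parts k"
    then obtain ys where ys: "ys \<in> sorted_parts k" "f = ?C ys" by auto
    have "(\<Sum>l\<leftarrow>map Suc ys. l - 1) = k"
      using ys(1) by (simp add: sorted_parts_def comp_def)
    then have "norm_part d k f = f"
      using norm_part_homogeneous[OF homogeneous_cycle_class_sum[of d "map Suc ys"], of k] ys(2) by simp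
    then show "f \<in> ?W" using part[of f] cycle_class_sum_invariant ys(2) by metis
  qed
  have k2: "2 * k \<le> d" using k d by auto
  have finQ: "finite ?Q" using finite_sorted_parts by simp
  have "card (?C ` sorted_parts k) \<le> card (monomial d F ` ?Q)"
    using fun_space.independent_span_bound[OF _ class_sums_independent(1)[OF k2] sub] finQ by simp
  also have "\<dots> \<le> card ?Q" by (rule card_image_le[OF finQ])
  also have "\<dots> < card (sorted_parts k)"
    by (rule card_Diff1_less[OF finite_sorted_parts]) (use k in \<open>auto simp: sorted_parts_def\<close>)
  finally show False using card_image[OF class_sums_independent(2)[OF k2]] by simp
qed

lemma minimal_if_homogeneous:
  assumes inv: "\<And>i. i \<in> {1..m} \<Longrightarrow> invariant d (F i)"
    and hom: "\<And>i. i \<in> {1..m} \<Longrightarrow> homogeneous d i (F i)" and d: "2 * m \<le> d"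
    and gen: "generates_algebra (invariant_algebra d) (F ` {1..m})"
  shows "minimal_generating_set (invariant_algebra d) (F ` {1..m})"
  unfolding minimal_generating_set_def
proof (intro conjI allI impI gen notI)
  fix T assume T: "T \<subset> F ` {1..m}" and genT: "generates_algebra (invariant_algebra d) T"
  then obtain f where "f \<in> F ` {1..m}" "f \<notin> T" by blast
  then obtain k where k: "k \<in> {1..m}" "F k \<notin> T" by blast
  then have sub: "T \<subseteq> F ` ({1..m} - {k})" using T by auto
  have "{f. invariant d f} \<subseteq> subalg d T"
    using genT unfolding generates_algebra_def carrier_invariant_algebra by simp
  also have "\<dots> \<subseteq> subalg d (F ` ({1..m} - {k}))"
    using sub by (intro subalg_subset) (auto intro: subalgebra_generated.incl)
  finally show False using not_generating[OF inv hom k(1) d] by blast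
qed

theorem mainTheorem3:
  fixes d m :: nat
  assumes "d \<ge> 2" and "m = d div 2"
  shows "minimal_generating_set (invariant_algebra d) (gamma_elt d ` {2..m+1})
       \<and> minimal_generating_set (invariant_algebra d) (delta_elt d ` {1..m})"
proof
  have "{2..m+1} = Suc ` {1..m}" by (simp add: numeral_2_eq_2)
  then have \<gamma>: "gamma_elt d ` {2..m+1} = (\<lambda>i. gamma_elt d (Suc i)) ` {1..m}"
    by (simp only: image_image)
  show "minimal_generating_set (invariant_algebra d) (gamma_elt d ` {2..m+1})"
    unfolding \<gamma>
  proof (rule minimal_if_homogeneous)
    show "homogeneous d i (gamma_elt d (Suc i))" for i
      using homogeneous_cycle_class_sum[of d "[Suc i]"] by (simp add: gamma_elt_def)
    show "generates_algebra (invariant_algebra d) ((\<lambda>i. gamma_elt d (Suc i)) ` {1..m})"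
      using gammas_generate[of d] unfolding assms(2)[symmetric] \<gamma> .
  qed (use assms(2) gamma_elt_invariant in auto)
  show "minimal_generating_set (invariant_algebra d) (delta_elt d ` {1..m})"
  proof (rule minimal_if_homogeneous)
    show "homogeneous d i (delta_elt d i)" for i
      using homogeneous_cycle_class_sum[of d "replicate i 2"]
      by (simp add: delta_elt_def sum_list_replicate)
    show "generates_algebra (invariant_algebra d) (delta_elt d ` {1..m})"
      using deltas_generate[of d] unfolding assms(2)[symmetric] .
  qed (use assms(2) delta_elt_invariant in auto)
qed

end
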